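(* Let $d\ge 2$ and $1\le k<d$ be integers. Let $f$ be a probability density on $\mathbb{R}^d$ that is almost everywhere bounded and continuous, and let $s_n>0$ satisfy $\rho_n:=n^{k+2}s_n^{d(k+1)}=1$ for all $n$. Let $\mathcal{P}_n$ be a Poisson process on $\mathbb{R}^d$ with intensity measure $nf(x)\,dx$ and let $\beta_{k,n}(t)=\beta_k\big(\check{C}(\mathcal{P}_n,s_nt)\big)$, $t>0$. Then for every $m\in\mathbb{N}$ and $0<t_1<t_2<\dots<t_m<\infty$, $$\big(\beta_{k,n}(t_i),\ i=1,\dots,m\big)\Rightarrow\big(\mathcal{V}_k(t_i),\ i=1,\dots,m\big)$$ weakly in $\mathbb{R}^m$ as $n\to\infty$, where $\mathcal{V}_k(t)=\int_{\mathbb{R}^{d(k+1)}}h_t(0,\mathbf{y})\,M_k(d\mathbf{y})$.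
   Context: Notation. $B(x;r)=\{y\in\mathbb{R}^d:|x-y|<r\}$. For a set of points $\mathcal{X}\subset\mathbb{R}^d$ and $t>0$, the Čech complex $\check{C}(\mathcal{X},t)$ is the simplicial complex whose $0$-simplices are the points of $\mathcal{X}$ and in which $[x_{i_0},\dots,x_{i_p}]$ is a $p$-simplex iff $\bigcap_{j=0}^pB(x_{i_j};t/2)\ne\emptyset$. $\beta_k(X)$ denotes the $k$th Betti number, i.e. the rank of the $k$th homology group $H_k(X)$. For $x_1,\dots,x_{k+2}\in\mathbb{R}^d$, $h_t(x_1,\dots,x_{k+2})$ is the indicator that $\check{C}(\{x_1,\dots,x_{k+2}\},t)$ contains all possible $k$-simplices on these $k+2$ points but not the $(k+1)$-simplex; equivalently $$h_t(x_1,\dots,x_{k+2})=\prod_{i=1}^{k+2}\mathbf{1}\Big\{\bigcap_{j\ne i}B(x_j;t/2)\neq\emptyset\Big\}-\mathbf{1}\Big\{\bigcap_{j=1}^{k+2}B(x_j;t/2)\ne\emptyset\Big\}.$$ For $\mathbf{y}=(y_1,\dots,y_{k+1})\in\mathbb{R}^{d(k+1)}$, $h_t(0,\mathbf{y})=h_t(0,y_1,\dots,y_{k+1})$. $m_k$ denotes Lebesgue measure on $\mathbb{R}^{d(k+1)}$ and $C_{f,k}=\frac{1}{(k+2)!}\int_{\mathbb{R}^d}f(x)^{k+2}\,dx$. $M_k$ is a Poisson random measure on $\mathbb{R}^{d(k+1)}$ with mean measure $C_{f,k}m_k$: $M_k(A)\sim\mathrm{Poi}(C_{f,k}m_k(A))$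 for measurable $A$, with $M_k(A_1),\dots,M_k(A_m)$ independent for disjoint $A_1,\dots,A_m$. *)

theory Defs
  imports
    "HOL-Probability.Probability"
    "HOL-Algebra.Coset"
    "HOL-Algebra.FiniteProduct"
    "HOL-Combinatorics.Permutations"
    "HOL-Library.Extended_Nat"
begin

section \<open>Simplicial homology with integer coefficients\<close>

text \<open>
  A simplicial complex is given by its set of simplices, each simplex being the finite nonempty set
  of its vertices. A list of distinct vertices stands for the simplex they span, oriented by the
  order of the list; two orderings of one simplex have the same orientation iff they differ by an
  even permutation. A \<open>p\<close>-chain is a finitely supported integer function on oriented \<open>p\<close>-simplices
  that changes sign when the orientation is reversed.
\<close>

definition simplicial_chains :: "'a set set \<Rightarrow> nat \<Rightarrow> ('a list \<Rightarrow> int) set" where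
  "simplicial_chains K p =
    {c. finite {xs. c xs \<noteq> 0} \<and>
        (\<forall>xs. c xs \<noteq> 0 \<longrightarrow> distinct xs \<and> length xs = Suc p \<and> set xs \<in> K) \<and>
        (\<forall>xs \<pi>. \<pi> permutes {..<length xs} \<longrightarrow> c (permute_list \<pi> xs) = sign \<pi> * c xs)}"

text \<open>
  For an oriented simplex \<open>[x\<^sub>0,\<dots>,x\<^sub>p]\<close> the boundary is the sum of
  \<open>(-1)\<^sup>i [x\<^sub>0,\<dots>,x\<^sub>i\<^sub>-\<^sub>1,x\<^sub>i\<^sub>+\<^sub>1,\<dots>,x\<^sub>p]\<close>. The coefficient of the oriented simplex \<open>ys\<close> in the
  boundary of \<open>c\<close> is therefore the sum of the coefficients in \<open>c\<close> of the simplices obtained by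
  putting one further vertex in front of \<open>ys\<close>. The value at the empty list is \<open>0\<close> because the
  complex is not augmented: the boundary of a \<open>0\<close>-chain is \<open>0\<close>.
\<close>

definition simplicial_boundary :: "('a list \<Rightarrow> int) \<Rightarrow> 'a list \<Rightarrow> int" where
  "simplicial_boundary c ys = (if ys = [] then 0 else (\<Sum>x | c (x # ys) \<noteq> 0. c (x # ys)))"

definition simplicial_cycles :: "'a set set \<Rightarrow> nat \<Rightarrow> ('a list \<Rightarrow> int) set" where
  "simplicial_cycles K p = {c \<in> simplicial_chains K p. simplicial_boundary c = (\<lambda>_. 0)}"

definition simplicial_boundaries :: "'a set set \<Rightarrow> nat \<Rightarrow> ('a list \<Rightarrow> int) set" where
  "simplicial_boundaries K p = simplicial_boundary ` simplicial_chains K (Suc p)"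

definition cycle_group :: "'a set set \<Rightarrow> nat \<Rightarrow> ('a list \<Rightarrow> int) monoid" where
  "cycle_group K p =
    \<lparr>carrier = simplicial_cycles K p, mult = (\<lambda>c d xs. c xs + d xs), one = (\<lambda>_. 0)\<rparr>"

definition simplicial_homology_group :: "'a set set \<Rightarrow> nat \<Rightarrow> ('a list \<Rightarrow> int) set monoid" where
  "simplicial_homology_group K p = cycle_group K p Mod simplicial_boundaries K p"

definition int_independent :: "('g, 'm) monoid_scheme \<Rightarrow> 'g set \<Rightarrow> bool" where
  "int_independent G S \<longleftrightarrow> finite S \<and> S \<subseteq> carrier G \<and>
    (\<forall>a :: 'g \<Rightarrow> int. finprod G (\<lambda>x. x [^]\<^bsub>G\<^esub> a x) S = \<one>\<^bsub>G\<^esub> \<longrightarrow> (\<forall>x\<in>S. a x = 0))"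

definition abelian_rank :: "('g, 'm) monoid_scheme \<Rightarrow> enat" where
  "abelian_rank G = (SUP S \<in> {S. int_independent G S}. enat (card S))"

text \<open>The rank is always finite for a complex with finitely many simplices.\<close>

definition betti_number :: "nat \<Rightarrow> 'a set set \<Rightarrow> nat" where
  "betti_number p K = the_enat (abelian_rank (simplicial_homology_group K p))"

section \<open>Cech complexes\<close>

definition cech_complex :: "'a::metric_space set \<Rightarrow> real \<Rightarrow> 'a set set" where
  "cech_complex X t =
    {\<sigma>. finite \<sigma> \<and> \<sigma> \<noteq> {} \<and> \<sigma> \<subseteq> X \<and> (\<Inter>x\<in>\<sigma>. ball x (t / 2)) \<noteq> {}}"

text \<open>
  The \<open>k + 2\<close> points are indexed from \<open>0\<close>: only \<open>x 0, \<dots>, x (k + 1)\<close> matter.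
\<close>

definition cech_h :: "nat \<Rightarrow> real \<Rightarrow> (nat \<Rightarrow> 'a::metric_space) \<Rightarrow> real" where
  "cech_h k t x =
    (\<Prod>i<k+2. of_bool ((\<Inter>j\<in>{..<k+2} - {i}. ball (x j) (t / 2)) \<noteq> {})) -
    of_bool ((\<Inter>j<k+2. ball (x j) (t / 2)) \<noteq> {})"

section \<open>Poisson random measures and Poisson processes\<close>

text \<open>
  The Poisson law on \<open>[0,\<infinity>]\<close>, with the usual conventions that it is degenerate for the parameters
  \<open>0\<close> and \<open>\<infinity>\<close>; \<open>poisson_pmf\<close> is only specified for positive real parameters.
\<close>

definition poisson_law :: "ennreal \<Rightarrow> ennreal measure" where
  "poisson_law r =
    (if r = 0 \<or> r = \<infinity> then return borel r
     else distr (measure_pmf (poisson_pmf (enn2real r))) borel of_nat)"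

definition poisson_random_measure ::
    "'w measure \<Rightarrow> ('w \<Rightarrow> 'b measure) \<Rightarrow> 'b measure \<Rightarrow> bool" where
  "poisson_random_measure \<Omega> N \<mu> \<longleftrightarrow>
    prob_space \<Omega> \<and>
    (\<forall>\<omega>\<in>space \<Omega>. sets (N \<omega>) = sets \<mu>) \<and>
    (\<forall>A\<in>sets \<mu>. (\<lambda>\<omega>. emeasure (N \<omega>) A) \<in> borel_measurable \<Omega> \<and>
       distr \<Omega> borel (\<lambda>\<omega>. emeasure (N \<omega>) A) = poisson_law (emeasure \<mu> A)) \<and>
    (\<forall>(m::nat) A. (\<forall>i<m. A i \<in> sets \<mu>) \<longrightarrow> disjoint_family_on A {..<m} \<longrightarrow>
       prob_space.indep_vars \<Omega> (\<lambda>_. borel) (\<lambda>i \<omega>. emeasure (N \<omega>) (A i)) {..<m})"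

text \<open>
  A Poisson process is a random set of points. The associated random measure assigns to a Borel set
  \<open>A\<close> the number of points of the process in \<open>A\<close>.
\<close>

definition poisson_process ::
    "'w measure \<Rightarrow> ('w \<Rightarrow> 'b::topological_space set) \<Rightarrow> 'b measure \<Rightarrow> bool" where
  "poisson_process \<Omega> P \<mu> \<longleftrightarrow>
    poisson_random_measure \<Omega> (\<lambda>\<omega>. distr (count_space (P \<omega>)) borel (\<lambda>x. x)) \<mu>"

section \<open>Weak convergence of random elements\<close>

text \<open>
  The random elements may live on different probability spaces. They are only required to be
  measurable with respect to the completed \<open>\<sigma>\<close>-algebras, so that modifying them on null sets is
  harmless; \<open>integral\<^sup>L (completion M)\<close> agrees with \<open>integral\<^sup>L M\<close> on functions measurable for \<open>M\<close>.
\<close>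

definition converges_weakly ::
    "(nat \<Rightarrow> 'w measure) \<Rightarrow> (nat \<Rightarrow> 'w \<Rightarrow> 'c::metric_space) \<Rightarrow> 'v measure \<Rightarrow> ('v \<Rightarrow> 'c) \<Rightarrow> bool" where
  "converges_weakly M X M' Y \<longleftrightarrow>
    (\<forall>\<^sub>F n in sequentially. X n \<in> borel_measurable (completion (M n))) \<and>
    Y \<in> borel_measurable (completion M') \<and>
    (\<forall>g :: 'c \<Rightarrow> real. continuous_on UNIV g \<longrightarrow> bounded (range g) \<longrightarrow>
      (\<lambda>n. integral\<^sup>L (completion (M n)) (\<lambda>\<omega>. g (X n \<omega>)))
        \<longlonglongrightarrow> integral\<^sup>L (completion M') (\<lambda>\<omega>. g (Y \<omega>)))"

end

theory Submission
  imports Defs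
begin

text \<open>
  Only sets of \<open>k + 2\<close> points matter when \<open>\<rho>\<^sub>n = 1\<close>: with probability close to \<open>1\<close> no
  \<open>k + 3\<close> points of \<open>\<P>\<^sub>n\<close> are linked at scale \<open>s\<^sub>n\<close>, and then the Betti number is the
  number of hollow \<open>(k + 1)\<close>-simplices. Cut the space into blocks of side \<open>J\<close> times the
  interaction range, with a shift for which the boundary layers of the blocks have mass \<open>O(1/J)\<close>.
  Up to a small error every hollow simplex sits inside one of finitely many blocks, each block
  contains at most one, and the blocks are independent, so that the joint Laplace transform of the
  Betti numbers becomes a product over blocks of \<open>1 - p\<^sub>q\<close>, where \<open>p\<^sub>q\<close> is an integral over
  \<open>(k + 2)\<close>-tuples in the block. The sum of the \<open>p\<^sub>q\<close> is computed in coordinates relative to the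
  first point; since \<open>f\<close> is a.e. continuous, it converges by dominated convergence to the exponent
  in the Laplace functional of the limiting Poisson measure. Random vectors with values in the
  nonnegative integer lattice converge weakly when their Laplace transforms do, by the
  Stone-Weierstrass theorem.
\<close>

section \<open>Ranks of abelian groups\<close>

text \<open>Put \<open>u = n * s ^ d\<close>. The normalisation says
  \<open>n * u ^ (k + 1) = 1\<close>, so \<open>u\<close> tends to 0, and a region at the
  interaction scale has mass of order \<open>u\<close>. Events with \<open>k + 3\<close> nearby
  points then have total probability of order \<open>n * u ^ (k + 2) = u\<close>. A group of
  \<open>k + 2\<close> points near the seam between blocks costs
  \<open>n * u ^ (k + 1) / J = 1 / J\<close>, which does not vanish with \<open>n\<close>; hence
  \<open>n\<close> tends to infinity for fixed \<open>J\<close>, and \<open>J\<close> is sent to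
  infinity afterwards. The second obstacle is that a Poisson process is known only through its
  counts of Borel sets, whereas Betti numbers depend on the points. Every functional is obtained as
  a limit over dyadic grids: points are replaced by cell corners and radii are shrunk a little,
  which eventually changes neither the complex, up to relabelling, nor any hollow simplex. Laplace
  transforms are compared at natural exponents only. Under \<open>z = exp (- x)\<close> they become
  expectations of monomials on the unit cube; the faces of the cube that correspond to infinite
  \<open>x\<close> are dealt with by showing that point masses converge and that no mass
  escapes.\<close>

lemma int_relation_exists:
  fixes v :: "'s \<Rightarrow> 'i \<Rightarrow> int"
  assumes "finite I" "finite S" "card I < card S"
  shows "\<exists>a. (\<exists>x\<in>S. a x \<noteq> 0) \<and> (\<forall>i\<in>I. (\<Sum>x\<in>S. a x * v x i) = 0)"
  using assms
proof (induction I arbitrary: S v rule: finite_induct)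
  case empty
  then have "S \<noteq> {}" by auto
  then show ?case by (intro exI[of _ "\<lambda>_. 1"]) auto
next
  case (insert i I)
  show ?case
  proof (cases "\<forall>x\<in>S. v x i = 0")
    case True
    from insert.IH[of S v] insert.prems insert.hyps obtain a where
      "\<exists>x\<in>S. a x \<noteq> 0" "\<forall>i\<in>I. (\<Sum>x\<in>S. a x * v x i) = 0" by auto
    with True show ?thesis by (intro exI[of _ a]) auto
  next
    case False
    then obtain x0 where x0: "x0 \<in> S" "v x0 i \<noteq> 0" by auto
    define S' where "S' = S - {x0}"
    have S: "S = insert x0 S'" "x0 \<notin> S'" "finite S'"
      using x0 insert.prems by (auto simp: S'_def)
    have "card I < card S'" using S insert.prems insert.hyps by simp
    \<comment> \<open>Coordinate \<open>i\<close> is eliminated against the pivot \<open>x0\<close>;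
      cross-multiplication replaces division, which the integers do not allow.\<close>
    from insert.IH[OF S(3) this, of "\<lambda>x l. v x0 i * v x l - v x i * v x0 l"]
    obtain a where a: "\<exists>x\<in>S'. a x \<noteq> 0"
      "\<And>l. l \<in> I \<Longrightarrow> (\<Sum>x\<in>S'. a x * (v x0 i * v x l - v x i * v x0 l)) = 0" by auto
    \<comment> \<open>Back substitution: the coefficients are scaled by the pivot entry, and the
      coefficient of \<open>x0\<close> cancels coordinate \<open>i\<close>.\<close>
    define b where "b = (\<lambda>x. if x = x0 then - (\<Sum>x\<in>S'. a x * v x i) else a x * v x0 i)"
    have "(\<Sum>x\<in>S. b x * v x l) = (\<Sum>x\<in>S'. a x * (v x0 i * v x l - v x i * v x0 l))" for l
    proof -
      have "(\<Sum>x\<in>S'. b x * v x l) = (\<Sum>x\<in>S'. a x * v x0 i * v x l)"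
        using S by (intro sum.cong) (auto simp: b_def)
      then show ?thesis using S
        by (simp add: b_def sum_distrib_left sum_distrib_right sum_subtractf sum_negf algebra_simps)
    qed
    then have "(\<Sum>x\<in>S. b x * v x l) = 0" if "l \<in> insert i I" for l
      using that a(2) by (cases "l = i") auto
    moreover have "\<exists>x\<in>S. b x \<noteq> 0" using a(1) x0 S by (auto simp: b_def)
    ultimately show ?thesis by blast
  qed
qed

text \<open>For infinite \<open>I\<close> this is the full product of copies of the integers rather
  than a free group; the rank is computed only for finite \<open>I\<close>.\<close>

definition free_ab :: "'i set \<Rightarrow> ('i \<Rightarrow> int) monoid" where
  "free_ab I = \<lparr>carrier = {f. \<forall>i. i \<notin> I \<longrightarrow> f i = 0}, mult = (\<lambda>f g i. f i + g i), one = (\<lambda>_. 0)\<rparr>"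

lemma comm_group_free_ab: "comm_group (free_ab I)"
proof (rule comm_groupI)
  fix x assume "x \<in> carrier (free_ab I)"
  then show "\<exists>y\<in>carrier (free_ab I). y \<otimes>\<^bsub>free_ab I\<^esub> x = \<one>\<^bsub>free_ab I\<^esub>"
    by (intro bexI[of _ "\<lambda>i. - x i"]) (auto simp: free_ab_def)
qed (auto simp: free_ab_def)

interpretation free_ab: comm_group "free_ab I" for I
  by (rule comm_group_free_ab)

lemma free_ab_int_pow:
  assumes "x \<in> carrier (free_ab I)"
  shows "x [^]\<^bsub>free_ab I\<^esub> (a::int) = (\<lambda>i. a * x i)"
proof -
  have nat: "x [^]\<^bsub>free_ab I\<^esub> (n::nat) = (\<lambda>i. int n * x i)" for n
    by (induction n) (auto simp: free_ab_def algebra_simps)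
  have inv: "inv\<^bsub>free_ab I\<^esub> y = (\<lambda>i. - y i)" if "y \<in> carrier (free_ab I)" for y
    using that by (intro free_ab.inv_equality) (auto simp: free_ab_def)
  show ?thesis
    unfolding int_pow_def2 using assms
    by (auto simp: nat inv free_ab.nat_pow_closed) (subst inv, auto simp: free_ab_def)
qed

lemma free_ab_finprod:
  assumes "finite S" "\<And>s. s \<in> S \<Longrightarrow> g s \<in> carrier (free_ab I)"
  shows "finprod (free_ab I) g S = (\<lambda>i. \<Sum>s\<in>S. g s i)"
  using assms
proof (induction rule: finite_induct)
  case empty
  have "\<one>\<^bsub>free_ab I\<^esub> = (\<lambda>_. 0)" by (simp add: free_ab_def)
  then show ?case by simp
next
  case (insert s S)
  then have "finprod (free_ab I) g (insert s S) = g s \<otimes>\<^bsub>free_ab I\<^esub> finprod (free_ab I) g S"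
    by (intro free_ab.finprod_insert) auto
  with insert show ?case by (simp add: free_ab_def)
qed

lemma int_independent_free_ab_iff:
  "int_independent (free_ab I) S \<longleftrightarrow> finite S \<and> S \<subseteq> carrier (free_ab I) \<and>
    (\<forall>a. (\<forall>i. (\<Sum>x\<in>S. a x * x i) = 0) \<longrightarrow> (\<forall>x\<in>S. a x = 0))"
proof (cases "finite S \<and> S \<subseteq> carrier (free_ab I)")
  case True
  have "finprod (free_ab I) (\<lambda>x. x [^]\<^bsub>free_ab I\<^esub> (a x :: int)) S = (\<lambda>i. \<Sum>x\<in>S. a x * x i)" for a
  proof -
    have "finprod (free_ab I) (\<lambda>x. x [^]\<^bsub>free_ab I\<^esub> a x) S = (\<lambda>i. \<Sum>x\<in>S. (x [^]\<^bsub>free_ab I\<^esub> a x) i)"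
      using True by (intro free_ab_finprod) (auto intro!: free_ab.int_pow_closed)
    also have "\<dots> = (\<lambda>i. \<Sum>x\<in>S. a x * x i)"
      using True by (intro ext sum.cong) (auto simp: free_ab_int_pow)
    finally show ?thesis .
  qed
  moreover have "\<one>\<^bsub>free_ab I\<^esub> = (\<lambda>_. 0)" by (simp add: free_ab_def)
  ultimately show ?thesis using True by (simp add: int_independent_def fun_eq_iff)
next
  case False
  then show ?thesis by (auto simp: int_independent_def)
qed

lemma abelian_rank_free_ab:
  assumes "finite I"
  shows "abelian_rank (free_ab I) = enat (card I)"
  unfolding abelian_rank_def
proof (rule antisym)
  show "(SUP S \<in> {S. int_independent (free_ab I) S}. enat (card S)) \<le> enat (card I)"
  proof (rule SUP_least, clarsimp)
    fix S assume S: "int_independent (free_ab I) S"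
    show "card S \<le> card I"
    proof (rule ccontr)
      assume "\<not> card S \<le> card I"
      then obtain a where a: "\<exists>x\<in>S. a x \<noteq> 0" "\<forall>i\<in>I. (\<Sum>x\<in>S. a x * x i) = 0"
        using int_relation_exists[of I S "\<lambda>x. x"] assms S by (auto simp: int_independent_def)
      have "(\<Sum>x\<in>S. a x * x i) = 0" for i
      proof (cases "i \<in> I")
        case False
        then show ?thesis using S
          by (intro sum.neutral) (auto simp: int_independent_def free_ab_def)
      qed (use a in auto)
      with S a(1) show False by (auto simp: int_independent_free_ab_iff)
    qed
  qed
  define e :: "'a \<Rightarrow> 'a \<Rightarrow> int" where "e = (\<lambda>i j. of_bool (i = j))"
  have inj: "inj_on e I" by (rule inj_onI) (auto simp: e_def fun_eq_iff of_bool_def split: if_splits)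
  have "int_independent (free_ab I) (e ` I)"
    unfolding int_independent_free_ab_iff
  proof (intro conjI allI impI ballI)
    fix a x assume a: "\<forall>i. (\<Sum>x\<in>e ` I. a x * x i) = 0" and "x \<in> e ` I"
    then obtain i where i: "i \<in> I" "x = e i" by auto
    have "0 = (\<Sum>j\<in>I. a (e j) * e j i)"
      using a inj by (simp add: sum.reindex)
    also have "\<dots> = (\<Sum>j\<in>I. if j = i then a (e j) else 0)"
      by (intro sum.cong) (auto simp: e_def)
    also have "\<dots> = a (e i)"
      using i assms by simp
    finally show "a x = 0" using i by simp
  qed (use assms in \<open>auto simp: e_def free_ab_def\<close>)
  then show "enat (card I) \<le> (SUP S \<in> {S. int_independent (free_ab I) S}. enat (card S))"
    using inj by (intro SUP_upper2[of "e ` I"]) (auto simp: card_image)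
qed

section \<open>Invariance of the rank under isomorphism\<close>

lemma int_independent_iso:
  assumes G: "comm_group G" and H: "comm_group H" and h: "h \<in> iso G H" and S: "int_independent G S"
  shows "int_independent H (h ` S)" "card (h ` S) = card S"
proof -
  interpret G: comm_group G by fact
  interpret H: comm_group H by fact
  have hom: "h \<in> hom G H" and bij: "bij_betw h (carrier G) (carrier H)"
    using h by (auto simp: iso_def)
  interpret h: group_hom G H h by unfold_locales (rule hom)
  have S': "finite S" "S \<subseteq> carrier G" using S by (auto simp: int_independent_def)
  have inj: "inj_on h (carrier G)" using bij by (auto simp: bij_betw_def)
  have injS: "inj_on h S" using inj S'(2) by (rule inj_on_subset)
  then show "card (h ` S) = card S" by (rule card_image)
  have fin: "h (finprod G g S) = finprod H (\<lambda>x. h (g x)) S" if "g \<in> S \<rightarrow> carrier G" for g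
    using S'(1) that
  proof (induction rule: finite_induct)
    case (insert s S)
    then show ?case by (subst G.finprod_insert H.finprod_insert; force)+
  qed auto
  show "int_independent H (h ` S)"
    unfolding int_independent_def
  proof (intro conjI allI impI ballI)
    fix a :: "_ \<Rightarrow> int" and y assume a: "finprod H (\<lambda>x. x [^]\<^bsub>H\<^esub> a x) (h ` S) = \<one>\<^bsub>H\<^esub>" and "y \<in> h ` S"
    then obtain x where x: "x \<in> S" "y = h x" by auto
    have "finprod H (\<lambda>x. x [^]\<^bsub>H\<^esub> a x) (h ` S) = finprod H (\<lambda>x. h x [^]\<^bsub>H\<^esub> a (h x)) S"
      using S' injS by (subst H.finprod_reindex) auto
    also have "\<dots> = finprod H (\<lambda>x. h (x [^]\<^bsub>G\<^esub> a (h x))) S"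
      using S' by (intro H.finprod_cong) (auto simp: h.hom_int_pow simp_implies_def subset_iff)
    also have "\<dots> = h (finprod G (\<lambda>x. x [^]\<^bsub>G\<^esub> a (h x)) S)"
      using S' by (subst fin) auto
    finally have "h (finprod G (\<lambda>x. x [^]\<^bsub>G\<^esub> a (h x)) S) = h \<one>\<^bsub>G\<^esub>" using a by simp
    then have "finprod G (\<lambda>x. x [^]\<^bsub>G\<^esub> a (h x)) S = \<one>\<^bsub>G\<^esub>"
      using inj S' by (elim inj_onD) (auto intro!: G.finprod_closed)
    then show "a y = 0" using S x unfolding int_independent_def by auto
  qed (use S' in auto)
qed

lemma abelian_rank_iso:
  assumes G: "comm_group G" and H: "comm_group H" and h: "h \<in> iso G H"
  shows "abelian_rank G = abelian_rank H"
proof -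
  \<comment> \<open>Generalised over the two groups, since it is applied to the isomorphism and to
    its inverse.\<close>
  have le: "abelian_rank A \<le> abelian_rank B"
    if "comm_group A" "comm_group B" "g \<in> iso A B" for A :: "('x, 'y) monoid_scheme" and B :: "('z, 'w) monoid_scheme" and g
    unfolding abelian_rank_def
  proof (rule SUP_least, clarsimp)
    fix S assume "int_independent A S"
    from int_independent_iso[OF that this]
    show "enat (card S) \<le> (SUP S \<in> {S. int_independent B S}. enat (card S))"
      by (intro SUP_upper2[of "g ` S"]) auto
  qed
  have "group G" using G by (simp add: comm_group_def)
  from le[OF G H h] le[OF H G group.iso_set_sym[OF this h]] show ?thesis by simp
qed

section \<open>Chains and boundaries\<close>

lemma permute_list_transpose_Suc:
  assumes "Suc i < length xs"
  shows "permute_list (Transposition.transpose (Suc i) (Suc (Suc i))) (x # xs) = x # permute_list (Transposition.transpose i (Suc i)) xs"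
  using assms
  by (intro nth_equalityI) (auto simp: permute_list_def nth_Cons Transposition.transpose_def simp del: upt_Suc split: nat.splits)

lemma permute_list_transpose_0:
  "permute_list (Transposition.transpose 0 (Suc 0)) (x # y # xs) = y # x # xs"
  by (intro nth_equalityI) (auto simp: permute_list_def nth_Cons Transposition.transpose_def simp del: upt_Suc split: nat.splits)

text \<open>Adjacent transpositions generate the symmetric group, so for the chains constructed
  below the sign rule has to be checked only where two neighbouring entries change places.\<close>

lemma alternating_if_adjacent:
  fixes c :: "'a list \<Rightarrow> int"
  assumes adj: "\<And>xs i. Suc i < length xs \<Longrightarrow> c (permute_list (Transposition.transpose i (Suc i)) xs) = - c xs"
    and \<pi>: "\<pi> permutes {..<length xs}"
  shows "c (permute_list \<pi> xs) = sign \<pi> * c xs"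
proof -
  have perm: "Transposition.transpose i j permutes {..<n}" if "i < n" "j < n" for i j n :: nat
    using that by (intro permutes_swap_id) auto
  have tr: "c (permute_list (Transposition.transpose a b) xs) = - c xs" if "a < b" "b < length xs" for a b xs
    using that
  proof (induction b arbitrary: xs)
    case (Suc b)
    show ?case
    proof (cases "a = b")
      case False
      then have ab: "a < b" using Suc.prems by simp
      \<comment> \<open>Conjugation by an adjacent transposition brings the two positions closer
        together; three sign changes amount to one.\<close>
      have eq: "Transposition.transpose a (Suc b) = Transposition.transpose b (Suc b) \<circ> (Transposition.transpose a b \<circ> Transposition.transpose b (Suc b))"
        using ab by (auto simp: fun_eq_iff Transposition.transpose_def)
      have p: "Transposition.transpose b (Suc b) permutes {..<length xs}" "Transposition.transpose a b permutes {..<length xs}"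
        using Suc.prems ab by (auto intro!: perm)
      have "c (permute_list (Transposition.transpose a (Suc b)) xs) =
        c (permute_list (Transposition.transpose b (Suc b)) (permute_list (Transposition.transpose a b) (permute_list (Transposition.transpose b (Suc b)) xs)))"
        unfolding eq using p by (simp add: permute_list_compose permutes_compose)
      also have "\<dots> = - c xs"
        using Suc ab by (simp add: adj)
      finally show ?thesis .
    qed (use Suc.prems adj in auto)
  qed simp
  have "\<forall>ys. length ys = length xs \<longrightarrow> c (permute_list \<pi> ys) = sign \<pi> * c ys"
    using \<pi> finite_lessThan
  proof (induction rule: permutes_induct)
    case (swap a b p)
    have "c (permute_list (Transposition.transpose a b) ys) = - c ys" if "length ys = length xs" for ys
    proof (cases "a < b")
      case True
      then show ?thesis using tr[of a b ys] swap that by auto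
    next
      case False
      then show ?thesis using tr[of b a ys] swap that by (auto simp: transpose_commute)
    qed
    moreover have "permutation p" using swap by (auto simp: permutation_permutes)
    ultimately show ?case using swap
      by (auto simp: permute_list_compose sign_compose permutation_swap_id sign_swap_id simp del: comp_apply simp flip: comp_def)
  qed (auto simp del: id_apply)
  then show ?thesis by simp
qed

lemma chain_permute:
  assumes "c \<in> simplicial_chains K p" "\<pi> permutes {..<length xs}"
  shows "c (permute_list \<pi> xs) = sign \<pi> * c xs"
  using assms by (auto simp: simplicial_chains_def)

lemma chain_adjacent:
  assumes "c \<in> simplicial_chains K p" "Suc i < length xs"
  shows "c (permute_list (Transposition.transpose i (Suc i)) xs) = - c xs"
proof -
  have "Transposition.transpose i (Suc i) permutes {..<length xs}"
    using assms by (intro permutes_swap_id) auto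
  from chain_permute[OF assms(1) this] show ?thesis by (simp add: sign_swap_id)
qed

lemma chain_swap:
  assumes "c \<in> simplicial_chains K p"
  shows "c (x # y # xs) = - c (y # x # xs)"
  using chain_adjacent[OF assms, of 0 "y # x # xs"] by (simp add: permute_list_transpose_0)

lemma chain_nonzero_mset:
  assumes "c \<in> simplicial_chains K p" "mset xs = mset ys" "c xs \<noteq> 0"
  shows "c ys \<noteq> 0"
proof -
  obtain f where "f permutes {..<length ys}" "permute_list f ys = xs"
    using mset_eq_permutation[OF assms(2)] by blast
  with chain_permute[OF assms(1), of f ys] assms(3) show ?thesis by auto
qed

lemma chain_support:
  assumes "c \<in> simplicial_chains K p" "c xs \<noteq> 0"
  shows "distinct xs" "length xs = Suc p" "set xs \<in> K"
  using assms by (auto simp: simplicial_chains_def)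

lemma chain_finite: "c \<in> simplicial_chains K p \<Longrightarrow> finite {xs. c xs \<noteq> 0}"
  by (auto simp: simplicial_chains_def)

lemma chainI:
  assumes "finite {xs. c xs \<noteq> 0}"
    and "\<And>xs. c xs \<noteq> 0 \<Longrightarrow> distinct xs \<and> length xs = Suc p \<and> set xs \<in> K"
    and "\<And>xs i. Suc i < length xs \<Longrightarrow> c (permute_list (Transposition.transpose i (Suc i)) xs) = - c xs"
  shows "c \<in> simplicial_chains K p"
  unfolding simplicial_chains_def
  using assms(1,2) alternating_if_adjacent[of c, OF assms(3)] by blast

lemma finite_heads: "finite {xs. c xs \<noteq> (0::int)} \<Longrightarrow> finite {x. c (x # ys) \<noteq> 0}"
  using finite_vimageI[of "{xs. c xs \<noteq> 0}" "\<lambda>x. x # ys"] by (simp add: vimage_def inj_on_def)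

text \<open>The defining sum runs over a support that depends on the chain and on the list; a common
  finite index set allows sums to be added and interchanged.\<close>

lemma simplicial_boundary_eq_sum:
  assumes "finite A" "{x. c (x # ys) \<noteq> 0} \<subseteq> A" "ys \<noteq> []"
  shows "simplicial_boundary c ys = (\<Sum>x\<in>A. c (x # ys))"
  unfolding simplicial_boundary_def using assms by (auto intro!: sum.mono_neutral_left)

lemma simplicial_boundary_add:
  assumes "finite {xs. c xs \<noteq> 0}" "finite {xs. d xs \<noteq> 0}"
  shows "simplicial_boundary (\<lambda>xs. c xs + d xs) = (\<lambda>ys. simplicial_boundary c ys + simplicial_boundary d ys)"
proof
  fix ys :: "'a list"
  show "simplicial_boundary (\<lambda>xs. c xs + d xs) ys = simplicial_boundary c ys + simplicial_boundary d ys"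
  proof (cases "ys = []")
    case False
    let ?A = "{x. c (x # ys) \<noteq> 0} \<union> {x. d (x # ys) \<noteq> 0}"
    have "finite ?A" using assms by (auto intro: finite_heads)
    with False show ?thesis
      by (subst (1 2 3) simplicial_boundary_eq_sum[of ?A]) (auto simp: sum.distrib)
  qed (simp add: simplicial_boundary_def)
qed

lemma simplicial_boundary_uminus:
  "simplicial_boundary (\<lambda>xs. - c xs) = (\<lambda>ys. - simplicial_boundary c ys)"
  by (auto simp: simplicial_boundary_def fun_eq_iff sum_negf)

lemma chain_add:
  assumes "c \<in> simplicial_chains K p" "d \<in> simplicial_chains K p"
  shows "(\<lambda>xs. c xs + d xs) \<in> simplicial_chains K p"
proof (rule chainI)
  show "finite {xs. c xs + d xs \<noteq> 0}"
    by (rule finite_subset[of _ "{xs. c xs \<noteq> 0} \<union> {xs. d xs \<noteq> 0}"]) (use assms in \<open>auto intro: chain_finite\<close>)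
  show "distinct xs \<and> length xs = Suc p \<and> set xs \<in> K" if "c xs + d xs \<noteq> 0" for xs
    using that chain_support[OF assms(1), of xs] chain_support[OF assms(2), of xs] by (cases "c xs = 0") auto
qed (simp add: assms[THEN chain_adjacent])

lemma chain_uminus:
  assumes "c \<in> simplicial_chains K p"
  shows "(\<lambda>xs. - c xs) \<in> simplicial_chains K p"
  using assms chain_support[OF assms]
  by (intro chainI) (auto intro: chain_finite simp: chain_adjacent)

lemma chain_zero: "(\<lambda>_. 0) \<in> simplicial_chains K p"
  by (rule chainI) auto

lemma simplicial_boundary_zero: "simplicial_boundary (\<lambda>_. 0) = (\<lambda>_. 0)"
  by (auto simp: simplicial_boundary_def)

lemma comm_group_cycle_group: "comm_group (cycle_group K p)"
proof (rule comm_groupI)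
  fix x assume "x \<in> carrier (cycle_group K p)"
  then show "\<exists>y\<in>carrier (cycle_group K p). y \<otimes>\<^bsub>cycle_group K p\<^esub> x = \<one>\<^bsub>cycle_group K p\<^esub>"
    by (intro bexI[of _ "\<lambda>xs. - x xs"])
      (auto simp: cycle_group_def simplicial_cycles_def chain_uminus simplicial_boundary_uminus)
qed (auto simp: cycle_group_def simplicial_cycles_def chain_add chain_zero simplicial_boundary_zero
  simplicial_boundary_add chain_finite algebra_simps)

lemma boundary_chain:
  assumes c: "c \<in> simplicial_chains K (Suc p)"
    and down: "\<And>\<sigma> \<tau>. \<sigma> \<in> K \<Longrightarrow> \<tau> \<subseteq> \<sigma> \<Longrightarrow> \<tau> \<noteq> {} \<Longrightarrow> \<tau> \<in> K"
  shows "simplicial_boundary c \<in> simplicial_chains K p"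
proof (rule chainI)
  have ex: "\<exists>x. c (x # ys) \<noteq> 0 \<and> ys \<noteq> []" if "simplicial_boundary c ys \<noteq> 0" for ys
  proof (rule ccontr)
    assume "\<not> ?thesis"
    then have "simplicial_boundary c ys = 0" by (auto simp: simplicial_boundary_def)
    with that show False by simp
  qed
  then have "{ys. simplicial_boundary c ys \<noteq> 0} \<subseteq> tl ` {xs. c xs \<noteq> 0}" by force
  then show "finite {xs. simplicial_boundary c xs \<noteq> 0}"
    using chain_finite[OF c] by (auto intro: finite_subset)
  show "distinct ys \<and> length ys = Suc p \<and> set ys \<in> K" if nz: "simplicial_boundary c ys \<noteq> 0" for ys
  proof -
    obtain x where x: "c (x # ys) \<noteq> 0" "ys \<noteq> []" using ex[OF nz] by auto
    note s = chain_support[OF c x(1)]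
    have "set ys \<in> K" by (rule down[OF s(3)]) (use x(2) in auto)
    then show ?thesis using s by simp
  qed
  show "simplicial_boundary c (permute_list (Transposition.transpose i (Suc i)) ys) = - simplicial_boundary c ys"
    if "Suc i < length ys" for ys i
  proof -
    have "c (x # permute_list (Transposition.transpose i (Suc i)) ys) = - c (x # ys)" for x
      using chain_adjacent[OF c, of "Suc i" "x # ys"] that by (simp add: permute_list_transpose_Suc)
    moreover have "permute_list (Transposition.transpose i (Suc i)) ys \<noteq> []" "ys \<noteq> []"
      using that by (auto simp flip: length_greater_0_conv)
    ultimately show ?thesis by (simp add: simplicial_boundary_def sum_negf)
  qed
qed

text \<open>The double boundary sums \<open>c (y # x # ys)\<close> over ordered pairs of vertices.
  Exchanging the two leading vertices changes the sign, so the sum equals its own negative.\<close>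

lemma boundary_boundary:
  assumes c: "c \<in> simplicial_chains K p"
  shows "simplicial_boundary (simplicial_boundary c) = (\<lambda>_. 0)"
proof
  fix ys
  show "simplicial_boundary (simplicial_boundary c) ys = 0"
  proof (cases "ys = []")
    case False
    define A where "A = \<Union>(set ` {xs. c xs \<noteq> 0})"
    have fin: "finite A" using chain_finite[OF c] by (auto simp: A_def)
    have b: "simplicial_boundary c (x # ys) = (\<Sum>y\<in>A. c (y # x # ys))" for x
      by (rule simplicial_boundary_eq_sum[OF fin]) (auto simp: A_def intro!: bexI[of _ "_ # x # ys"] exI[of _ "_ # x # ys"])
    have "simplicial_boundary (simplicial_boundary c) ys = (\<Sum>x\<in>A. \<Sum>y\<in>A. c (y # x # ys))"
    proof (subst simplicial_boundary_eq_sum[OF fin _ False])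
      show "{x. simplicial_boundary c (x # ys) \<noteq> 0} \<subseteq> A"
      proof safe
        fix x assume "simplicial_boundary c (x # ys) \<noteq> 0"
        then obtain y where "c (y # x # ys) \<noteq> 0" unfolding b by (metis sum.neutral)
        then show "x \<in> A" by (auto simp: A_def intro!: exI[of _ "y # x # ys"])
      qed
    qed (simp add: b)
    moreover have "(\<Sum>x\<in>A. \<Sum>y\<in>A. c (y # x # ys)) = - (\<Sum>x\<in>A. \<Sum>y\<in>A. c (y # x # ys))"
    proof -
      have "(\<Sum>x\<in>A. \<Sum>y\<in>A. c (y # x # ys)) = (\<Sum>x\<in>A. \<Sum>y\<in>A. - c (x # y # ys))"
        by (intro sum.cong refl chain_swap[OF c])
      also have "\<dots> = - (\<Sum>y\<in>A. \<Sum>x\<in>A. c (x # y # ys))"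
        by (subst sum.swap) (simp add: sum_negf)
      finally show ?thesis .
    qed
    ultimately show ?thesis by simp
  qed (simp add: simplicial_boundary_def)
qed

section \<open>Homology of clustered complexes\<close>

text \<open>Fixes one orientation for each finite vertex set, so that a chain has a definite integer
  coefficient on it.\<close>

definition orient :: "'a set \<Rightarrow> 'a list" where
  "orient Y = (SOME xs. distinct xs \<and> set xs = Y)"

lemma orient:
  assumes "finite Y" shows "distinct (orient Y)" "set (orient Y) = Y" "length (orient Y) = card Y"
proof -
  have *: "distinct (orient Y) \<and> set (orient Y) = Y"
    unfolding orient_def by (rule someI_ex) (use finite_distinct_list[OF assms] in blast)
  then show "distinct (orient Y)" "set (orient Y) = Y" "length (orient Y) = card Y"
    by (auto simp flip: distinct_card)
qed

text \<open>The oriented simplex \<open>xs\<close> as a chain. The permutation chosen here is unique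
  when \<open>xs\<close> is distinct, which is what \<open>elementary_chain_permute\<close> rests
  on.\<close>

definition elementary_chain :: "'a list \<Rightarrow> 'a list \<Rightarrow> int" where
  "elementary_chain xs zs = (if mset zs = mset xs
    then sign (SOME \<pi>. \<pi> permutes {..<length xs} \<and> permute_list \<pi> xs = zs) else 0)"

lemma elementary_chain_permute:
  assumes "distinct xs" "\<pi> permutes {..<length xs}"
  shows "elementary_chain xs (permute_list \<pi> xs) = sign \<pi>"
proof -
  have "(SOME \<rho>. \<rho> permutes {..<length xs} \<and> permute_list \<rho> xs = permute_list \<pi> xs) = \<pi>"
  proof (rule some_equality)
    fix \<rho> assume \<rho>: "\<rho> permutes {..<length xs} \<and> permute_list \<rho> xs = permute_list \<pi> xs"
    show "\<rho> = \<pi>"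
    proof
      fix i
      show "\<rho> i = \<pi> i"
      proof (cases "i < length xs")
        case True
        then have "xs ! \<rho> i = xs ! \<pi> i"
          using \<rho> assms(2) by (metis permute_list_nth)
        moreover have "\<rho> i < length xs" "\<pi> i < length xs"
          using True \<rho> assms(2) permutes_in_image by (metis lessThan_iff)+
        ultimately show ?thesis using assms(1) nth_eq_iff_index_eq by blast
      next
        case False
        then show ?thesis using \<rho> assms(2) by (auto simp: permutes_def)
      qed
    qed
  qed (use assms in simp)
  then show ?thesis using assms by (simp add: elementary_chain_def)
qed

lemma elementary_chain_adjacent:
  assumes "distinct xs" "Suc i < length zs"
  shows "elementary_chain xs (permute_list (Transposition.transpose i (Suc i)) zs) = - elementary_chain xs zs"
proof -
  have p: "Transposition.transpose i (Suc i) permutes {..<length zs}"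
    using assms by (intro permutes_swap_id) auto
  show ?thesis
  proof (cases "mset zs = mset xs")
    case True
    then obtain \<pi> where \<pi>: "\<pi> permutes {..<length xs}" "permute_list \<pi> xs = zs"
      using mset_eq_permutation by blast
    have p': "Transposition.transpose i (Suc i) permutes {..<length xs}" using p \<pi> by auto
    have "permute_list (Transposition.transpose i (Suc i)) zs = permute_list (\<pi> \<circ> Transposition.transpose i (Suc i)) xs"
      using p' \<pi> by (simp add: permute_list_compose)
    moreover have "sign (\<pi> \<circ> Transposition.transpose i (Suc i)) = - sign \<pi>"
      using \<pi> by (subst sign_compose) (auto simp: permutation_swap_id sign_swap_id intro: permutation_permutes[THEN iffD2])
    ultimately show ?thesis
      using elementary_chain_permute[OF assms(1) \<pi>(1)] \<pi>(2)
        elementary_chain_permute[OF assms(1) permutes_compose[OF p' \<pi>(1)]] by simp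
  next
    case False
    then show ?thesis using p by (simp add: elementary_chain_def)
  qed
qed

lemma elementary_chain_self: "distinct xs \<Longrightarrow> elementary_chain xs xs = 1"
  using elementary_chain_permute[OF _ permutes_id, of xs] by simp

text \<open>
  If the simplices meeting a given one span at most \<open>k + 2\<close> vertices altogether, then a
  \<open>k\<close>-cycle is carried by sets of \<open>k + 2\<close> vertices all of whose facets are simplices, and on the
  facets of such a set it is a multiple of the boundary of the full \<open>(k + 1)\<close>-simplex.
\<close>

locale clustered =
  fixes K :: "'a set set" and k :: nat
  assumes finite_K: "finite K" and finite_simplex: "\<sigma> \<in> K \<Longrightarrow> finite \<sigma>"
    and down: "\<sigma> \<in> K \<Longrightarrow> \<tau> \<subseteq> \<sigma> \<Longrightarrow> \<tau> \<noteq> {} \<Longrightarrow> \<tau> \<in> K"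
    and k: "1 \<le> k"
    and cluster: "\<sigma> \<in> K \<Longrightarrow> card (\<Union>{\<tau> \<in> K. \<tau> \<inter> \<sigma> \<noteq> {}}) \<le> k + 2"
begin

section \<open>Sets of vertices with all facets present\<close>

definition framed :: "'a set set" where
  "framed = {Y. finite Y \<and> card Y = k + 2 \<and> (\<forall>y\<in>Y. Y - {y} \<in> K)}"

abbreviation "hollow \<equiv> framed - K"

lemma cluster_subset:
  assumes "\<sigma> \<in> K" "A \<subseteq> \<Union>{\<tau> \<in> K. \<tau> \<inter> \<sigma> \<noteq> {}}"
  shows "card A \<le> k + 2"
proof -
  have "finite (\<Union>{\<tau> \<in> K. \<tau> \<inter> \<sigma> \<noteq> {}})" using finite_K finite_simplex by auto
  from card_mono[OF this assms(2)] cluster[OF assms(1)] show ?thesis by simp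
qed

lemma framed_subset: "Y \<in> framed \<Longrightarrow> Y \<subseteq> \<Union>K"
proof
  fix y assume Y: "Y \<in> framed" "y \<in> Y"
  then have "Y \<noteq> {y}" using k by (auto simp: framed_def)
  then obtain y' where "y' \<in> Y" "y' \<noteq> y" using Y by auto
  with Y show "y \<in> \<Union>K" by (intro UnionI[of "Y - {y'}"]) (auto simp: framed_def)
qed

lemma finite_framed: "finite framed"
proof (rule finite_subset)
  show "framed \<subseteq> Pow (\<Union>K)" using framed_subset by auto
  show "finite (Pow (\<Union>K))" using finite_K finite_simplex by auto
qed

text \<open>Three different cofaces of \<open>r\<close> would place \<open>k + 3\<close> vertices in
  simplices that meet the first one.\<close>

lemma coface_unique:
  assumes "insert u r \<in> K" "insert v r \<in> K" "insert w r \<in> K" "card r = k" "u \<notin> r" "v \<notin> r" "w \<notin> r"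
  shows "u = v \<or> v = w \<or> u = w"
proof (rule ccontr)
  assume *: "\<not> ?thesis"
  have r: "finite r" "r \<noteq> {}" using assms k by (auto intro: card_ge_0_finite)
  have "card (insert u (insert v (insert w r))) \<le> k + 2"
    by (rule cluster_subset[OF assms(1)]) (use assms r in auto)
  then show False using * assms r by simp
qed

text \<open>Together with the \<open>k + 1\<close> vertices of \<open>\<sigma>\<close>, two
  different outside vertices of simplices meeting \<open>\<sigma>\<close> would make
  \<open>k + 3\<close>.\<close>

lemma neighbours_unique:
  assumes "\<sigma> \<in> K" "card \<sigma> = k + 1" "\<tau> \<in> K" "\<tau>' \<in> K" "\<tau> \<inter> \<sigma> \<noteq> {}" "\<tau>' \<inter> \<sigma> \<noteq> {}"
    "v \<in> \<tau>" "v' \<in> \<tau>'" "v \<notin> \<sigma>" "v' \<notin> \<sigma>"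
  shows "v = v'"
proof (rule ccontr)
  assume *: "v \<noteq> v'"
  have "card (insert v (insert v' \<sigma>)) \<le> k + 2"
    by (rule cluster_subset[OF assms(1)]) (use assms finite_simplex[OF assms(1)] in auto)
  then show False using * assms finite_simplex[OF assms(1)] by simp
qed

lemma framed_face_in_K:
  assumes "Y \<in> framed" "\<sigma> \<subseteq> Y" "card \<sigma> = k + 1"
  obtains v where "v \<in> Y" "v \<notin> \<sigma>" "Y = insert v \<sigma>" "\<sigma> \<in> K" "\<exists>\<tau>\<in>K. v \<in> \<tau> \<and> \<tau> \<inter> \<sigma> \<noteq> {}"
proof -
  have Y: "finite Y" "card Y = k + 2" "\<And>y. y \<in> Y \<Longrightarrow> Y - {y} \<in> K" using assms by (auto simp: framed_def)
  have "card (Y - \<sigma>) = 1" using Y assms by (subst card_Diff_subset) (auto intro: finite_subset)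
  then obtain v where v: "Y - \<sigma> = {v}" by (auto simp: card_1_singleton_iff)
  then have "\<sigma> = Y - {v}" "v \<in> Y" using assms by auto
  moreover have "\<exists>\<tau>\<in>K. v \<in> \<tau> \<and> \<tau> \<inter> \<sigma> \<noteq> {}"
  proof -
    \<comment> \<open>Since \<open>k \<ge> 1\<close>, the facet has a second vertex
      \<open>y\<close>; removing \<open>x\<close> from \<open>Y\<close> leaves a simplex that
      contains both \<open>v\<close> and \<open>y\<close>.\<close>
    have "\<not> card \<sigma> \<le> 1" using assms k by simp
    then obtain x y where xy: "x \<in> \<sigma>" "y \<in> \<sigma>" "x \<noteq> y"
      using card_le_Suc0_iff_eq[of \<sigma>] Y assms by (auto intro: finite_subset)
    then show ?thesis using Y(3)[of x] v assms by (intro bexI[of _ "Y - {x}"]) auto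
  qed
  ultimately show ?thesis using v Y by (intro that[of v]) auto
qed

lemma framed_unique:
  assumes "Y \<in> framed" "Y' \<in> framed" "\<sigma> \<subseteq> Y" "\<sigma> \<subseteq> Y'" "card \<sigma> = k + 1"
  shows "Y = Y'"
proof -
  obtain v where v: "v \<in> Y" "v \<notin> \<sigma>" "Y = insert v \<sigma>" "\<sigma> \<in> K" "\<exists>\<tau>\<in>K. v \<in> \<tau> \<and> \<tau> \<inter> \<sigma> \<noteq> {}"
    using framed_face_in_K[OF assms(1,3,5)] .
  obtain v' where v': "v' \<in> Y'" "v' \<notin> \<sigma>" "Y' = insert v' \<sigma>" "\<sigma> \<in> K" "\<exists>\<tau>\<in>K. v' \<in> \<tau> \<and> \<tau> \<inter> \<sigma> \<noteq> {}"
    using framed_face_in_K[OF assms(2,4,5)] .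
  have "v = v'" using v v' assms neighbours_unique[of \<sigma> _ _ v v'] by blast
  then show ?thesis using v v' by simp
qed

text \<open>A cycle cannot end at \<open>ys\<close>. Across each facet of \<open>ys\<close> another
  simplex has to cancel its contribution to the boundary, and the new vertex is the same for all
  facets because outer neighbours are unique.\<close>

lemma cycle_coface:
  assumes z: "z \<in> simplicial_cycles K k" and ys: "z ys \<noteq> 0"
  obtains v where "v \<notin> set ys" "insert v (set ys) \<in> framed"
proof -
  have zc: "z \<in> simplicial_chains K k" and zb: "\<And>r. simplicial_boundary z r = 0"
    using z by (auto simp: simplicial_cycles_def)
  have sup: "distinct ys" "length ys = Suc k" "set ys \<in> K" using chain_support[OF zc ys] by auto
  have card: "card (set ys) = k + 1" using sup by (simp add: distinct_card)
  have ex: "\<exists>v. v \<notin> set ys \<and> insert v (set ys - {y}) \<in> K" if y: "y \<in> set ys" for y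
  proof -
    define r where "r = remove1 y ys"
    have r: "z (y # r) \<noteq> 0" using y by (intro chain_nonzero_mset[OF zc _ ys]) (simp add: r_def)
    have set_r: "set r = set ys - {y}" and len: "length r = k"
      using sup y by (simp_all add: r_def length_remove1)
    have "r \<noteq> []" using len k by auto
    have "\<exists>v. v \<noteq> y \<and> z (v # r) \<noteq> 0"
    proof (rule ccontr)
      assume "\<not> ?thesis"
      then have "{x. z (x # r) \<noteq> 0} = {y}" using r by auto
      then have "simplicial_boundary z r = z (y # r)" using \<open>r \<noteq> []\<close> by (simp add: simplicial_boundary_def)
      then show False using zb r by simp
    qed
    then obtain v where v: "v \<noteq> y" "z (v # r) \<noteq> 0" by auto
    from chain_support[OF zc v(2)] v(1) set_r y show ?thesis by auto
  qed
  have meets: "insert v (set ys - {y}) \<inter> set ys \<noteq> {}" if "y \<in> set ys" for v y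
  proof
    assume "insert v (set ys - {y}) \<inter> set ys = {}"
    then have "set ys = {y}" using that by auto
    then show False using card k by simp
  qed
  have "set ys \<noteq> {}" using sup by auto
  then obtain y0 where y0: "y0 \<in> set ys" by (metis all_not_in_conv)
  \<comment> \<open>The vertex found for one facet turns out to serve for all of them.\<close>
  from ex[OF y0] obtain v where v: "v \<notin> set ys" "insert v (set ys - {y0}) \<in> K" by auto
  have "insert v (set ys - {y}) \<in> K" if y: "y \<in> set ys" for y
  proof -
    from ex[OF y] obtain v' where v': "v' \<notin> set ys" "insert v' (set ys - {y}) \<in> K" by auto
    have "v = v'"
      by (rule neighbours_unique[OF sup(3) card v(2) v'(2)]) (use meets y y0 v v' in auto)
    then show ?thesis using v' by simp
  qed
  then have "insert v (set ys) \<in> framed"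
    using v sup card by (auto simp: framed_def insert_Diff_if)
  then show ?thesis using v that by auto
qed

text \<open>The candidate for a \<open>(k + 1)\<close>-chain with boundary \<open>z\<close>. It
  lives on framed sets, and is a chain of \<open>K\<close> only if it vanishes on the hollow
  ones.\<close>

definition filler :: "('a list \<Rightarrow> int) \<Rightarrow> 'a list \<Rightarrow> int" where
  "filler z zs = (if distinct zs \<and> set zs \<in> framed then z (tl zs) else 0)"

lemma framed_list: "distinct zs \<Longrightarrow> set zs \<in> framed \<Longrightarrow> length zs = k + 2"
  by (auto simp: framed_def distinct_card)

text \<open>Transpositions behind the head are inherited from \<open>z\<close>. Exchanging the first
  two entries passes to another facet, and there the sign comes from the cycle condition at the
  common face \<open>r\<close>, whose only possible cofaces are these two facets.\<close>

lemma filler_adjacent: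
  assumes z: "z \<in> simplicial_cycles K k" and i: "Suc i < length zs"
  shows "filler z (permute_list (Transposition.transpose i (Suc i)) zs) = - filler z zs"
proof -
  have zc: "z \<in> simplicial_chains K k" and zb: "\<And>r. simplicial_boundary z r = 0"
    using z by (auto simp: simplicial_cycles_def)
  have p: "Transposition.transpose i (Suc i) permutes {..<length zs}"
    using i by (intro permutes_swap_id) auto
  show ?thesis
  proof (cases "distinct zs \<and> set zs \<in> framed")
    case True
    then have len: "length zs = k + 2" using framed_list by auto
    then obtain x u r where zs: "zs = x # u # r" by (metis Suc_length_conv add_2_eq_Suc')
    have r: "length r = k" "distinct (x # u # r)" using len True zs by auto
    have "z (tl (permute_list (Transposition.transpose i (Suc i)) zs)) = - z (tl zs)"
    proof (cases i)
      case 0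
      have "r \<noteq> []" using r k by auto
      have eq: "insert x (set r) = set zs - {u}" "insert u (set r) = set zs - {x}"
        using zs r by auto
      have faces: "set zs - {y} \<in> K" if "y \<in> set zs" for y
        using True that by (simp add: framed_def)
      have K: "insert x (set r) \<in> K" "insert u (set r) \<in> K"
        unfolding eq by (rule faces; simp add: zs)+
      have "{x'. z (x' # r) \<noteq> 0} \<subseteq> {x, u}"
      proof
        fix x' assume "x' \<in> {x'. z (x' # r) \<noteq> 0}"
        then have nz: "z (x' # r) \<noteq> 0" by simp
        have "insert x' (set r) \<in> K" "x' \<notin> set r" using chain_support[OF zc nz] by auto
        moreover have "card (set r) = k" "x \<notin> set r" "u \<notin> set r" "x \<noteq> u" using r by (auto simp: distinct_card)
        ultimately show "x' \<in> {x, u}" using coface_unique[OF K(1) K(2), of x'] by auto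
      qed
      then have "simplicial_boundary z r = (\<Sum>x'\<in>{x, u}. z (x' # r))"
        using \<open>r \<noteq> []\<close> by (intro simplicial_boundary_eq_sum) auto
      then have "z (x # r) + z (u # r) = 0" using r zb by simp
      then show ?thesis using zs 0 by (simp add: permute_list_transpose_0)
    next
      case (Suc j)
      then show ?thesis using zs i chain_adjacent[OF zc, of j "u # r"]
        by (simp add: permute_list_transpose_Suc)
    qed
    then show ?thesis using True p by (simp add: filler_def)
  next
    case False
    then show ?thesis using p by (auto simp: filler_def)
  qed
qed

lemma filler_support: "filler z zs \<noteq> 0 \<Longrightarrow> distinct zs \<and> length zs = k + 2 \<and> set zs \<in> framed"
  using framed_list by (auto simp: filler_def split: if_splits)

lemma finite_filler: "finite {zs. filler z zs \<noteq> 0}"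
proof (rule finite_subset)
  show "{zs. filler z zs \<noteq> 0} \<subseteq> {zs. set zs \<subseteq> \<Union>K \<and> length zs = k + 2}"
    using filler_support framed_subset by blast
  show "finite {zs. set zs \<subseteq> \<Union>K \<and> length zs = k + 2}"
    using finite_K finite_simplex by (intro finite_lists_length_eq) auto
qed

text \<open>By \<open>framed_unique\<close> a simplex in the support of \<open>z\<close> lies in
  only one framed set, so each boundary sum has a single term.\<close>

lemma boundary_filler:
  assumes z: "z \<in> simplicial_cycles K k"
  shows "simplicial_boundary (filler z) = z"
proof
  fix ys
  have zc: "z \<in> simplicial_chains K k" using z by (auto simp: simplicial_cycles_def)
  show "simplicial_boundary (filler z) ys = z ys"
  proof (cases "z ys = 0")
    case True
    then show ?thesis by (auto simp: simplicial_boundary_def filler_def intro: sum.neutral)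
  next
    case False
    obtain v where v: "v \<notin> set ys" "insert v (set ys) \<in> framed" using cycle_coface[OF z False] .
    have ys: "distinct ys" "length ys = Suc k" using chain_support[OF zc False] by auto
    have "x = v" if "filler z (x # ys) \<noteq> 0" for x
    proof -
      have x: "x \<notin> set ys" "insert x (set ys) \<in> framed" using filler_support[OF that] by auto
      have "insert x (set ys) = insert v (set ys)"
        by (rule framed_unique[of _ _ "set ys"]) (use x v ys in \<open>auto simp: distinct_card\<close>)
      then show ?thesis using x v by blast
    qed
    then have "simplicial_boundary (filler z) ys = (\<Sum>x\<in>{v}. filler z (x # ys))"
      using ys by (intro simplicial_boundary_eq_sum) auto
    also have "\<dots> = z ys" using v ys by (simp add: filler_def)
    finally show ?thesis .
  qed
qed

text \<open>On the facets of a hollow set a cycle is a multiple of the boundary of the missing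
  simplex. The multiple is read off at the facet opposite the first vertex, where that boundary has
  coefficient 1.\<close>

definition coords :: "('a list \<Rightarrow> int) \<Rightarrow> 'a set \<Rightarrow> int" where
  "coords z Y = (if Y \<in> hollow then z (tl (orient Y)) else 0)"

lemma hollow_tl:
  assumes "Y \<in> framed"
  shows "distinct (tl (orient Y))" "set (tl (orient Y)) \<subseteq> Y" "card (set (tl (orient Y))) = k + 1"
    "orient Y = hd (orient Y) # tl (orient Y)" "tl (orient Y) \<noteq> []"
proof -
  have Y: "finite Y" "card Y = k + 2" using assms by (auto simp: framed_def)
  note o = orient[OF Y(1)]
  then show "distinct (tl (orient Y))" by (simp add: distinct_tl)
  then show "card (set (tl (orient Y))) = k + 1" using o Y by (simp add: distinct_card)
  have ne: "orient Y \<noteq> []" using o Y by auto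
  then show "orient Y = hd (orient Y) # tl (orient Y)" by simp
  show "set (tl (orient Y)) \<subseteq> Y" using ne o list.set_sel(2) by fastforce
  have "length (tl (orient Y)) = k + 1" using o Y by simp
  then show "tl (orient Y) \<noteq> []" by (metis Suc_eq_plus1 list.size(3) nat.distinct(1))
qed

text \<open>The complex with all hollow sets filled in serves two purposes: chains of
  \<open>K\<close> are among its chains, which yields the kernel of \<open>coords\<close>, and its
  further chains yield surjectivity.\<close>

lemma coords_boundary:
  assumes c: "c \<in> simplicial_chains (K \<union> hollow) (Suc k)" and Y: "Y \<in> hollow"
  shows "coords (simplicial_boundary c) Y = c (orient Y)"
proof -
  note o = hollow_tl[of Y]
  have "x = hd (orient Y)" if x: "c (x # tl (orient Y)) \<noteq> 0" for x
  proof -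
    let ?X = "set (x # tl (orient Y))"
    note s = chain_support[OF c x]
    \<comment> \<open>A simplex of \<open>K\<close> with \<open>k + 2\<close> vertices is framed as
      well, so uniqueness of framed sets applies to every coface of the chosen facet.\<close>
    have "?X \<in> framed"
    proof (cases "?X \<in> K")
      case True
      have "?X - {y} \<in> K" if "y \<in> ?X" for y
      proof (rule down[OF True])
        show "?X - {y} \<noteq> {}"
        proof
          assume "?X - {y} = {}"
          then have "?X \<subseteq> {y}" by auto
          then have "card ?X \<le> card {y}" by (intro card_mono) auto
          then show False using s(1,2) by (simp add: distinct_card del: set_simps)
        qed
      qed auto
      then show ?thesis using s by (auto simp: framed_def distinct_card simp del: set_simps)
    qed (use s in auto)
    then have "?X = Y"
      by (rule framed_unique[of _ _ "set (tl (orient Y))"]) (use o Y in auto)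
    moreover have "set (orient Y) = Y" "distinct (orient Y)"
      using Y orient[of Y] by (auto simp: framed_def)
    ultimately show ?thesis using s(1) o(4) Y
      by (metis DiffD1 distinct.simps(2) insert_eq_iff insert_iff list.simps(15))
  qed
  then have "{x. c (x # tl (orient Y)) \<noteq> 0} \<subseteq> {hd (orient Y)}" by auto
  then have "simplicial_boundary c (tl (orient Y)) = (\<Sum>x\<in>{hd (orient Y)}. c (x # tl (orient Y)))"
    using o Y by (intro simplicial_boundary_eq_sum) auto
  then show ?thesis using o Y by (simp add: coords_def)
qed

lemma chains_mono: "K1 \<subseteq> K2 \<Longrightarrow> simplicial_chains K1 p \<subseteq> simplicial_chains K2 p"
  by (auto simp: simplicial_chains_def)

text \<open>If all coordinates vanish, the filler vanishes on hollow sets and is a chain of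
  \<open>K\<close> with boundary \<open>z\<close>. Conversely, a chain of \<open>K\<close> has
  coefficient 0 on every hollow set.\<close>

lemma kernel_coords: "Coset.kernel (cycle_group K k) (free_ab hollow) coords = simplicial_boundaries K k"
proof (intro equalityI subsetI)
  fix z assume "z \<in> Coset.kernel (cycle_group K k) (free_ab hollow) coords"
  then have z: "z \<in> simplicial_cycles K k" and 0: "\<And>Y. coords z Y = 0"
    by (auto simp: kernel_def cycle_group_def free_ab_def fun_eq_iff)
  have "filler z \<in> simplicial_chains K (Suc k)"
  proof (rule chainI)
    fix zs assume nz: "filler z zs \<noteq> 0"
    have s: "distinct zs" "length zs = k + 2" "set zs \<in> framed" using filler_support[OF nz] by auto
    have "set zs \<in> K"
    proof (rule ccontr)
      assume "set zs \<notin> K"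
      then have h: "set zs \<in> hollow" using s by auto
      \<comment> \<open>A coordinate controls the filler at one ordering of the hollow set; the sign
        rule carries this to every ordering.\<close>
      have "mset (orient (set zs)) = mset zs"
        using orient[of "set zs"] s by (simp add: set_eq_iff_mset_eq_distinct)
      then obtain f where f: "f permutes {..<length (orient (set zs))}" "permute_list f (orient (set zs)) = zs"
        using mset_eq_permutation[of zs "orient (set zs)"] by auto
      have "filler z zs = sign f * filler z (orient (set zs))"
        using alternating_if_adjacent[of "filler z", OF filler_adjacent[OF z] f(1)] f(2) by simp
      moreover have "filler z (orient (set zs)) = coords z (set zs)"
        using h orient[of "set zs"] by (simp add: filler_def coords_def)
      ultimately show False using nz 0 by simp
    qed
    then show "distinct zs \<and> length zs = Suc (Suc k) \<and> set zs \<in> K" using s by auto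
  qed (use finite_filler filler_adjacent[OF z] in auto)
  then show "z \<in> simplicial_boundaries K k"
    using boundary_filler[OF z] by (force simp: simplicial_boundaries_def)
next
  fix z assume "z \<in> simplicial_boundaries K k"
  then obtain c where c: "c \<in> simplicial_chains K (Suc k)" "z = simplicial_boundary c"
    by (auto simp: simplicial_boundaries_def)
  have "z \<in> simplicial_cycles K k"
    using boundary_chain[OF c(1) down] boundary_boundary[OF c(1)] c(2) by (auto simp: simplicial_cycles_def)
  moreover have "coords z Y = 0" for Y
  proof (cases "Y \<in> hollow")
    case True
    have "c \<in> simplicial_chains (K \<union> hollow) (Suc k)" using c(1) chains_mono[of K "K \<union> hollow"] by auto
    from coords_boundary[OF this True] have "coords z Y = c (orient Y)" using c by simp
    also have "\<dots> = 0" using chain_support(3)[OF c(1), of "orient Y"] True orient[of Y] by (auto simp: framed_def)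
    finally show ?thesis .
  qed (auto simp: coords_def)
  ultimately show "z \<in> Coset.kernel (cycle_group K k) (free_ab hollow) coords"
    by (simp add: kernel_def cycle_group_def free_ab_def fun_eq_iff del: Diff_iff)
qed

text \<open>Prescribed coordinates are realised by the boundary of a chain of filled hollow
  simplices, which is itself a cycle of \<open>K\<close>.\<close>

lemma coords_onto: "coords ` carrier (cycle_group K k) = carrier (free_ab hollow)"
proof (intro equalityI subsetI)
  fix f assume f: "f \<in> carrier (free_ab hollow)"
  define w where "w zs = (if distinct zs \<and> set zs \<in> hollow then f (set zs) * elementary_chain (orient (set zs)) zs else 0)" for zs
  have w: "w \<in> simplicial_chains (K \<union> hollow) (Suc k)"
  proof (rule chainI)
    have "{zs. w zs \<noteq> 0} \<subseteq> {zs. set zs \<subseteq> \<Union>K \<and> length zs = k + 2}"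
      using framed_list framed_subset by (auto simp: w_def split: if_splits)
    moreover have "finite {zs. set zs \<subseteq> \<Union>K \<and> length zs = k + 2}"
      using finite_K finite_simplex by (intro finite_lists_length_eq) auto
    ultimately show "finite {zs. w zs \<noteq> 0}" by (rule finite_subset)
    show "distinct zs \<and> length zs = Suc (Suc k) \<and> set zs \<in> K \<union> hollow" if "w zs \<noteq> 0" for zs
      using that framed_list[of zs] by (auto simp: w_def split: if_splits)
    show "w (permute_list (Transposition.transpose i (Suc i)) zs) = - w zs" if "Suc i < length zs" for zs i
    proof -
      have "Transposition.transpose i (Suc i) permutes {..<length zs}"
        using that by (intro permutes_swap_id) auto
      then show ?thesis using that orient(1)[of "set zs"]
        by (auto simp: w_def elementary_chain_adjacent)
    qed
  qed
  have b: "simplicial_boundary w \<in> simplicial_chains (K \<union> hollow) k"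
  proof (rule boundary_chain[OF w])
    fix \<sigma> \<tau> assume \<sigma>: "\<sigma> \<in> K \<union> hollow" "\<tau> \<subseteq> \<sigma>" "\<tau> \<noteq> {}"
    show "\<tau> \<in> K \<union> hollow"
    proof (cases "\<sigma> \<in> K \<or> \<tau> = \<sigma>")
      case False
      then obtain y where "y \<in> \<sigma>" "y \<notin> \<tau>" using \<sigma> by auto
      then show ?thesis using False \<sigma> down[of "\<sigma> - {y}" \<tau>] by (auto simp: framed_def)
    qed (use \<sigma> down in auto)
  qed
  \<comment> \<open>The boundary has simplices with \<open>k + 1\<close> vertices, while hollow sets
    have \<open>k + 2\<close>.\<close>
  have "set xs \<in> K" if nz: "simplicial_boundary w xs \<noteq> 0" for xs
  proof -
    have "set xs \<in> K \<union> hollow" "card (set xs) = Suc k"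
      using chain_support[OF b nz] by (auto simp: distinct_card)
    then show ?thesis by (auto simp: framed_def)
  qed
  then have "simplicial_boundary w \<in> simplicial_chains K k"
    using b by (simp add: simplicial_chains_def)
  then have "simplicial_boundary w \<in> carrier (cycle_group K k)"
    using boundary_boundary[OF w] by (auto simp: cycle_group_def simplicial_cycles_def)
  moreover have "coords (simplicial_boundary w) = f"
  proof
    fix Y
    show "coords (simplicial_boundary w) Y = f Y"
    proof (cases "Y \<in> hollow")
      case True
      then have "finite Y" by (auto simp: framed_def)
      from coords_boundary[OF w True] show ?thesis
        using orient[OF \<open>finite Y\<close>] True by (simp add: w_def elementary_chain_self)
    next
      case False
      then show ?thesis using f by (auto simp: coords_def free_ab_def)
    qed
  qed
  ultimately show "f \<in> coords ` carrier (cycle_group K k)" by (intro rev_image_eqI) auto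
qed (auto simp: free_ab_def coords_def)

text \<open>By the first isomorphism theorem \<open>coords\<close> identifies the homology group
  with the free abelian group on the finitely many hollow sets.\<close>

lemma betti_number_eq: "betti_number k K = card hollow"
proof -
  interpret Z: comm_group "cycle_group K k" by (rule comm_group_cycle_group)
  interpret h: group_hom "cycle_group K k" "free_ab hollow" coords
    by unfold_locales (use coords_onto in \<open>auto simp: hom_def cycle_group_def free_ab_def coords_def fun_eq_iff\<close>)
  have iso: "(\<lambda>X. the_elem (coords ` X)) \<in> iso (simplicial_homology_group K k) (free_ab hollow)"
    using h.FactGroup_iso_set[OF coords_onto] by (simp add: simplicial_homology_group_def kernel_coords)
  have "comm_group (simplicial_homology_group K k)"
    unfolding simplicial_homology_group_def
    using Z.abelian_FactGroup h.subgroup_kernel by (simp add: kernel_coords)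
  from abelian_rank_iso[OF this comm_group_free_ab iso] show ?thesis
    using finite_framed by (simp add: betti_number_def abelian_rank_free_ab)
qed

end

section \<open>Invariance under relabelling\<close>

text \<open>The relabelling is a bijection of the whole type, so that arbitrary lists can be pulled
  back. A map that is injective only on the vertices is first extended by
  \<open>inj_on_extend_bij\<close>.\<close>

lemma chain_transport:
  assumes "bij \<phi>" "c \<in> simplicial_chains K p"
  shows "(\<lambda>xs. c (map (inv_into UNIV \<phi>) xs)) \<in> simplicial_chains ((`) \<phi> ` K) p"
  unfolding simplicial_chains_def
proof (safe, goal_cases)
  case 1
  have "{xs. c (map (inv_into UNIV \<phi>) xs) \<noteq> 0} \<subseteq> map \<phi> ` {xs. c xs \<noteq> 0}"
  proof
    fix xs assume "xs \<in> {xs. c (map (inv_into UNIV \<phi>) xs) \<noteq> 0}"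
    then show "xs \<in> map \<phi> ` {xs. c xs \<noteq> 0}"
      using assms(1) by (intro image_eqI[of _ _ "map (inv_into UNIV \<phi>) xs"]) (auto simp: bij_def surj_iff map_idI o_def surj_f_inv_f)
  qed
  then show ?case using chain_finite[OF assms(2)] by (auto intro: finite_subset)
next
  case (2 xs)
  from chain_support(1)[OF assms(2) 2] show ?case by (simp add: distinct_map)
next
  case (3 xs)
  from chain_support(2)[OF assms(2) 3] show ?case by simp
next
  case (4 xs)
  from chain_support(3)[OF assms(2) 4] have "inv_into UNIV \<phi> ` set xs \<in> K" by simp
  moreover have "\<phi> ` inv_into UNIV \<phi> ` set xs = set xs" using assms(1) by (simp add: bij_def image_f_inv_f)
  ultimately show ?case by (metis imageI)
next
  case (5 xs \<pi>)
  then show ?case using chain_permute[OF assms(2), of \<pi> "map (inv_into UNIV \<phi>) xs"]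
    by (simp add: permute_list_map)
qed

lemma boundary_transport:
  assumes "bij \<phi>"
  shows "simplicial_boundary (\<lambda>xs. c (map (inv_into UNIV \<phi>) xs)) = (\<lambda>ys. simplicial_boundary c (map (inv_into UNIV \<phi>) ys))"
proof
  fix ys
  have "bij_betw (inv_into UNIV \<phi>) {x. c (inv_into UNIV \<phi> x # map (inv_into UNIV \<phi>) ys) \<noteq> 0} {x. c (x # map (inv_into UNIV \<phi>) ys) \<noteq> 0}"
    by (rule bij_betwI[of _ _ _ \<phi>]) (use assms in \<open>auto simp: bij_def surj_f_inv_f\<close>)
  from sum.reindex_bij_betw[OF this, of "\<lambda>x. c (x # map (inv_into UNIV \<phi>) ys)"]
  show "simplicial_boundary (\<lambda>xs. c (map (inv_into UNIV \<phi>) xs)) ys = simplicial_boundary c (map (inv_into UNIV \<phi>) ys)"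
    by (auto simp: simplicial_boundary_def)
qed

lemma cycle_transport:
  assumes "bij \<phi>" "c \<in> simplicial_cycles K p"
  shows "(\<lambda>xs. c (map (inv_into UNIV \<phi>) xs)) \<in> simplicial_cycles ((`) \<phi> ` K) p"
  using assms by (auto simp: simplicial_cycles_def chain_transport boundary_transport)

lemma boundaries_transport:
  assumes "bij \<phi>" "c \<in> simplicial_boundaries K p"
  shows "(\<lambda>xs. c (map (inv_into UNIV \<phi>) xs)) \<in> simplicial_boundaries ((`) \<phi> ` K) p"
proof -
  obtain d where "d \<in> simplicial_chains K (Suc p)" "c = simplicial_boundary d"
    using assms(2) by (auto simp: simplicial_boundaries_def)
  with chain_transport[OF assms(1)] show ?thesis
    by (force simp: simplicial_boundaries_def boundary_transport[OF assms(1)])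
qed

lemma subgroup_boundaries:
  assumes down: "\<And>\<sigma> \<tau>. \<sigma> \<in> K \<Longrightarrow> \<tau> \<subseteq> \<sigma> \<Longrightarrow> \<tau> \<noteq> {} \<Longrightarrow> \<tau> \<in> K"
  shows "subgroup (simplicial_boundaries K p) (cycle_group K p)"
proof -
  interpret Z: comm_group "cycle_group K p" by (rule comm_group_cycle_group)
  have sub: "simplicial_boundaries K p \<subseteq> carrier (cycle_group K p)"
    using boundary_chain[OF _ down] boundary_boundary
    by (fastforce simp: cycle_group_def simplicial_cycles_def simplicial_boundaries_def)
  show ?thesis
  proof (rule Z.subgroupI)
    show "simplicial_boundaries K p \<noteq> {}" using chain_zero by (auto simp: simplicial_boundaries_def)
    fix a assume a: "a \<in> simplicial_boundaries K p"
    then obtain c where c: "c \<in> simplicial_chains K (Suc p)" "a = simplicial_boundary c"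
      by (auto simp: simplicial_boundaries_def)
    have "(\<lambda>xs. - a xs) \<in> simplicial_boundaries K p"
      using c chain_uminus[OF c(1)] by (force simp: simplicial_boundaries_def simplicial_boundary_uminus)
    moreover have "inv\<^bsub>cycle_group K p\<^esub> a = (\<lambda>xs. - a xs)"
    proof (rule Z.inv_equality)
      show "(\<lambda>xs. - a xs) \<otimes>\<^bsub>cycle_group K p\<^esub> a = \<one>\<^bsub>cycle_group K p\<^esub>" by (simp add: cycle_group_def)
    qed (use calculation a sub in auto)
    ultimately show "inv\<^bsub>cycle_group K p\<^esub> a \<in> simplicial_boundaries K p" by simp
    fix b assume "b \<in> simplicial_boundaries K p"
    then obtain d where d: "d \<in> simplicial_chains K (Suc p)" "b = simplicial_boundary d"
      by (auto simp: simplicial_boundaries_def)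
    have "a \<otimes>\<^bsub>cycle_group K p\<^esub> b = simplicial_boundary (\<lambda>xs. c xs + d xs)"
      using c d by (simp add: cycle_group_def simplicial_boundary_add chain_finite)
    then show "a \<otimes>\<^bsub>cycle_group K p\<^esub> b \<in> simplicial_boundaries K p"
      using chain_add[OF c(1) d(1)] by (auto simp: simplicial_boundaries_def)
  qed (rule sub)
qed

text \<open>Moving the points to grid corners changes the vertices but not the combinatorics; this
  lemma carries the Betti number along. The isomorphism is induced by transport followed by the
  quotient map, whose kernel is found by transporting back.\<close>

lemma betti_number_transport:
  fixes \<phi> :: "'a \<Rightarrow> 'a" and K :: "'a set set"
  assumes \<phi>: "bij \<phi>" and down: "\<And>\<sigma> \<tau>. \<sigma> \<in> K \<Longrightarrow> \<tau> \<subseteq> \<sigma> \<Longrightarrow> \<tau> \<noteq> {} \<Longrightarrow> \<tau> \<in> K"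
  shows "betti_number p ((`) \<phi> ` K) = betti_number p K"
proof -
  let ?K = "(`) \<phi> ` K" and ?T = "\<lambda>c xs. c (map (inv_into UNIV \<phi>) xs)"
  let ?Z = "cycle_group K p" and ?Z' = "cycle_group ?K p" and ?B = "simplicial_boundaries K p" and ?B' = "simplicial_boundaries ?K p"
  have inv: "bij (inv_into UNIV \<phi>)" "inv_into UNIV (inv_into UNIV \<phi>) = \<phi>" "(`) (inv_into UNIV \<phi>) ` ?K = K" "\<And>x. \<phi> (inv_into UNIV \<phi> x) = x" "\<And>x. inv_into UNIV \<phi> (\<phi> x) = x"
    using bij_imp_bij_inv[OF \<phi>] inv_inv_eq[OF \<phi>] \<phi>
    by (simp_all add: image_image bij_is_inj bij_is_surj surj_f_inv_f)
  have down': "\<tau> \<in> ?K" if \<sigma>: "\<sigma> \<in> ?K" "\<tau> \<subseteq> \<sigma>" "\<tau> \<noteq> {}" for \<sigma> \<tau>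
  proof -
    obtain \<sigma>0 where \<sigma>0: "\<sigma>0 \<in> K" "\<sigma> = \<phi> ` \<sigma>0" using \<sigma>(1) by auto
    have "inv_into UNIV \<phi> ` \<tau> \<in> K"
    proof (rule down[OF \<sigma>0(1)])
      show "inv_into UNIV \<phi> ` \<tau> \<subseteq> \<sigma>0" using \<sigma>(2) \<sigma>0(2) inv(5) by auto
    qed (use \<sigma> in auto)
    moreover have "\<tau> = \<phi> ` inv_into UNIV \<phi> ` \<tau>" using inv(4) by (simp add: image_image)
    ultimately show ?thesis by blast
  qed
  interpret Z: comm_group ?Z by (rule comm_group_cycle_group)
  interpret Z': comm_group ?Z' by (rule comm_group_cycle_group)
  have sB: "subgroup ?B ?Z" and sB': "subgroup ?B' ?Z'"
    using subgroup_boundaries down down' by blast+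
  interpret B': normal ?B' ?Z' by (rule Z'.subgroup_imp_normal[OF sB'])
  have cG: "comm_group (?Z Mod ?B)" "comm_group (?Z' Mod ?B')"
    using Z.abelian_FactGroup[OF sB] Z'.abelian_FactGroup[OF sB'] .
  interpret Q: comm_group "?Z' Mod ?B'" by fact
  have T: "?T z \<in> carrier ?Z'" if "z \<in> carrier ?Z" for z
    using that cycle_transport[OF \<phi>] by (auto simp: cycle_group_def)
  have T': "(\<lambda>xs. z (map \<phi> xs)) \<in> carrier ?Z" if "z \<in> carrier ?Z'" for z
    using that cycle_transport[OF inv(1), of z ?K p] inv by (auto simp: cycle_group_def)
  have TT: "?T (\<lambda>xs. z (map \<phi> xs)) = z" "(\<lambda>xs. ?T z (map \<phi> xs)) = z" for z :: "'a list \<Rightarrow> int"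
    using inv by (auto simp: o_def)
  define h where "h = (\<lambda>z. ?B' #>\<^bsub>?Z'\<^esub> ?T z)"
  have "?T \<in> hom ?Z ?Z'" using T by (auto simp: hom_def) (simp add: cycle_group_def)
  from hom_compose[OF this B'.r_coset_hom_Mod] have "h \<in> hom ?Z (?Z' Mod ?B')" by (simp add: h_def o_def)
  then interpret h: group_hom ?Z "?Z' Mod ?B'" h by unfold_locales
  have onto: "h ` carrier ?Z = carrier (?Z' Mod ?B')"
  proof (intro equalityI subsetI)
    fix X assume "X \<in> carrier (?Z' Mod ?B')"
    then obtain z where "z \<in> carrier ?Z'" "X = ?B' #>\<^bsub>?Z'\<^esub> z" by (auto simp: carrier_FactGroup)
    then show "X \<in> h ` carrier ?Z"
      using T' TT(1)[of z] by (intro image_eqI[of _ _ "\<lambda>xs. z (map \<phi> xs)"]) (auto simp: h_def)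
  qed auto
  have "Coset.kernel ?Z (?Z' Mod ?B') h = ?B"
  proof (intro equalityI subsetI)
    fix z assume "z \<in> Coset.kernel ?Z (?Z' Mod ?B') h"
    then have "z \<in> carrier ?Z" "?B' #>\<^bsub>?Z'\<^esub> ?T z = ?B'" by (auto simp: kernel_def h_def)
    then have "?T z \<in> ?B'" using Z'.coset_join1[OF _ T sB'] B'.subset by auto
    from boundaries_transport[OF inv(1) this] inv TT(2)[of z] show "z \<in> ?B" by (simp add: o_def)
  next
    fix z assume z: "z \<in> ?B"
    then have "z \<in> carrier ?Z" using sB subgroup.subset by blast
    moreover have "?B' #>\<^bsub>?Z'\<^esub> ?T z = ?B'"
      using boundaries_transport[OF \<phi> z] sB' B'.subset by (intro Z'.coset_join2) auto
    ultimately show "z \<in> Coset.kernel ?Z (?Z' Mod ?B') h" by (auto simp: kernel_def h_def)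
  qed
  with h.FactGroup_iso_set[OF onto] have "(\<lambda>X. the_elem (h ` X)) \<in> iso (?Z Mod ?B) (?Z' Mod ?B')" by simp
  from abelian_rank_iso[OF cG this] show ?thesis
    by (simp add: betti_number_def simplicial_homology_group_def)
qed

section \<open>Cech complexes and hollow simplices\<close>

definition common_ball :: "real \<Rightarrow> 'a::metric_space set \<Rightarrow> bool" where
  "common_ball r \<sigma> \<longleftrightarrow> (\<exists>p. \<forall>x\<in>\<sigma>. dist x p < r)"

lemma Inter_ball_nonempty_iff: "(\<Inter>j\<in>J. ball (x j) r) \<noteq> {} \<longleftrightarrow> common_ball r (x ` J)"
  by (simp add: common_ball_def set_eq_iff)

lemma common_ball_mono: "common_ball r \<sigma> \<Longrightarrow> \<tau> \<subseteq> \<sigma> \<Longrightarrow> common_ball r \<tau>"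
  by (auto simp: common_ball_def)

lemma common_ball_dist:
  assumes "common_ball r \<sigma>" "x \<in> \<sigma>" "y \<in> \<sigma>"
  shows "dist x y < 2 * r"
proof -
  obtain p where "\<forall>x\<in>\<sigma>. dist x p < r" using assms by (auto simp: common_ball_def)
  then have "dist x p < r" "dist y p < r" using assms by auto
  then show ?thesis using dist_triangle2[of x y p] by linarith
qed

lemma cech_complex_iff:
  "\<sigma> \<in> cech_complex X t \<longleftrightarrow> finite \<sigma> \<and> \<sigma> \<noteq> {} \<and> \<sigma> \<subseteq> X \<and> common_ball (t / 2) \<sigma>"
  using Inter_ball_nonempty_iff[of "\<lambda>x. x" "t / 2" \<sigma>] by (simp add: cech_complex_def)

definition hollow_simplex :: "nat \<Rightarrow> real \<Rightarrow> 'a::metric_space set \<Rightarrow> bool" where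
  "hollow_simplex k t Y \<longleftrightarrow> finite Y \<and> card Y = k + 2 \<and>
    (\<forall>y\<in>Y. common_ball (t / 2) (Y - {y})) \<and> \<not> common_ball (t / 2) Y"

lemma cech_complex_dist:
  "\<sigma> \<in> cech_complex X t \<Longrightarrow> x \<in> \<sigma> \<Longrightarrow> y \<in> \<sigma> \<Longrightarrow> dist x y < t"
  using common_ball_dist[of "t / 2" \<sigma> x y] by (simp add: cech_complex_iff)

lemma cech_complex_down:
  "\<sigma> \<in> cech_complex X t \<Longrightarrow> \<tau> \<subseteq> \<sigma> \<Longrightarrow> \<tau> \<noteq> {} \<Longrightarrow> \<tau> \<in> cech_complex X t"
  unfolding cech_complex_iff by (blast intro: finite_subset common_ball_mono)

text \<open>Every simplex has diameter below \<open>t\<close>, so all simplices meeting a given one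
  lie in a ball of radius \<open>2 * t\<close> around any of its vertices. The bound on such balls
  is thus the cluster condition.\<close>

lemma betti_number_cech_complex:
  assumes X: "finite X" and k: "1 \<le> k" and X_ball: "\<And>x. x \<in> X \<Longrightarrow> card (X \<inter> ball x (2 * t)) \<le> k + 2"
  shows "betti_number k (cech_complex X t) = card {Y. Y \<subseteq> X \<and> hollow_simplex k t Y}"
proof -
  let ?K = "cech_complex X t"
  interpret clustered ?K k
  proof
    show "finite ?K" by (rule finite_subset[of _ "Pow X"]) (use X in \<open>auto simp: cech_complex_iff\<close>)
    show "finite \<sigma>" if "\<sigma> \<in> ?K" for \<sigma> using that by (simp add: cech_complex_iff)
    show "card (\<Union>{\<tau> \<in> ?K. \<tau> \<inter> \<sigma> \<noteq> {}}) \<le> k + 2" if \<sigma>: "\<sigma> \<in> ?K" for \<sigma>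
    proof -
      obtain x where x: "x \<in> \<sigma>" "x \<in> X" using \<sigma> by (auto simp: cech_complex_iff)
      have "\<Union>{\<tau> \<in> ?K. \<tau> \<inter> \<sigma> \<noteq> {}} \<subseteq> X \<inter> ball x (2 * t)"
      proof
        fix y assume "y \<in> \<Union>{\<tau> \<in> ?K. \<tau> \<inter> \<sigma> \<noteq> {}}"
        then obtain \<tau> w where \<tau>: "y \<in> \<tau>" "\<tau> \<in> ?K" "w \<in> \<tau>" "w \<in> \<sigma>" by auto
        have "dist x w < t" "dist w y < t" using cech_complex_dist \<sigma> \<tau> x by blast+
        then have "dist x y < 2 * t" using dist_triangle[of x y w] by linarith
        then show "y \<in> X \<inter> ball x (2 * t)" using \<tau> by (auto simp: cech_complex_iff)
      qed
      then have "card (\<Union>{\<tau> \<in> ?K. \<tau> \<inter> \<sigma> \<noteq> {}}) \<le> card (X \<inter> ball x (2 * t))"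
        using X by (intro card_mono) auto
      then show ?thesis using X_ball[OF x(2)] by linarith
    qed
    show "\<tau> \<in> ?K" if "\<sigma> \<in> ?K" "\<tau> \<subseteq> \<sigma>" "\<tau> \<noteq> {}" for \<sigma> \<tau> using that by (rule cech_complex_down)
  qed (rule k)
  have "hollow = {Y. Y \<subseteq> X \<and> hollow_simplex k t Y}"
  proof (intro equalityI subsetI)
    fix Y assume Y: "Y \<in> hollow"
    have "\<Union>?K \<subseteq> X" by (auto simp: cech_complex_iff)
    then have YX: "Y \<subseteq> X" using framed_subset[of Y] Y by blast
    have f: "finite Y" "card Y = k + 2" "\<And>y. y \<in> Y \<Longrightarrow> Y - {y} \<in> ?K" "Y \<notin> ?K"
      using Y unfolding framed_def by simp_all
    have "Y \<noteq> {}" using f by auto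
    then have "\<not> common_ball (t / 2) Y" using f(1,4) YX by (simp add: cech_complex_iff)
    moreover have "common_ball (t / 2) (Y - {y})" if "y \<in> Y" for y
      using f(3)[OF that] by (simp add: cech_complex_iff)
    ultimately show "Y \<in> {Y. Y \<subseteq> X \<and> hollow_simplex k t Y}"
      using YX f(1,2) by (simp add: hollow_simplex_def)
  next
    fix Y assume Y: "Y \<in> {Y. Y \<subseteq> X \<and> hollow_simplex k t Y}"
    then have Y': "finite Y" "card Y = k + 2" "Y \<subseteq> X" by (auto simp: hollow_simplex_def)
    have "Y - {y} \<in> ?K" if "y \<in> Y" for y
    proof -
      have "card (Y - {y}) \<noteq> 0" using Y' that by simp
      then have "Y - {y} \<noteq> {}" by (metis card.empty)
      then show ?thesis using Y Y' that by (auto simp: hollow_simplex_def cech_complex_iff)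
    qed
    moreover have "Y \<notin> ?K" using Y by (simp add: hollow_simplex_def cech_complex_iff)
    ultimately show "Y \<in> hollow" using Y' by (simp add: framed_def)
  qed
  then show ?thesis using betti_number_eq by simp
qed

text \<open>With at least three points there is a facet that contains both \<open>x\<close> and
  \<open>y\<close>, and facets have a common ball.\<close>

lemma hollow_simplex_dist:
  assumes "hollow_simplex k t Y" "1 \<le> k" "x \<in> Y" "y \<in> Y"
  shows "dist x y < t"
proof -
  have Y: "finite Y" "card Y = k + 2" using assms by (auto simp: hollow_simplex_def)
  have "card {x, y} \<le> 2" by (simp add: card_insert_if)
  then have "\<not> Y \<subseteq> {x, y}" using Y assms(2) card_mono[of "{x, y}" Y] by auto
  then obtain z where z: "z \<in> Y" "z \<noteq> x" "z \<noteq> y" by auto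
  then have "common_ball (t / 2) (Y - {z})" using assms by (simp add: hollow_simplex_def)
  from common_ball_dist[OF this, of x y] show ?thesis using assms z by auto
qed

text \<open>For repeated points, omitting one of two equal entries leaves the point set unchanged;
  the product then agrees with the subtracted indicator, and the difference is 0, in accordance with
  the cardinality condition in \<open>hollow_simplex\<close>.\<close>

lemma cech_h_eq:
  "cech_h k t x = of_bool (hollow_simplex k t (x ` {..<k+2}))"
proof -
  let ?I = "{..<k+2}" and ?N = "\<lambda>J. common_ball (t / 2) (x ` J)"
  have prod: "(\<Prod>i\<in>?I. of_bool (?N (?I - {i}))) = (of_bool (\<forall>i\<in>?I. ?N (?I - {i})) :: real)"
  proof (cases "\<forall>i\<in>?I. ?N (?I - {i})")
    case False
    then obtain i where "i \<in> ?I" "\<not> ?N (?I - {i})" by blast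
    then have "(\<Prod>i\<in>?I. of_bool (?N (?I - {i}))) = (0::real)" by (intro prod_zero bexI[of _ i]) auto
    then show ?thesis using False by simp
  qed simp
  have mono: "?N ?I \<Longrightarrow> ?N (?I - {i})" for i by (rule common_ball_mono) auto
  have h: "cech_h k t x = of_bool (\<forall>i\<in>?I. ?N (?I - {i})) - of_bool (?N ?I)"
    unfolding cech_h_def Inter_ball_nonempty_iff prod ..
  show ?thesis
  proof (cases "inj_on x ?I")
    case True
    have "x ` ?I - {x i} = x ` (?I - {i})" if "i \<in> ?I" for i
      using inj_on_image_set_diff[OF True, of ?I "{i}"] that by auto
    then have "(\<forall>y\<in>x ` ?I. common_ball (t / 2) (x ` ?I - {y})) \<longleftrightarrow> (\<forall>i\<in>?I. ?N (?I - {i}))"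
      by (simp del: lessThan_iff)
    then have "hollow_simplex k t (x ` ?I) \<longleftrightarrow> (\<forall>i\<in>?I. ?N (?I - {i})) \<and> \<not> ?N ?I"
      using card_image[OF True] by (simp add: hollow_simplex_def)
    then show ?thesis unfolding h using mono by (cases "?N ?I") auto
  next
    case False
    then obtain i j where ij: "i \<in> ?I" "j \<in> ?I" "i \<noteq> j" "x i = x j" by (auto simp: inj_on_def)
    have "x ` (?I - {i}) = x ` ?I"
    proof
      show "x ` ?I \<subseteq> x ` (?I - {i})"
      proof (rule image_subsetI)
        fix l assume "l \<in> ?I"
        then show "x l \<in> x ` (?I - {i})"
          using ij by (cases "l = i") (auto intro: image_eqI[of _ _ j])
      qed
    qed auto
    then have "(\<forall>i\<in>?I. ?N (?I - {i})) \<longleftrightarrow> ?N ?I" using mono ij(1) by metis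
    moreover have "card (x ` ?I) \<noteq> k + 2" using False eq_card_imp_inj_on[of ?I x] by auto
    ultimately show ?thesis unfolding h by (simp add: hollow_simplex_def)
  qed
qed

section \<open>Approximation by nearby points\<close>

locale approximation =
  fixes R :: "nat \<Rightarrow> 'a::metric_space \<Rightarrow> 'a" and \<delta> :: "nat \<Rightarrow> real"
  assumes dist_R: "\<And>m x. dist (R m x) x \<le> \<delta> m" and \<delta>: "\<delta> \<longlonglongrightarrow> 0"
begin

text \<open>
  The radius has to shrink with the mesh: balls are open, so a common point leaves some room, while
  the shrunken balls around the approximating points are contained in the original ones.
\<close>

lemma eventually_common_ball_iff:
  assumes "finite \<sigma>"
  shows "\<forall>\<^sub>F m in sequentially. common_ball (r - \<delta> m) (R m ` \<sigma>) \<longleftrightarrow> common_ball r \<sigma>"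
proof (cases "common_ball r \<sigma>")
  case False
  have "\<not> common_ball (r - \<delta> m) (R m ` \<sigma>)" for m
  proof
    assume "common_ball (r - \<delta> m) (R m ` \<sigma>)"
    then obtain p where p: "\<forall>x\<in>\<sigma>. dist (R m x) p < r - \<delta> m" by (auto simp: common_ball_def)
    have "dist x p < r" if "x \<in> \<sigma>" for x
      using p that dist_R[of m x] dist_triangle[of x p "R m x"] by (force simp: dist_commute)
    then show False using False by (auto simp: common_ball_def)
  qed
  then show ?thesis using False by simp
next
  case True
  then obtain p where p: "\<forall>x\<in>\<sigma>. dist x p < r" by (auto simp: common_ball_def)
  \<comment> \<open>One \<open>\<delta> m\<close> pays for the moved point, the other for the
    reduced radius.\<close>
  have "\<forall>\<^sub>F m in sequentially. \<forall>x\<in>\<sigma>. dist x p + 2 * \<delta> m < r"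
  proof (rule eventually_ball_finite[OF assms], rule ballI)
    fix x assume "x \<in> \<sigma>"
    have "(\<lambda>m. dist x p + 2 * \<delta> m) \<longlonglongrightarrow> dist x p + 2 * 0" by (intro tendsto_intros \<delta>)
    then show "\<forall>\<^sub>F m in sequentially. dist x p + 2 * \<delta> m < r"
      using p \<open>x \<in> \<sigma>\<close> by (intro order_tendstoD(2)) auto
  qed
  then show ?thesis
  proof eventually_elim
    case (elim m)
    have "dist (R m x) p < r - \<delta> m" if "x \<in> \<sigma>" for x
    proof -
      have "dist x p + 2 * \<delta> m < r" using elim that by blast
      then show ?thesis using dist_R[of m x] dist_triangle[of "R m x" p x] by linarith
    qed
    then have "common_ball (r - \<delta> m) (R m ` \<sigma>)" by (auto simp: common_ball_def)
    then show ?case using True by simp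
  qed
qed

lemma eventually_inj_on:
  assumes "finite X"
  shows "\<forall>\<^sub>F m in sequentially. inj_on (R m) X"
proof -
  have "\<forall>\<^sub>F m in sequentially. \<forall>z\<in>{z \<in> X \<times> X. fst z \<noteq> snd z}. 2 * \<delta> m < dist (fst z) (snd z)"
  proof (rule eventually_ball_finite, goal_cases)
    case 2
    have "(\<lambda>m. 2 * \<delta> m) \<longlonglongrightarrow> 0" using tendsto_mult[OF tendsto_const \<delta>, of 2] by simp
    from order_tendstoD(2)[OF this] show ?case by simp
  qed (use assms in auto)
  then show ?thesis
  proof eventually_elim
    case (elim m)
    show ?case
    proof (rule inj_onI, rule ccontr)
      fix x y assume xy: "x \<in> X" "y \<in> X" "R m x = R m y" "x \<noteq> y"
      then have "2 * \<delta> m < dist x y" using elim by auto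
      then show False using dist_triangle[of x y "R m x"] dist_R[of m x] dist_R[of m y] xy
        by (simp add: dist_commute)
    qed
  qed
qed

text \<open>The parameter of the complex is a diameter, so shrinking the radius by
  \<open>\<delta> m\<close> lowers it by \<open>2 * \<delta> m\<close>.\<close>

lemma eventually_complex_iff:
  assumes "finite X"
  shows "\<forall>\<^sub>F m in sequentially. inj_on (R m) X \<and> (\<forall>\<sigma>\<in>Pow X.
    common_ball ((t - 2 * \<delta> m) / 2) (R m ` \<sigma>) \<longleftrightarrow> common_ball (t / 2) \<sigma>)"
proof (intro eventually_conj eventually_inj_on assms eventually_ball_finite ballI)
  fix \<sigma> assume "\<sigma> \<in> Pow X"
  then have "finite \<sigma>" using assms finite_subset by auto
  from eventually_common_ball_iff[OF this, of "t / 2"]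
  show "\<forall>\<^sub>F m in sequentially. common_ball ((t - 2 * \<delta> m) / 2) (R m ` \<sigma>) \<longleftrightarrow> common_ball (t / 2) \<sigma>"
    by (simp add: diff_divide_distrib)
qed (use assms in auto)

lemma eventually_hollow_simplex_iff:
  assumes "finite Y"
  shows "\<forall>\<^sub>F m in sequentially. inj_on (R m) Y \<and> (hollow_simplex k (t - 2 * \<delta> m) (R m ` Y) \<longleftrightarrow> hollow_simplex k t Y)"
  using eventually_complex_iff[OF assms, of t]
proof eventually_elim
  case (elim m)
  then have inj: "inj_on (R m) Y"
    and iff: "\<And>\<sigma>. \<sigma> \<subseteq> Y \<Longrightarrow> common_ball ((t - 2 * \<delta> m) / 2) (R m ` \<sigma>) \<longleftrightarrow> common_ball (t / 2) \<sigma>"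
    by auto
  have "R m ` Y - {R m y} = R m ` (Y - {y})" if "y \<in> Y" for y
    using inj_on_image_set_diff[OF inj, of Y "{y}"] that by auto
  then have "(\<forall>y\<in>R m ` Y. common_ball ((t - 2 * \<delta> m) / 2) (R m ` Y - {y})) \<longleftrightarrow>
    (\<forall>y\<in>Y. common_ball (t / 2) (Y - {y}))"
    using iff[of "Y - {_}"] by simp
  then show ?case
    using inj iff[of Y] card_image[OF inj] assms by (simp add: hollow_simplex_def)
qed

end

text \<open>Inside the finite union of \<open>X\<close> and its image the two complements have
  equally many elements and can be matched; outside the union the identity is taken.\<close>

lemma inj_on_extend_bij:
  fixes R :: "'a \<Rightarrow> 'a"
  assumes "finite X" "inj_on R X"
  obtains \<phi> where "bij \<phi>" "\<And>x. x \<in> X \<Longrightarrow> \<phi> x = R x"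
proof -
  let ?A = "X \<union> R ` X"
  have fin: "finite ?A" using assms by auto
  have "card (?A - X) = card (?A - R ` X)"
    using assms fin card_image[OF assms(2)] by (subst (1 2) card_Diff_subset) auto
  then obtain g where g: "bij_betw g (?A - X) (?A - R ` X)"
    using finite_same_card_bij[of "?A - X" "?A - R ` X"] fin by auto
  define \<phi> where "\<phi> x = (if x \<in> X then R x else if x \<in> ?A then g x else x)" for x
  have "bij_betw \<phi> X (R ` X) = bij_betw R X (R ` X)"
    by (rule bij_betw_cong) (simp add: \<phi>_def)
  then have 1: "bij_betw \<phi> X (R ` X)" using inj_on_imp_bij_betw[OF assms(2)] by simp
  have "bij_betw \<phi> (?A - X) (?A - R ` X) = bij_betw g (?A - X) (?A - R ` X)"
    by (rule bij_betw_cong) (auto simp: \<phi>_def)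
  then have 2: "bij_betw \<phi> (?A - X) (?A - R ` X)" using g by simp
  have "bij_betw \<phi> (- ?A) (- ?A) = bij_betw id (- ?A) (- ?A)"
    by (rule bij_betw_cong) (auto simp: \<phi>_def)
  then have 3: "bij_betw \<phi> (- ?A) (- ?A)" by simp
  have "bij_betw \<phi> (X \<union> (?A - X)) (R ` X \<union> (?A - R ` X))"
    using 1 2 by (rule bij_betw_combine) auto
  then have "bij_betw \<phi> (X \<union> (?A - X) \<union> - ?A) (R ` X \<union> (?A - R ` X) \<union> - ?A)"
    using 3 by (rule bij_betw_combine) auto
  moreover have "X \<union> (?A - X) \<union> - ?A = UNIV" "R ` X \<union> (?A - R ` X) \<union> - ?A = UNIV" by auto
  ultimately have "bij \<phi>" by simp
  then show ?thesis by (rule that) (simp add: \<phi>_def)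
qed

text \<open>For a fine mesh the moved points span the same complex up to relabelling, so the Betti
  numbers are equal and not merely close.\<close>

lemma (in approximation) eventually_betti_number:
  assumes "finite X"
  shows "\<forall>\<^sub>F m in sequentially.
    betti_number p (cech_complex (R m ` X) (t - 2 * \<delta> m)) = betti_number p (cech_complex X t)"
  using eventually_complex_iff[OF assms, of t]
proof eventually_elim
  case (elim m)
  then have inj: "inj_on (R m) X"
    and iff: "\<And>\<sigma>. \<sigma> \<subseteq> X \<Longrightarrow> common_ball ((t - 2 * \<delta> m) / 2) (R m ` \<sigma>) \<longleftrightarrow> common_ball (t / 2) \<sigma>"
    by auto
  obtain \<phi> where \<phi>: "bij \<phi>" "\<And>x. x \<in> X \<Longrightarrow> \<phi> x = R m x"
    using inj_on_extend_bij[OF assms inj] by metis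
  have im: "\<phi> ` \<sigma> = R m ` \<sigma>" if "\<sigma> \<subseteq> X" for \<sigma> using \<phi>(2) that by (intro image_cong) auto
  have "cech_complex (R m ` X) (t - 2 * \<delta> m) = (`) \<phi> ` cech_complex X t"
  proof (intro equalityI subsetI)
    fix \<sigma> assume s: "\<sigma> \<in> cech_complex (R m ` X) (t - 2 * \<delta> m)"
    then obtain \<tau> where \<tau>: "\<tau> \<subseteq> X" "\<sigma> = R m ` \<tau>" by (auto simp: cech_complex_iff subset_image_iff)
    have "finite \<tau>" using \<tau>(1) assms by (rule finite_subset)
    then have "\<tau> \<in> cech_complex X t"
      using s \<tau> iff[OF \<tau>(1)] by (simp add: cech_complex_iff)
    then show "\<sigma> \<in> (`) \<phi> ` cech_complex X t"
      by (rule rev_image_eqI) (simp add: im[OF \<tau>(1)] \<tau>(2))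
  next
    fix \<sigma> assume "\<sigma> \<in> (`) \<phi> ` cech_complex X t"
    then obtain \<tau> where \<tau>: "\<tau> \<in> cech_complex X t" "\<sigma> = \<phi> ` \<tau>" by auto
    then have X: "\<tau> \<subseteq> X" by (simp add: cech_complex_iff)
    have "R m ` \<tau> \<in> cech_complex (R m ` X) (t - 2 * \<delta> m)"
      using \<tau>(1) iff[OF X] by (simp add: cech_complex_iff image_mono)
    then show "\<sigma> \<in> cech_complex (R m ` X) (t - 2 * \<delta> m)" using \<tau>(2) im[OF X] by simp
  qed
  moreover have "betti_number p ((`) \<phi> ` cech_complex X t) = betti_number p (cech_complex X t)"
    by (rule betti_number_transport[OF \<phi>(1) cech_complex_down])
  ultimately show ?case by simp
qed

section \<open>Poisson random measures\<close>

text \<open>\<open>poisson_pmf\<close> is only specified for positive parameters.\<close>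

definition poisson0_pmf :: "real \<Rightarrow> nat pmf" where
  "poisson0_pmf a = (if a = 0 then return_pmf 0 else poisson_pmf a)"

lemma pmf_poisson0: "0 \<le> a \<Longrightarrow> pmf (poisson0_pmf a) n = a ^ n / fact n * exp (- a)"
  by (cases n) (auto simp: poisson0_pmf_def)

lemma poisson_law_eq: "0 \<le> a \<Longrightarrow> poisson_law (ennreal a) = distr (measure_pmf (poisson0_pmf a)) borel of_nat"
  by (auto simp: poisson_law_def poisson0_pmf_def return_pmf.rep_eq distr_return ennreal_eq_0_iff)

text \<open>Since \<open>fact n \<le> fact (n + j)\<close>, shifting the index by \<open>j\<close>
  costs a factor of at most \<open>a ^ j\<close>; the remaining series is the total mass 1.\<close>

lemma poisson0_tail:
  assumes "0 \<le> a"
  shows "measure_pmf.prob (poisson0_pmf a) {j..} \<le> a ^ j"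
proof -
  have bij: "bij_betw (\<lambda>n. n + j) UNIV {j..}"
    by (rule bij_betwI[of _ _ _ "\<lambda>n. n - j"]) auto
  have le: "pmf (poisson0_pmf a) (n + j) \<le> a ^ j * pmf (poisson0_pmf a) n" for n
  proof -
    have "(fact n :: real) \<le> fact (n + j)" by (rule fact_mono) simp
    then have "a ^ (n + j) * exp (- a) / fact (n + j) \<le> a ^ (n + j) * exp (- a) / fact n"
      using assms by (intro divide_left_mono) auto
    then show ?thesis using assms by (simp add: pmf_poisson0 power_add field_simps)
  qed
  have "emeasure (measure_pmf (poisson0_pmf a)) {j..} = (\<integral>\<^sup>+ n. pmf (poisson0_pmf a) n \<partial>count_space {j..})"
    by (simp add: nn_integral_pmf)
  also have "\<dots> = (\<integral>\<^sup>+ n. pmf (poisson0_pmf a) (n + j) \<partial>count_space UNIV)"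
    by (rule nn_integral_bij_count_space[OF bij, symmetric])
  also have "\<dots> \<le> (\<integral>\<^sup>+ n. ennreal (a ^ j) * pmf (poisson0_pmf a) n \<partial>count_space UNIV)"
    using le assms by (intro nn_integral_mono) (auto simp flip: ennreal_mult')
  also have "\<dots> = ennreal (a ^ j)"
    by (simp add: nn_integral_cmult nn_integral_pmf)
  finally show ?thesis
    using assms by (simp add: measure_pmf.emeasure_eq_measure)
qed

text \<open>Exponential tilting: the weight \<open>exp (- (b * n))\<close> turns the law into the
  Poisson law with parameter \<open>a * exp (- b)\<close>, up to a constant factor.\<close>

lemma poisson0_laplace:
  assumes "0 \<le> a"
  shows "measure_pmf.expectation (poisson0_pmf a) (\<lambda>n. exp (- (b * real n))) = exp (- (a * (1 - exp (- b))))"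
proof -
  let ?a' = "a * exp (- b)" and ?c = "exp (- (a * (1 - exp (- b))))"
  have eq: "pmf (poisson0_pmf a) n * exp (- (b * real n)) = ?c * pmf (poisson0_pmf ?a') n" for n
  proof -
    have "exp (- (b * real n)) = exp (- b) ^ n" by (simp flip: exp_of_nat2_mult)
    moreover have "exp (- a) = ?c * exp (- ?a')" by (simp add: algebra_simps flip: exp_add)
    ultimately show ?thesis using assms by (simp add: pmf_poisson0 power_mult_distrib)
  qed
  have "(\<integral>\<^sup>+ n. ennreal (exp (- (b * real n))) \<partial>measure_pmf (poisson0_pmf a)) =
    (\<integral>\<^sup>+ n. ennreal (pmf (poisson0_pmf a) n) * ennreal (exp (- (b * real n))) \<partial>count_space UNIV)"
    by (simp add: nn_integral_measure_pmf)
  also have "\<dots> = (\<integral>\<^sup>+ n. ennreal ?c * ennreal (pmf (poisson0_pmf ?a') n) \<partial>count_space UNIV)"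
    by (intro nn_integral_cong) (simp add: eq flip: ennreal_mult')
  also have "\<dots> = ennreal ?c"
    by (simp add: nn_integral_cmult nn_integral_pmf)
  finally show ?thesis
    by (simp add: integral_eq_nn_integral)
qed

text \<open>Poisson random measures are specified through families indexed by initial segments of
  the natural numbers; below, the indices are grid cells and sets of indices.\<close>

lemma (in prob_space) indep_vars_reindex:
  assumes bij: "bij_betw h J I" and ind: "indep_vars (\<lambda>j. M' (h j)) (\<lambda>j. X (h j)) J"
  shows "indep_vars M' X I"
proof -
  have im: "h ` J = I" and inj: "inj_on h J" using bij by (auto simp: bij_betw_def)
  show ?thesis
    unfolding indep_vars_def2 indep_sets_def
  proof (intro conjI ballI allI impI)
    fix i assume "i \<in> I"
    then show "random_variable (M' i) (X i)" "{X i -` A \<inter> space M |A. A \<in> sets (M' i)} \<subseteq> events"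
      using ind im by (auto simp: indep_vars_def2)
  next
    fix K A assume K: "K \<subseteq> I" "K \<noteq> {}" "finite K"
      and A: "A \<in> Pi K (\<lambda>i. {X i -` A \<inter> space M |A. A \<in> sets (M' i)})"
    define L where "L = inv_into J h ` K"
    have "h ` L = K" using K(1) im by (simp add: L_def image_inv_into_cancel)
    moreover have "L \<subseteq> J" using K(1) im by (auto simp: L_def intro: inv_into_into)
    moreover from this inj have "inj_on h L" by (rule inj_on_subset[rotated])
    ultimately have L: "h ` L = K" "inj_on h L" "L \<subseteq> J" "L \<noteq> {}" "finite L"
      using K by (auto simp: L_def)
    have "prob (\<Inter>j\<in>L. A (h j)) = (\<Prod>j\<in>L. prob (A (h j)))"
    proof (rule indep_setsD)
      show "indep_sets (\<lambda>j. {X (h j) -` A \<inter> space M |A. A \<in> sets (M' (h j))}) J"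
        using ind by (simp add: indep_vars_def2)
      show "\<forall>j\<in>L. A (h j) \<in> {X (h j) -` A \<inter> space M |A. A \<in> sets (M' (h j))}"
        using A L(1) by (auto simp: Pi_iff)
    qed fact+
    then show "prob (\<Inter>j\<in>K. A j) = (\<Prod>j\<in>K. prob (A j))"
      using L(1) prod.reindex[OF L(2), of "\<lambda>i. prob (A i)"] by (simp add: image_image flip: L(1))
  qed
qed

section \<open>Counts of a Poisson random measure\<close>

locale poisson_rm = prob_space \<Omega> for \<Omega> :: "'w measure" +
  fixes N :: "'w \<Rightarrow> 'b measure" and \<mu> :: "'b measure"
  assumes prm: "poisson_random_measure \<Omega> N \<mu>"
begin

lemma sets_N: "\<omega> \<in> space \<Omega> \<Longrightarrow> sets (N \<omega>) = sets \<mu>"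
  using prm by (auto simp: poisson_random_measure_def)

lemma measurable_N[measurable]: "A \<in> sets \<mu> \<Longrightarrow> (\<lambda>\<omega>. emeasure (N \<omega>) A) \<in> borel_measurable \<Omega>"
  using prm by (auto simp: poisson_random_measure_def)

lemma indep_N:
  assumes "finite I" "\<And>i. i \<in> I \<Longrightarrow> A i \<in> sets \<mu>" "disjoint_family_on A I"
  shows "indep_vars (\<lambda>_. borel) (\<lambda>i \<omega>. emeasure (N \<omega>) (A i)) I"
proof -
  obtain h where h: "bij_betw h {0..<card I} I" using ex_bij_betw_nat_finite[OF assms(1)] by blast
  then have h: "bij_betw h {..<card I} I" by (simp add: atLeast0LessThan)
  have hI: "h i \<in> I" if "i < card I" for i using h that by (auto simp: bij_betw_def)
  have "disjoint_family_on (\<lambda>i. A (h i)) {..<card I}"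
    using assms(3) h hI unfolding disjoint_family_on_def bij_betw_def inj_on_def by blast
  moreover have "\<forall>i<card I. A (h i) \<in> sets \<mu>" using hI assms(2) by auto
  moreover have "\<forall>(m::nat) A. (\<forall>i<m. A i \<in> sets \<mu>) \<longrightarrow> disjoint_family_on A {..<m} \<longrightarrow>
      indep_vars (\<lambda>_. borel) (\<lambda>i \<omega>. emeasure (N \<omega>) (A i)) {..<m}"
    using prm unfolding poisson_random_measure_def by (elim conjE)
  ultimately have "indep_vars (\<lambda>_. borel) (\<lambda>i \<omega>. emeasure (N \<omega>) (A (h i))) {..<card I}"
    by simp
  then show ?thesis by (rule indep_vars_reindex[OF h])
qed

lemma distr_N:
  assumes "A \<in> sets \<mu>" "emeasure \<mu> A < \<infinity>"
  shows "distr \<Omega> borel (\<lambda>\<omega>. emeasure (N \<omega>) A) = distr (measure_pmf (poisson0_pmf (measure \<mu> A))) borel of_nat"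
proof -
  have "emeasure \<mu> A = ennreal (measure \<mu> A)" using assms by (simp add: emeasure_eq_ennreal_measure)
  then show ?thesis using prm assms(1)
    by (simp add: poisson_random_measure_def poisson_law_eq)
qed

lemma prob_N:
  assumes "A \<in> sets \<mu>" "emeasure \<mu> A < \<infinity>" "S \<in> sets borel"
  shows "prob {\<omega> \<in> space \<Omega>. emeasure (N \<omega>) A \<in> S} = measure_pmf.prob (poisson0_pmf (measure \<mu> A)) (of_nat -` S)"
proof -
  have "prob {\<omega> \<in> space \<Omega>. emeasure (N \<omega>) A \<in> S} = measure (distr \<Omega> borel (\<lambda>\<omega>. emeasure (N \<omega>) A)) S"
    using assms by (subst measure_distr) (auto intro!: arg_cong[where f = prob])
  also have "\<dots> = measure_pmf.prob (poisson0_pmf (measure \<mu> A)) (of_nat -` S)"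
    unfolding distr_N[OF assms(1,2)] using assms(3) by (subst measure_distr) auto
  finally show ?thesis .
qed

lemma prob_N_eq:
  assumes "A \<in> sets \<mu>" "emeasure \<mu> A < \<infinity>"
  shows "prob {\<omega> \<in> space \<Omega>. emeasure (N \<omega>) A = of_nat n} = measure \<mu> A ^ n / fact n * exp (- measure \<mu> A)"
proof -
  have "(of_nat :: nat \<Rightarrow> ennreal) -` {of_nat n} = {n}" by auto
  with prob_N[OF assms, of "{of_nat n}"] show ?thesis
    by (simp add: measure_pmf_single pmf_poisson0)
qed

lemma prob_N_ge:
  assumes "A \<in> sets \<mu>" "emeasure \<mu> A < \<infinity>"
  shows "prob {\<omega> \<in> space \<Omega>. of_nat n \<le> emeasure (N \<omega>) A} \<le> measure \<mu> A ^ n"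
proof -
  have "(of_nat :: nat \<Rightarrow> ennreal) -` {of_nat n..} = {n..}" by auto
  with prob_N[OF assms, of "{of_nat n..}"] poisson0_tail[of "measure \<mu> A" n] show ?thesis
    by simp
qed

lemma AE_N_nat:
  assumes "A \<in> sets \<mu>" "emeasure \<mu> A < \<infinity>"
  shows "AE \<omega> in \<Omega>. emeasure (N \<omega>) A \<in> range of_nat"
proof -
  have range[measurable]: "range (of_nat :: nat \<Rightarrow> ennreal) \<in> sets borel"
    by (rule sets.countable) simp_all
  have "(of_nat :: nat \<Rightarrow> ennreal) -` range of_nat = UNIV" by auto
  then have "prob {\<omega> \<in> space \<Omega>. emeasure (N \<omega>) A \<in> range of_nat} = 1"
    using prob_N[OF assms range] by simp
  moreover have "{\<omega> \<in> space \<Omega>. emeasure (N \<omega>) A \<in> range of_nat} \<in> events"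
    using assms(1) by measurable
  ultimately show ?thesis by (simp add: prob_Collect_eq_1)
qed

lemma laplace_N:
  assumes "A \<in> sets \<mu>" "emeasure \<mu> A < \<infinity>"
  shows "expectation (\<lambda>\<omega>. exp (- (b * enn2real (emeasure (N \<omega>) A)))) = exp (- (measure \<mu> A * (1 - exp (- b))))"
proof -
  have "expectation (\<lambda>\<omega>. exp (- (b * enn2real (emeasure (N \<omega>) A)))) =
    (\<integral>x. exp (- (b * enn2real x)) \<partial>distr \<Omega> borel (\<lambda>\<omega>. emeasure (N \<omega>) A))"
    using assms by (subst integral_distr) auto
  also have "\<dots> = measure_pmf.expectation (poisson0_pmf (measure \<mu> A)) (\<lambda>n. exp (- (b * real n)))"
    unfolding distr_N[OF assms] by (subst integral_distr) auto
  finally show ?thesis by (simp add: poisson0_laplace)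
qed

end

locale poisson_proc = prob_space \<Omega> + mu: finite_measure \<mu>
  for \<Omega> :: "'w measure" and \<mu> :: "'b::topological_space measure" +
  fixes P :: "'w \<Rightarrow> 'b set"
  assumes process: "poisson_process \<Omega> P \<mu>" and sets_\<mu>[measurable_cong]: "sets \<mu> = sets borel"
begin

abbreviation N :: "'w \<Rightarrow> 'b measure" where
  "N \<omega> \<equiv> distr (count_space (P \<omega>)) borel (\<lambda>x. x)"

sublocale rm: poisson_rm \<Omega> N \<mu>
  by unfold_locales (use process in \<open>simp add: poisson_process_def\<close>)

lemma space_\<mu>: "space \<mu> = UNIV" using sets_eq_imp_space_eq[OF sets_\<mu>] by simp

lemma N_eq:
  assumes "A \<in> sets borel"
  shows "emeasure (N \<omega>) A = (if finite (P \<omega> \<inter> A) then of_nat (card (P \<omega> \<inter> A)) else \<infinity>)"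
proof -
  have "emeasure (N \<omega>) A = emeasure (count_space (P \<omega>)) (A \<inter> P \<omega>)"
    using assms by (subst emeasure_distr) auto
  then show ?thesis by (simp add: emeasure_count_space Int_commute)
qed

lemma emeasure_\<mu>_finite: "emeasure \<mu> A < \<infinity>"
  unfolding infinity_ennreal_def by (rule top.not_eq_extremum[THEN iffD1]) (rule mu.emeasure_finite)

lemma AE_finite: "AE \<omega> in \<Omega>. finite (P \<omega>)"
proof -
  have "AE \<omega> in \<Omega>. emeasure (N \<omega>) UNIV \<in> range of_nat"
    by (rule rm.AE_N_nat[OF _ emeasure_\<mu>_finite]) (simp add: sets_\<mu>)
  then show ?thesis
  proof eventually_elim
    case (elim \<omega>)
    then show ?case using N_eq[of UNIV \<omega>] by (auto split: if_splits)
  qed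
qed

lemma prob_ge:
  assumes "A \<in> sets borel"
  shows "prob {\<omega> \<in> space \<Omega>. of_nat n \<le> emeasure (N \<omega>) A} \<le> measure \<mu> A ^ n"
  by (rule rm.prob_N_ge[OF _ emeasure_\<mu>_finite]) (simp add: sets_\<mu> assms)

text \<open>Split according to the number \<open>i \<ge> 1\<close> of points in \<open>A\<close>.
  Counts in \<open>A\<close> and \<open>B - A\<close> are independent, and their tail bounds leave
  one factor \<open>measure \<mu> A\<close> in front of powers of \<open>measure \<mu> B\<close>.
  That factor makes the bound summable over disjoint sets \<open>A\<close>.\<close>

lemma prob_cluster:
  assumes A: "A \<in> sets borel" and B: "B \<in> sets borel" and AB: "A \<subseteq> B"
  shows "prob {\<omega> \<in> space \<Omega>. 1 \<le> emeasure (N \<omega>) A \<and> of_nat (Suc n) \<le> emeasure (N \<omega>) B}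
    \<le> real (Suc n) * (measure \<mu> A * measure \<mu> B ^ n)"
proof -
  let ?X = "\<lambda>\<omega>. emeasure (N \<omega>) A" and ?Y = "\<lambda>\<omega>. emeasure (N \<omega>) (B - A)"
  let ?E = "\<lambda>i. {\<omega> \<in> space \<Omega>. of_nat i \<le> ?X \<omega>} \<inter> {\<omega> \<in> space \<Omega>. of_nat (Suc n - i) \<le> ?Y \<omega>}"
  have BA[measurable]: "B - A \<in> sets borel" using A B by auto
  note [measurable] = A B
  define F where "F i = (if i = (0::nat) then A else B - A)" for i
  have "disjoint_family_on F {0, 1}" by (auto simp add: disjoint_family_on_def F_def)
  then have ind: "indep_vars (\<lambda>_. borel) (\<lambda>i \<omega>. emeasure (N \<omega>) (F i)) {0, 1}"
    by (rule rm.indep_N[rotated 2]) (use A BA in \<open>simp_all add: sets_\<mu> F_def\<close>)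
  have sub: "{\<omega> \<in> space \<Omega>. 1 \<le> ?X \<omega> \<and> of_nat (Suc n) \<le> emeasure (N \<omega>) B} \<subseteq> (\<Union>i\<in>{1..Suc n}. ?E i)"
  proof
    fix \<omega> assume "\<omega> \<in> {\<omega> \<in> space \<Omega>. 1 \<le> ?X \<omega> \<and> of_nat (Suc n) \<le> emeasure (N \<omega>) B}"
    then have \<omega>: "\<omega> \<in> space \<Omega>" "1 \<le> ?X \<omega>" "of_nat (Suc n) \<le> emeasure (N \<omega>) B" by auto
    \<comment> \<open>The first case also covers an infinite count in \<open>A\<close>; in the
      second the count is a natural number and serves as \<open>i\<close>.\<close>
    show "\<omega> \<in> (\<Union>i\<in>{1..Suc n}. ?E i)"
    proof (cases "of_nat (Suc n) \<le> ?X \<omega>")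
      case True
      then show ?thesis using \<omega> by (intro UN_I[of "Suc n"]) auto
    next
      case False
      then have fin: "finite (P \<omega> \<inter> A)" and X: "?X \<omega> = of_nat (card (P \<omega> \<inter> A))"
        using N_eq[OF A, of \<omega>] by (auto split: if_splits)
      let ?c = "card (P \<omega> \<inter> A)"
      have "(of_nat 1 :: ennreal) \<le> of_nat ?c" "\<not> (of_nat (Suc n) :: ennreal) \<le> of_nat ?c"
        using \<omega>(2) False X by simp_all
      then have c: "1 \<le> ?c" "?c < Suc n" by (simp_all only: of_nat_le_iff not_le)
      have "of_nat (Suc n - ?c) \<le> ?Y \<omega>"
      proof (cases "finite (P \<omega> \<inter> (B - A))")
        case True
        have eq: "P \<omega> \<inter> B = (P \<omega> \<inter> A) \<union> (P \<omega> \<inter> (B - A))" using AB by auto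
        have "finite (P \<omega> \<inter> B)" unfolding eq using fin True by simp
        then have "(of_nat (Suc n) :: ennreal) \<le> of_nat (card (P \<omega> \<inter> B))"
          using \<omega>(3) N_eq[OF B, of \<omega>] by simp
        then have "Suc n \<le> card (P \<omega> \<inter> B)" by (simp only: of_nat_le_iff)
        also have "\<dots> = ?c + card (P \<omega> \<inter> (B - A))"
          unfolding eq using fin True by (intro card_Un_disjoint) auto
        finally have "Suc n - ?c \<le> card (P \<omega> \<inter> (B - A))" by simp
        then show ?thesis using N_eq[OF BA, of \<omega>] True by (simp only: of_nat_le_iff if_True)
      qed (use N_eq[OF BA, of \<omega>] in simp)
      then show ?thesis using \<omega> X c by (intro UN_I[of ?c]) auto
    qed
  qed
  have E: "prob (?E i) \<le> measure \<mu> A * measure \<mu> B ^ n" if i: "i \<in> {1..Suc n}" for i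
  proof -
    let ?T = "\<lambda>j. if j = (0::nat) then {of_nat i..} else {of_nat (Suc n - i)..} :: ennreal set"
    have "?E i = (\<Inter>j\<in>{0,1}. (\<lambda>\<omega>. emeasure (N \<omega>) (F j)) -` ?T j \<inter> space \<Omega>)"
      by (auto simp: F_def)
    then have "prob (?E i) = (\<Prod>j\<in>{0,1}. prob ((\<lambda>\<omega>. emeasure (N \<omega>) (F j)) -` ?T j \<inter> space \<Omega>))"
      using indep_varsD_finite[OF ind, of ?T] by simp
    also have "\<dots> = prob {\<omega> \<in> space \<Omega>. of_nat i \<le> ?X \<omega>} * prob {\<omega> \<in> space \<Omega>. of_nat (Suc n - i) \<le> ?Y \<omega>}"
      by (simp add: F_def vimage_def Int_def conj_commute)
    also have "\<dots> \<le> measure \<mu> A ^ i * measure \<mu> (B - A) ^ (Suc n - i)"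
      using A BA by (intro mult_mono prob_ge) auto
    also have "\<dots> \<le> (measure \<mu> A * measure \<mu> B ^ (i - 1)) * measure \<mu> B ^ (Suc n - i)"
    proof (intro mult_mono)
      have "measure \<mu> A \<le> measure \<mu> B" using AB B by (intro mu.finite_measure_mono) (auto simp: sets_\<mu>)
      then have "measure \<mu> A ^ (i - 1) \<le> measure \<mu> B ^ (i - 1)" by (intro power_mono) auto
      moreover have "measure \<mu> A ^ i = measure \<mu> A * measure \<mu> A ^ (i - 1)"
        using i by (metis atLeastAtMost_iff not_one_le_zero power_eq_if)
      ultimately show "measure \<mu> A ^ i \<le> measure \<mu> A * measure \<mu> B ^ (i - 1)"
        by (simp add: mult_left_mono)
      show "measure \<mu> (B - A) ^ (Suc n - i) \<le> measure \<mu> B ^ (Suc n - i)"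
        using B by (intro power_mono mu.finite_measure_mono) (auto simp: sets_\<mu>)
    qed auto
    also have "\<dots> = measure \<mu> A * measure \<mu> B ^ n"
      using i by (simp add: mult.assoc flip: power_add)
    finally show ?thesis .
  qed
  have "prob {\<omega> \<in> space \<Omega>. 1 \<le> ?X \<omega> \<and> of_nat (Suc n) \<le> emeasure (N \<omega>) B} \<le> prob (\<Union>i\<in>{1..Suc n}. ?E i)"
    by (intro finite_measure_mono sub) measurable
  also have "\<dots> \<le> (\<Sum>i\<in>{1..Suc n}. prob (?E i))"
    by (intro finite_measure_subadditive_finite) auto
  also have "\<dots> \<le> (\<Sum>i\<in>{1..Suc n}. measure \<mu> A * measure \<mu> B ^ n)"
    by (intro sum_mono E)
  finally show ?thesis by simp
qed

end

section \<open>Functionals of a Poisson process on disjoint blocks\<close>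

text \<open>Reads a function of the set of occupied cells off the occupation numbers. The value 0 is
  a default for the case that some cell holds several points.\<close>

definition level :: "('c set \<Rightarrow> real) \<Rightarrow> 'c set \<Rightarrow> ('c \<Rightarrow> ennreal) \<Rightarrow> real" where
  "level \<psi> C v = (if \<forall>c\<in>C. v c = 0 \<or> v c = 1 then \<psi> {c \<in> C. v c = 1} else 0)"

lemma level_cong: "(\<And>c. c \<in> C \<Longrightarrow> v c = w c) \<Longrightarrow> level \<psi> C v = level \<psi> C w"
proof -
  assume "\<And>c. c \<in> C \<Longrightarrow> v c = w c"
  then have "(\<forall>c\<in>C. v c = 0 \<or> v c = 1) = (\<forall>c\<in>C. w c = 0 \<or> w c = 1)" "{c \<in> C. v c = 1} = {c \<in> C. w c = 1}"
    by auto
  then show ?thesis by (simp only: level_def)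
qed

text \<open>The expansion over all possible sets of occupied cells consists of products with one
  factor per cell, which suits both measurability and independence.\<close>

lemma level_sum:
  assumes "finite C"
  shows "level \<psi> C v = (\<Sum>S\<in>Pow C. \<psi> S * (\<Prod>c\<in>C. of_bool (v c = of_bool (c \<in> S))))"
proof -
  have prod: "(\<Prod>c\<in>C. of_bool (v c = of_bool (c \<in> S))) = (of_bool (\<forall>c\<in>C. v c = of_bool (c \<in> S)) :: real)" for S
  proof (cases "\<forall>c\<in>C. v c = of_bool (c \<in> S)")
    case False
    then obtain c where c: "c \<in> C" "v c \<noteq> of_bool (c \<in> S)" by blast
    have "(\<Prod>c\<in>C. of_bool (v c = of_bool (c \<in> S))) = (0::real)"
      by (rule prod_zero[OF assms]) (use c in \<open>auto intro!: bexI[of _ c]\<close>)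
    then show ?thesis using False by simp
  qed simp
  show ?thesis
  proof (cases "\<forall>c\<in>C. v c = 0 \<or> v c = 1")
    case True
    let ?S = "{c \<in> C. v c = 1}"
    have "(\<forall>c\<in>C. v c = of_bool (c \<in> S)) \<longleftrightarrow> S = ?S" if "S \<subseteq> C" for S
      using True that by (auto simp: of_bool_def split: if_splits)
    then have "(\<Sum>S\<in>Pow C. \<psi> S * (\<Prod>c\<in>C. of_bool (v c = of_bool (c \<in> S)))) = (\<Sum>S\<in>Pow C. if S = ?S then \<psi> S else 0)"
      unfolding prod by (intro sum.cong) auto
    also have "\<dots> = \<psi> ?S" using assms by (subst sum.delta) auto
    finally show ?thesis using True by (simp add: level_def)
  next
    case False
    then obtain c where c: "c \<in> C" "v c \<noteq> 0" "v c \<noteq> 1" by blast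
    then have n: "(\<forall>c\<in>C. v c = of_bool (c \<in> S)) = False" for S by (auto intro!: bexI[of _ c])
    have "(\<Sum>S\<in>Pow C. \<psi> S * (\<Prod>c\<in>C. of_bool (v c = of_bool (c \<in> S)))) = 0"
      unfolding prod n by simp
    then show ?thesis using False by (simp only: level_def if_False)
  qed
qed

lemma measurable_level:
  assumes "finite C"
  shows "level \<psi> C \<in> borel_measurable (PiM C (\<lambda>_. borel))"
proof -
  have "(\<lambda>v :: _ \<Rightarrow> ennreal. \<Sum>S\<in>Pow C. \<psi> S * (\<Prod>c\<in>C. of_bool (v c = of_bool (c \<in> S)))) \<in> borel_measurable (PiM C (\<lambda>_. borel))"
  proof (intro borel_measurable_sum borel_measurable_times borel_measurable_const borel_measurable_prod)
    fix S c assume "c \<in> C"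
    then have comp: "(\<lambda>v. v c) \<in> measurable (PiM C (\<lambda>_. borel)) (borel :: ennreal measure)"
      by (rule measurable_component_singleton)
    have "(indicator {of_bool (c \<in> S)} :: ennreal \<Rightarrow> real) \<in> borel_measurable borel"
      by (intro borel_measurable_indicator) simp
    from measurable_compose[OF comp this] show "(\<lambda>v :: _ \<Rightarrow> ennreal. of_bool (v c = of_bool (c \<in> S)) :: real) \<in> borel_measurable (PiM C (\<lambda>_. borel))"
      by (simp only: indicator_def singleton_iff)
  qed
  then show ?thesis unfolding level_sum[OF assms, abs_def] .
qed

lemma level_bounds: "(\<And>S. 0 \<le> \<psi> S) \<Longrightarrow> (\<And>S. \<psi> S \<le> 1) \<Longrightarrow> 0 \<le> level \<psi> C v \<and> level \<psi> C v \<le> 1"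
  by (simp add: level_def)

text \<open>Words with a repeated letter have a smaller image and drop out through \<open>g\<close>;
  every set of \<open>j\<close> letters is the image of \<open>fact j\<close> words. This is the
  origin of the factorial in the limiting intensity.\<close>

lemma sum_over_injections:
  fixes g :: "'c set \<Rightarrow> real" and p :: "'c \<Rightarrow> real"
  assumes C: "finite C" and g: "\<And>S. card S \<noteq> j \<Longrightarrow> g S = 0"
  shows "(\<Sum>w\<in>{..<j} \<rightarrow>\<^sub>E C. g (w ` {..<j}) * (\<Prod>i<j. p (w i))) = fact j * (\<Sum>S\<in>Pow C. g S * (\<Prod>c\<in>S. p c))"
proof -
  let ?A = "{..<j} \<rightarrow>\<^sub>E C" and ?h = "\<lambda>w. g (w ` {..<j}) * (\<Prod>i<j. p (w i))"
  have finA: "finite ?A" using C by (intro finite_PiE) auto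
  have "(\<Sum>S\<in>Pow C. sum ?h {w \<in> ?A. w ` {..<j} = S}) = sum ?h ?A"
    by (rule sum.group[OF finA]) (use C in \<open>auto simp: PiE_def\<close>)
  moreover have "sum ?h {w \<in> ?A. w ` {..<j} = S} = fact j * (g S * (\<Prod>c\<in>S. p c))" if S: "S \<in> Pow C" for S
  proof (cases "card S = j")
    case True
    have finS: "finite S" using S C finite_subset by auto
    have inj: "inj_on w {..<j}" if "w ` {..<j} = S" for w
      using that True by (intro eq_card_imp_inj_on) auto
    have fib: "{w \<in> ?A. w ` {..<j} = S} = {w \<in> {..<j} \<rightarrow>\<^sub>E S. inj_on w {..<j}}"
    proof (intro equalityI subsetI)
      fix w assume w: "w \<in> {w \<in> {..<j} \<rightarrow>\<^sub>E S. inj_on w {..<j}}"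
      then have "w ` {..<j} \<subseteq> S" by auto
      moreover have "card (w ` {..<j}) = card S" using w True by (simp add: card_image)
      ultimately have "w ` {..<j} = S" using finS by (intro card_subset_eq) auto
      moreover have "w \<in> ?A" using w S by (auto simp: PiE_iff)
      ultimately show "w \<in> {w \<in> ?A. w ` {..<j} = S}" by simp
    next
      fix w assume "w \<in> {w \<in> ?A. w ` {..<j} = S}"
      then have w: "w \<in> ?A" "w ` {..<j} = S" by auto
      then have "w \<in> {..<j} \<rightarrow>\<^sub>E S" unfolding PiE_iff by blast
      then show "w \<in> {w \<in> {..<j} \<rightarrow>\<^sub>E S. inj_on w {..<j}}" using inj[OF w(2)] by simp
    qed
    have "card {w \<in> {..<j} \<rightarrow>\<^sub>E S. inj_on w {..<j}} = fact j"
      using card_inj_on_subset_funcset[of "{..<j}" S "{..<j}"] finS True by (simp add: fact_prod_rev)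
    moreover have "?h w = g S * (\<Prod>c\<in>S. p c)" if "w \<in> {w \<in> ?A. w ` {..<j} = S}" for w
    proof -
      have wS: "w ` {..<j} = S" using that by auto
      have "(\<Prod>c\<in>w ` {..<j}. p c) = (\<Prod>i<j. p (w i))"
        using prod.reindex[OF inj[OF wS], of p] by simp
      then show ?thesis using wS by simp
    qed
    ultimately show ?thesis using fib by simp
  next
    case False
    then show ?thesis using g by (simp add: sum.neutral)
  qed
  then have "(\<Sum>S\<in>Pow C. sum ?h {w \<in> ?A. w ` {..<j} = S}) = (\<Sum>S\<in>Pow C. fact j * (g S * (\<Prod>c\<in>S. p c)))"
    by (rule sum.cong[OF refl])
  ultimately show ?thesis by (simp only: sum_distrib_left)
qed

text \<open>
  A functional \<open>\<psi>\<close> of the points in a block depends on more than countings of fixed Borel sets, so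
  independence over blocks and even measurability are not immediate. The cells of the \<open>m\<close>-th
  partition provide both: once they separate the points, the occupation numbers determine the
  approximation \<open>\<phi> m\<close> of \<open>\<psi>\<close>.
\<close>

locale block_functional = poisson_proc \<Omega> \<mu> P
  for \<Omega> :: "'w measure" and \<mu> :: "'b::topological_space measure" and P :: "'w \<Rightarrow> 'b set" +
  fixes Q :: "'q set" and B :: "'q \<Rightarrow> 'b set" and C :: "nat \<Rightarrow> 'q \<Rightarrow> 'c set"
    and \<kappa> :: "nat \<Rightarrow> 'b \<Rightarrow> 'c" and \<psi> :: "'b set \<Rightarrow> real" and \<phi> :: "nat \<Rightarrow> 'c set \<Rightarrow> real" and j :: nat
  assumes finite_Q: "finite Q" and cell: "\<And>m c. \<kappa> m -` {c} \<in> sets borel"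
    and finite_C: "\<And>m q. q \<in> Q \<Longrightarrow> finite (C m q)"
    and B_eq: "\<And>m q. q \<in> Q \<Longrightarrow> B q = \<kappa> m -` C m q"
    and disj: "\<And>m. disjoint_family_on (C m) Q"
    and \<phi>_nonneg: "\<And>m S. 0 \<le> \<phi> m S" and \<phi>_le: "\<And>m S. \<phi> m S \<le> 1"
    and \<phi>_card: "\<And>m S. card S \<noteq> j \<Longrightarrow> \<phi> m S = 0"
    and \<phi>_lim: "\<And>X. finite X \<Longrightarrow> (\<lambda>m. \<phi> m (\<kappa> m ` X)) \<longlonglongrightarrow> \<psi> X"
    and \<kappa>_inj: "\<And>X. finite X \<Longrightarrow> \<forall>\<^sub>F m in sequentially. inj_on (\<kappa> m) X"
begin

definition occupation :: "nat \<Rightarrow> 'w \<Rightarrow> 'c \<Rightarrow> ennreal" where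
  "occupation m \<omega> c = emeasure (N \<omega>) (\<kappa> m -` {c})"

definition W :: "nat \<Rightarrow> 'q \<Rightarrow> 'w \<Rightarrow> real" where
  "W m q \<omega> = level (\<phi> m) (C m q) (occupation m \<omega>)"

definition tuple_integral :: "'q \<Rightarrow> real" where
  "tuple_integral q = (\<integral>x. \<psi> (x ` {..<j}) * (\<Prod>i<j. indicator (B q) (x i)) \<partial>PiM {..<j} (\<lambda>_. \<mu>))"

lemma measurable_occupation[measurable]: "(\<lambda>\<omega>. occupation m \<omega> c) \<in> borel_measurable \<Omega>"
  unfolding occupation_def using cell by measurable

lemma measurable_W[measurable]: "q \<in> Q \<Longrightarrow> W m q \<in> borel_measurable \<Omega>"
proof -
  assume q: "q \<in> Q"
  have "W m q = (\<lambda>\<omega>. level (\<phi> m) (C m q) (\<lambda>c\<in>C m q. occupation m \<omega> c))"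
    unfolding W_def by (intro ext level_cong) simp
  moreover
  have "(\<lambda>\<omega>. \<lambda>c\<in>C m q. occupation m \<omega> c) \<in> measurable \<Omega> (PiM (C m q) (\<lambda>_. borel))"
    by measurable
  from measurable_compose[OF this measurable_level[OF finite_C[OF q]], of "\<phi> m"] calculation
  show ?thesis by (simp only:)
qed

lemma W_bounds: "0 \<le> W m q \<omega>" "W m q \<omega> \<le> 1"
  using level_bounds[of "\<phi> m" "C m q" "occupation m \<omega>"] \<phi>_nonneg \<phi>_le by (auto simp: W_def)

lemma W_lim:
  assumes q: "q \<in> Q" and fin: "finite (P \<omega>)"
  shows "(\<lambda>m. W m q \<omega>) \<longlonglongrightarrow> \<psi> (P \<omega> \<inter> B q)"
proof -
  let ?X = "P \<omega> \<inter> B q"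
  have X: "finite ?X" using fin by auto
  have "\<forall>\<^sub>F m in sequentially. \<phi> m (\<kappa> m ` ?X) = W m q \<omega>"
    using \<kappa>_inj[OF X]
  proof eventually_elim
    case (elim m)
    have occ: "occupation m \<omega> c = of_bool (c \<in> \<kappa> m ` ?X)" if c: "c \<in> C m q" for c
    proof -
      have "P \<omega> \<inter> \<kappa> m -` {c} = {x \<in> ?X. \<kappa> m x = c}" using c B_eq[OF q, of m] by auto
      moreover have "card {x \<in> ?X. \<kappa> m x = c} = of_bool (c \<in> \<kappa> m ` ?X)"
      proof (cases "c \<in> \<kappa> m ` ?X")
        case True
        then obtain x where x: "x \<in> ?X" "c = \<kappa> m x" by blast
        then have "{x \<in> ?X. \<kappa> m x = c} = {x}" using elim by (auto simp: inj_on_def)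
        then show ?thesis using True by simp
      next
        case False
        then have "{x \<in> ?X. \<kappa> m x = c} = {}" by auto
        then show ?thesis using False by (simp only: card.empty of_bool_eq)
      qed
      moreover have "finite (P \<omega> \<inter> \<kappa> m -` {c})" using fin by auto
      ultimately have "occupation m \<omega> c = of_nat (of_bool (c \<in> \<kappa> m ` ?X))"
        using N_eq[OF cell, of \<omega> m c] by (simp only: occupation_def if_True)
      then show ?thesis by simp
    qed
    have "\<kappa> m ` ?X \<subseteq> C m q" using B_eq[OF q, of m] by auto
    then have "{c \<in> C m q. occupation m \<omega> c = 1} = \<kappa> m ` ?X" using occ by (auto simp: of_bool_def split: if_splits)
    moreover have "\<forall>c\<in>C m q. occupation m \<omega> c = 0 \<or> occupation m \<omega> c = 1" using occ by (auto simp: of_bool_def)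
    ultimately show ?case by (simp add: W_def level_def)
  qed
  from Lim_transform_eventually[OF \<phi>_lim[OF X] this] show ?thesis .
qed

lemma indep_occupation:
  "finite I \<Longrightarrow> indep_vars (\<lambda>_. borel) (\<lambda>c \<omega>. occupation m \<omega> c) I"
  unfolding occupation_def
  by (rule rm.indep_N) (use cell in \<open>auto simp: sets_\<mu> disjoint_family_on_def\<close>)

text \<open>At a fixed mesh the blocks use disjoint groups of cells, and disjoint groups of
  independent variables are independent.\<close>

lemma expectation_prod_W:
  "expectation (\<lambda>\<omega>. \<Prod>q\<in>Q. 1 - W m q \<omega>) = (\<Prod>q\<in>Q. 1 - expectation (W m q))"
proof -
  let ?I = "\<Union>q\<in>Q. C m q"
  have "indep_vars (\<lambda>q. PiM (C m q) (\<lambda>_. borel)) (\<lambda>q \<omega>. \<lambda>c\<in>C m q. occupation m \<omega> c) Q"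
    by (rule indep_vars_restrict[OF indep_occupation[of ?I]]) (use finite_Q finite_C disj in auto)
  then have "indep_vars (\<lambda>_. borel) (\<lambda>q \<omega>. 1 - level (\<phi> m) (C m q) (\<lambda>c\<in>C m q. occupation m \<omega> c)) Q"
    by (rule indep_vars_compose2) (intro borel_measurable_diff borel_measurable_const measurable_level finite_C)
  moreover have "level (\<phi> m) (C m q) (\<lambda>c\<in>C m q. occupation m \<omega> c) = W m q \<omega>" for q \<omega>
    unfolding W_def by (rule level_cong) simp
  ultimately have ind: "indep_vars (\<lambda>_. borel) (\<lambda>q \<omega>. 1 - W m q \<omega>) Q" by simp
  have int: "integrable \<Omega> (W m q)" if "q \<in> Q" for q
    using that W_bounds[of m q] by (intro integrable_const_bound[where B = 1]) auto
  have "expectation (\<lambda>\<omega>. \<Prod>q\<in>Q. 1 - W m q \<omega>) = (\<Prod>q\<in>Q. expectation (\<lambda>\<omega>. 1 - W m q \<omega>))"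
    using int by (intro indep_vars_lebesgue_integral finite_Q ind) auto
  also have "\<dots> = (\<Prod>q\<in>Q. 1 - expectation (W m q))"
    using int by (intro prod.cong) (simp_all add: prob_space)
  finally show ?thesis .
qed

text \<open>A set \<open>S\<close> of cells contributes the probability that its cells hold one
  point each and the rest of the block is empty. The exponential factors of all cells multiply to
  the one of the block.\<close>

lemma expectation_W:
  assumes q: "q \<in> Q"
  shows "expectation (W m q) = exp (- measure \<mu> (B q)) *
    (\<Sum>S\<in>Pow (C m q). \<phi> m S * (\<Prod>c\<in>S. measure \<mu> (\<kappa> m -` {c})))"
proof -
  let ?C = "C m q" and ?\<mu> = "\<lambda>c. measure \<mu> (\<kappa> m -` {c})"
  note fin = finite_C[OF q, of m]
  have meas: "measure \<mu> (B q) = (\<Sum>c\<in>?C. ?\<mu> c)"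
  proof -
    have "B q = (\<Union>c\<in>?C. \<kappa> m -` {c})" unfolding B_eq[OF q, of m] by auto
    moreover have "measure \<mu> (\<Union>c\<in>?C. \<kappa> m -` {c}) = (\<Sum>c\<in>?C. ?\<mu> c)"
      by (rule mu.finite_measure_finite_Union[OF fin])
        (use cell in \<open>auto simp: sets_\<mu> disjoint_family_on_def\<close>)
    ultimately show ?thesis by simp
  qed
  have one: "expectation (\<lambda>\<omega>. of_bool (occupation m \<omega> c = of_bool b)) = (if b then ?\<mu> c else 1) * exp (- ?\<mu> c)" for c b
  proof -
    have "expectation (\<lambda>\<omega>. of_bool (occupation m \<omega> c = of_bool b) :: real) =
        expectation (indicator {\<omega> \<in> space \<Omega>. occupation m \<omega> c = of_nat (of_bool b)})"
      by (intro Bochner_Integration.integral_cong) (auto simp: indicator_def)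
    also have "\<dots> = prob {\<omega> \<in> space \<Omega>. emeasure (N \<omega>) (\<kappa> m -` {c}) = of_nat (of_bool b)}"
      by (simp only: Bochner_Integration.integral_indicator) (auto simp: occupation_def intro!: arg_cong[where f = prob])
    also have "\<dots> = (if b then ?\<mu> c else 1) * exp (- ?\<mu> c)"
      using cell by (subst rm.prob_N_eq) (auto simp: sets_\<mu> emeasure_\<mu>_finite[simplified])
    finally show ?thesis .
  qed
  have prod: "expectation (\<lambda>\<omega>. \<Prod>c\<in>?C. of_bool (occupation m \<omega> c = of_bool (c \<in> S))) =
      (\<Prod>c\<in>S. ?\<mu> c) * exp (- measure \<mu> (B q))" if S: "S \<in> Pow ?C" for S
  proof -
    have ind: "indep_vars (\<lambda>_. borel) (\<lambda>c \<omega>. of_bool (occupation m \<omega> c = of_bool (c \<in> S)) :: real) ?C"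
      by (rule indep_vars_compose2[OF indep_occupation[OF fin]]) (simp add: of_bool_def)
    have "expectation (\<lambda>\<omega>. \<Prod>c\<in>?C. of_bool (occupation m \<omega> c = of_bool (c \<in> S)) :: real) =
        (\<Prod>c\<in>?C. expectation (\<lambda>\<omega>. of_bool (occupation m \<omega> c = of_bool (c \<in> S))))"
    proof (rule indep_vars_lebesgue_integral[OF fin ind])
      show "integrable \<Omega> (\<lambda>\<omega>. of_bool (occupation m \<omega> c = of_bool (c \<in> S)) :: real)" for c
        by (rule integrable_const_bound[where B = 1]) (simp_all add: of_bool_def)
    qed
    also have "\<dots> = (\<Prod>c\<in>?C. if c \<in> S then ?\<mu> c else 1) * (\<Prod>c\<in>?C. exp (- ?\<mu> c))"
      by (simp add: one prod.distrib)
    also have "(\<Prod>c\<in>?C. if c \<in> S then ?\<mu> c else 1) = (\<Prod>c\<in>S. ?\<mu> c)"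
    proof -
      have "?C \<inter> {c. c \<in> S} = S" using S by auto
      then show ?thesis using prod.inter_restrict[OF fin, of ?\<mu> S] S by (simp add: Int_absorb1 inf_commute)
    qed
    also have "(\<Prod>c\<in>?C. exp (- ?\<mu> c)) = exp (- measure \<mu> (B q))"
      using fin by (simp add: meas exp_sum flip: sum_negf)
    finally show ?thesis .
  qed
  have "expectation (W m q) = expectation (\<lambda>\<omega>. \<Sum>S\<in>Pow ?C. \<phi> m S * (\<Prod>c\<in>?C. of_bool (occupation m \<omega> c = of_bool (c \<in> S))))"
    unfolding W_def level_sum[OF fin] ..
  also have "\<dots> = (\<Sum>S\<in>Pow ?C. \<phi> m S * expectation (\<lambda>\<omega>. \<Prod>c\<in>?C. of_bool (occupation m \<omega> c = of_bool (c \<in> S))))"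
  proof (subst Bochner_Integration.integral_sum)
    fix S
    have "AE \<omega> in \<Omega>. norm (\<Prod>c\<in>?C. of_bool (occupation m \<omega> c = of_bool (c \<in> S)) :: real) \<le> 1"
      by (intro AE_I2) (auto simp: abs_prod intro!: prod_le_1)
    then have "integrable \<Omega> (\<lambda>\<omega>. \<Prod>c\<in>?C. of_bool (occupation m \<omega> c = of_bool (c \<in> S)) :: real)"
      by (rule integrable_const_bound) (intro borel_measurable_prod, simp add: of_bool_def)
    then show "integrable \<Omega> (\<lambda>\<omega>. \<phi> m S * (\<Prod>c\<in>?C. of_bool (occupation m \<omega> c = of_bool (c \<in> S))))"
      by simp
  qed simp
  also have "\<dots> = (\<Sum>S\<in>Pow ?C. \<phi> m S * ((\<Prod>c\<in>S. ?\<mu> c) * exp (- measure \<mu> (B q))))"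
    by (intro sum.cong) (simp_all add: prod)
  finally show ?thesis by (simp add: sum_distrib_left mult_ac)
qed

sublocale tuples: product_sigma_finite "\<lambda>_::nat. \<mu>"
  by unfold_locales

lemma finite_measure_tuples: "finite_measure (PiM {..<j} (\<lambda>_. \<mu>))"
proof (rule finite_measureI)
  have "emeasure (PiM {..<j} (\<lambda>_. \<mu>)) (\<Pi>\<^sub>E i\<in>{..<j}. space \<mu>) = (\<Prod>i<j. emeasure \<mu> (space \<mu>))"
    by (rule tuples.emeasure_PiM) auto
  then show "emeasure (PiM {..<j} (\<lambda>_. \<mu>)) (space (PiM {..<j} (\<lambda>_. \<mu>))) \<noteq> \<infinity>"
    by (simp add: space_PiM mu.emeasure_eq_measure ennreal_power)
qed

definition tuple_level :: "nat \<Rightarrow> 'q \<Rightarrow> (nat \<Rightarrow> 'b) \<Rightarrow> real" where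
  "tuple_level m q x = \<phi> m (\<kappa> m ` x ` {..<j}) * (\<Prod>i<j. indicator (B q) (x i))"

text \<open>At most one word survives in the sum, namely the word \<open>?w\<close> of cells in
  which the entries of the tuple lie.\<close>

lemma tuple_level_eq:
  assumes q: "q \<in> Q"
  shows "tuple_level m q x = (\<Sum>w\<in>{..<j} \<rightarrow>\<^sub>E C m q. \<phi> m (w ` {..<j}) * (\<Prod>i<j. indicator (\<kappa> m -` {w i}) (x i)))"
proof -
  let ?w = "\<lambda>i\<in>{..<j}. \<kappa> m (x i)"
  have prod: "(\<Prod>i<j. indicator (\<kappa> m -` {w i}) (x i)) = (of_bool (w = ?w) :: real)" if "w \<in> {..<j} \<rightarrow>\<^sub>E C m q" for w
  proof (cases "w = ?w")
    case True
    then show ?thesis by (auto intro!: prod.neutral)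
  next
    case False
    moreover have "w = ?w" if "\<forall>i<j. w i = \<kappa> m (x i)"
      using \<open>w \<in> {..<j} \<rightarrow>\<^sub>E C m q\<close> that by (intro extensionalityI[of _ "{..<j}"]) (auto simp: PiE_def)
    ultimately obtain i where "i < j" "w i \<noteq> \<kappa> m (x i)" by blast
    then have "(\<Prod>i<j. indicator (\<kappa> m -` {w i}) (x i)) = (0::real)"
      by (intro prod_zero) (auto intro!: bexI[of _ i] simp: indicator_def)
    then show ?thesis using False by simp
  qed
  have aux: "p = of_bool b \<Longrightarrow> a * p = (if b then a else 0)" for p a :: real and b by simp
  have "(\<Sum>w\<in>{..<j} \<rightarrow>\<^sub>E C m q. \<phi> m (w ` {..<j}) * (\<Prod>i<j. indicator (\<kappa> m -` {w i}) (x i))) =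
      (\<Sum>w\<in>{..<j} \<rightarrow>\<^sub>E C m q. if w = ?w then \<phi> m (w ` {..<j}) else 0)"
  proof (rule sum.cong[OF refl])
    fix w assume "w \<in> {..<j} \<rightarrow>\<^sub>E C m q"
    from prod[OF this]
    show "\<phi> m (w ` {..<j}) * (\<Prod>i<j. indicator (\<kappa> m -` {w i}) (x i)) = (if w = ?w then \<phi> m (w ` {..<j}) else 0)"
      by (rule aux)
  qed
  also have "\<dots> = (if ?w \<in> {..<j} \<rightarrow>\<^sub>E C m q then \<phi> m (?w ` {..<j}) else 0)"
    using finite_C[OF q] by (subst sum.delta) (auto intro!: finite_PiE)
  also have "?w ` {..<j} = \<kappa> m ` x ` {..<j}" by auto
  also have "?w \<in> {..<j} \<rightarrow>\<^sub>E C m q \<longleftrightarrow> (\<forall>i<j. x i \<in> B q)"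
    by (auto simp: B_eq[OF q, of m] PiE_def Pi_def)
  also have "(if \<forall>i<j. x i \<in> B q then \<phi> m (\<kappa> m ` x ` {..<j}) else 0) = tuple_level m q x"
  proof (cases "\<forall>i<j. x i \<in> B q")
    case False
    then obtain i where "i < j" "x i \<notin> B q" by blast
    then have "(\<Prod>i<j. indicator (B q) (x i)) = (0::real)"
      by (intro prod_zero) (auto intro!: bexI[of _ i] simp: indicator_def)
    then show ?thesis using False by (simp add: tuple_level_def)
  qed (simp add: tuple_level_def)
  finally show ?thesis ..
qed

lemma measurable_cell_indicator:
  "i < j \<Longrightarrow> (\<lambda>x. indicator (\<kappa> m -` {c}) (x i) :: real) \<in> borel_measurable (PiM {..<j} (\<lambda>_. \<mu>))"
proof -
  assume "i < j"
  then have [measurable]: "(\<lambda>x. x i) \<in> measurable (PiM {..<j} (\<lambda>_. \<mu>)) \<mu>"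
    by (intro measurable_component_singleton) auto
  have [measurable]: "\<kappa> m -` {c} \<in> sets \<mu>" using cell sets_\<mu> by simp
  show ?thesis by measurable
qed

lemma measurable_tuple_level:
  assumes q: "q \<in> Q" shows "tuple_level m q \<in> borel_measurable (PiM {..<j} (\<lambda>_. \<mu>))"
  unfolding tuple_level_eq[OF q, abs_def]
  by (intro borel_measurable_sum borel_measurable_times borel_measurable_const borel_measurable_prod
      measurable_cell_indicator) auto

lemma tuple_level_bounds: "0 \<le> tuple_level m q x" "tuple_level m q x \<le> 1"
proof -
  have "0 \<le> (\<Prod>i<j. indicator (B q) (x i) :: real)" by (intro prod_nonneg) auto
  moreover have "(\<Prod>i<j. indicator (B q) (x i) :: real) \<le> 1" by (intro prod_le_1) (auto simp: indicator_def)
  ultimately show "0 \<le> tuple_level m q x" "tuple_level m q x \<le> 1"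
    using \<phi>_nonneg \<phi>_le by (auto simp: tuple_level_def intro!: mult_le_one)
qed

lemma tuple_level_lim: "(\<lambda>m. tuple_level m q x) \<longlonglongrightarrow> \<psi> (x ` {..<j}) * (\<Prod>i<j. indicator (B q) (x i))"
  unfolding tuple_level_def by (intro tendsto_intros \<phi>_lim) auto

lemma measurable_tuple_limit:
  "q \<in> Q \<Longrightarrow> (\<lambda>x. \<psi> (x ` {..<j}) * (\<Prod>i<j. indicator (B q) (x i))) \<in> borel_measurable (PiM {..<j} (\<lambda>_. \<mu>))"
  by (rule borel_measurable_LIMSEQ_real[OF tuple_level_lim measurable_tuple_level])

text \<open>The same sum over sets of cells occurs in \<open>expectation_W\<close>. Hence at every
  mesh the Poisson expectation is \<open>exp (- measure \<mu> (B q)) / fact j\<close> times an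
  integral over tuples, and the limit in \<open>m\<close> can be taken on the integral side.\<close>

lemma integral_tuple_level:
  assumes q: "q \<in> Q"
  shows "(\<integral>x. tuple_level m q x \<partial>PiM {..<j} (\<lambda>_. \<mu>)) =
    fact j * (\<Sum>S\<in>Pow (C m q). \<phi> m S * (\<Prod>c\<in>S. measure \<mu> (\<kappa> m -` {c})))"
proof -
  interpret F: finite_measure "PiM {..<j} (\<lambda>_. \<mu>)" by (rule finite_measure_tuples)
  have "(\<integral>x. tuple_level m q x \<partial>PiM {..<j} (\<lambda>_. \<mu>)) =
    (\<Sum>w\<in>{..<j} \<rightarrow>\<^sub>E C m q. \<phi> m (w ` {..<j}) * (\<integral>x. (\<Prod>i<j. indicator (\<kappa> m -` {w i}) (x i)) \<partial>PiM {..<j} (\<lambda>_. \<mu>)))"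
    unfolding tuple_level_eq[OF q]
  proof (subst Bochner_Integration.integral_sum)
    fix w
    have "integrable (PiM {..<j} (\<lambda>_. \<mu>)) (\<lambda>x. \<Prod>i<j. indicator (\<kappa> m -` {w i}) (x i) :: real)"
      by (intro F.integrable_const_bound[where B = 1] borel_measurable_prod measurable_cell_indicator AE_I2)
        (auto simp: abs_prod indicator_def intro!: prod_le_1)
    then show "integrable (PiM {..<j} (\<lambda>_. \<mu>)) (\<lambda>x. \<phi> m (w ` {..<j}) * (\<Prod>i<j. indicator (\<kappa> m -` {w i}) (x i)))"
      by simp
  qed simp
  also have "\<dots> = (\<Sum>w\<in>{..<j} \<rightarrow>\<^sub>E C m q. \<phi> m (w ` {..<j}) * (\<Prod>i<j. measure \<mu> (\<kappa> m -` {w i})))"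
  proof (intro sum.cong refl arg_cong2[where f = "(*)"])
    fix w
    have "integrable \<mu> (indicator (\<kappa> m -` {c}) :: _ \<Rightarrow> real)" for c
      using cell emeasure_\<mu>_finite by (simp add: integrable_indicator_iff sets_\<mu>)
    then show "(\<integral>x. (\<Prod>i<j. indicator (\<kappa> m -` {w i}) (x i)) \<partial>PiM {..<j} (\<lambda>_. \<mu>)) = (\<Prod>i<j. measure \<mu> (\<kappa> m -` {w i}))"
      by (subst tuples.product_integral_prod) (auto simp: space_\<mu>)
  qed
  also have "\<dots> = fact j * (\<Sum>S\<in>Pow (C m q). \<phi> m S * (\<Prod>c\<in>S. measure \<mu> (\<kappa> m -` {c})))"
    by (rule sum_over_injections[OF finite_C[OF q] \<phi>_card])
  finally show ?thesis .
qed

lemma finite_event[measurable]: "{\<omega> \<in> space \<Omega>. finite (P \<omega>)} \<in> events"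
proof -
  have "{\<omega> \<in> space \<Omega>. finite (P \<omega>)} = {\<omega> \<in> space \<Omega>. emeasure (N \<omega>) UNIV \<noteq> \<infinity>}"
    using N_eq[of UNIV] by auto
  also have "\<dots> \<in> events" by measurable
  finally show ?thesis .
qed

text \<open>\<open>W_lim\<close> requires a finite configuration. The indicator of that event makes
  the approximations converge at every \<open>\<omega>\<close>, and this also gives measurability of
  the limit.\<close>

lemma expectation_prod_blocks:
  defines "f \<equiv> \<lambda>\<omega>. indicator {\<omega> \<in> space \<Omega>. finite (P \<omega>)} \<omega> * (\<Prod>q\<in>Q. 1 - \<psi> (P \<omega> \<inter> B q))"
  shows "f \<in> borel_measurable \<Omega>"
    and "expectation f = (\<Prod>q\<in>Q. 1 - exp (- measure \<mu> (B q)) / fact j * tuple_integral q)"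
proof -
  let ?F = "{\<omega> \<in> space \<Omega>. finite (P \<omega>)}"
  define g where "g m \<omega> = indicator ?F \<omega> * (\<Prod>q\<in>Q. 1 - W m q \<omega>)" for m \<omega>
  have g_lim: "(\<lambda>m. g m \<omega>) \<longlonglongrightarrow> f \<omega>" for \<omega>
  proof (cases "\<omega> \<in> ?F")
    case True
    then show ?thesis unfolding g_def f_def by (intro tendsto_intros W_lim) auto
  qed (simp add: g_def f_def)
  have g_meas: "g m \<in> borel_measurable \<Omega>" for m
    unfolding g_def[abs_def] by measurable
  show f_meas: "f \<in> borel_measurable \<Omega>"
    by (rule borel_measurable_LIMSEQ_real[OF g_lim g_meas])
  have "(\<lambda>m. expectation (g m)) \<longlonglongrightarrow> expectation f"
  proof (rule integral_dominated_convergence[where w = "\<lambda>_. 1"])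
    show "AE \<omega> in \<Omega>. norm (g m \<omega>) \<le> 1" for m
    proof (rule AE_I2)
      fix \<omega>
      have "(\<Prod>q\<in>Q. \<bar>1 - W m q \<omega>\<bar>) \<le> 1" using W_bounds[of m _ \<omega>] by (intro prod_le_1) (auto simp: abs_le_iff)
      then show "norm (g m \<omega>) \<le> 1" by (auto simp: g_def indicator_def abs_prod)
    qed
  qed (use f_meas g_meas g_lim in auto)
  moreover have "expectation (g m) = expectation (\<lambda>\<omega>. \<Prod>q\<in>Q. 1 - W m q \<omega>)" for m
  proof (rule integral_cong_AE[OF g_meas])
    show "AE \<omega> in \<Omega>. g m \<omega> = (\<Prod>q\<in>Q. 1 - W m q \<omega>)"
      using AE_finite AE_space by eventually_elim (simp add: g_def)
  qed measurable
  moreover have "(\<lambda>m. expectation (\<lambda>\<omega>. \<Prod>q\<in>Q. 1 - W m q \<omega>)) \<longlonglongrightarrow>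
      (\<Prod>q\<in>Q. 1 - exp (- measure \<mu> (B q)) / fact j * tuple_integral q)"
  proof -
    have W_exp: "expectation (W m q) = exp (- measure \<mu> (B q)) / fact j * (\<integral>x. tuple_level m q x \<partial>PiM {..<j} (\<lambda>_. \<mu>))"
      if "q \<in> Q" for m q
      using that by (simp add: expectation_W integral_tuple_level)
    interpret F: finite_measure "PiM {..<j} (\<lambda>_. \<mu>)" by (rule finite_measure_tuples)
    have lim: "(\<lambda>m. \<integral>x. tuple_level m q x \<partial>PiM {..<j} (\<lambda>_. \<mu>)) \<longlonglongrightarrow> tuple_integral q" if q: "q \<in> Q" for q
      unfolding tuple_integral_def
    proof (rule integral_dominated_convergence[where w = "\<lambda>_. 1"])
      show "AE x in PiM {..<j} (\<lambda>_. \<mu>). norm (tuple_level m q x) \<le> 1" for m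
        using tuple_level_bounds[of m q] by (intro AE_I2) auto
    qed (use q measurable_tuple_limit measurable_tuple_level tuple_level_lim in auto)
    show ?thesis
      unfolding expectation_prod_W
    proof (intro tendsto_prod tendsto_diff tendsto_const)
      fix q assume q: "q \<in> Q"
      show "(\<lambda>m. expectation (W m q)) \<longlonglongrightarrow> exp (- measure \<mu> (B q)) / fact j * tuple_integral q"
        unfolding W_exp[OF q] by (intro tendsto_mult tendsto_const lim q)
    qed
  qed
  ultimately show "expectation f = (\<Prod>q\<in>Q. 1 - exp (- measure \<mu> (B q)) / fact j * tuple_integral q)"
    using LIMSEQ_unique by simp
qed

end

section \<open>Integrals over configurations in relative coordinates\<close>

lemma (in pair_sigma_finite) integral_prod_mult:
  fixes f :: "'a \<Rightarrow> real" and g :: "'b \<Rightarrow> real"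
  assumes f: "integrable M1 f" and g: "integrable M2 g"
  shows "integrable (M1 \<Otimes>\<^sub>M M2) (\<lambda>z. f (fst z) * g (snd z))"
    and "(\<integral>z. f (fst z) * g (snd z) \<partial>(M1 \<Otimes>\<^sub>M M2)) = (\<integral>x. f x \<partial>M1) * (\<integral>y. g y \<partial>M2)"
proof -
  have [measurable]: "f \<in> borel_measurable M1" "g \<in> borel_measurable M2" using f g by auto
  show int: "integrable (M1 \<Otimes>\<^sub>M M2) (\<lambda>z. f (fst z) * g (snd z))"
  proof (rule Fubini_integrable)
    show "integrable M1 (\<lambda>x. \<integral>y. norm (f (fst (x, y)) * g (snd (x, y))) \<partial>M2)"
      using f g by (simp add: abs_mult)
    show "AE x in M1. integrable M2 (\<lambda>y. f (fst (x, y)) * g (snd (x, y)))"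
      using g by simp
  qed measurable
  from integral_fst'[OF this] show "(\<integral>z. f (fst z) * g (snd z) \<partial>(M1 \<Otimes>\<^sub>M M2)) = (\<integral>x. f x \<partial>M1) * (\<integral>y. g y \<partial>M2)"
    by simp
qed

abbreviation lborel_power :: "nat \<Rightarrow> (nat \<Rightarrow> 'a::euclidean_space) measure" where
  "lborel_power K \<equiv> PiM {..<K} (\<lambda>_. lborel)"

interpretation lborel_product: product_sigma_finite "\<lambda>_::nat. lborel :: 'a::euclidean_space measure"
  by unfold_locales

lemma pair_sigma_finite_lborel_power:
  "pair_sigma_finite (lborel :: 'a::euclidean_space measure) (lborel_power K :: (nat \<Rightarrow> 'a) measure)"
proof -
  interpret P: sigma_finite_measure "lborel_power K :: (nat \<Rightarrow> 'a) measure"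
    by (rule lborel_product.sigma_finite) simp
  show ?thesis by unfold_locales
qed

definition spread :: "nat \<Rightarrow> real \<Rightarrow> 'a \<times> (nat \<Rightarrow> 'a) \<Rightarrow> nat \<Rightarrow> 'a::real_vector" where
  "spread K c z = (\<lambda>i\<in>{..<Suc K}. case_nat (fst z) (\<lambda>l. fst z + c *\<^sub>R snd z l) i)"

text \<open>The joint density of \<open>K + 1\<close> points with intensity \<open>g\<close>,
  written in relative coordinates; each \<open>c ^ DIM('a)\<close> is the Jacobian of one rescaled
  displacement.\<close>

definition spread_weight :: "nat \<Rightarrow> real \<Rightarrow> ('a::euclidean_space \<Rightarrow> real) \<Rightarrow> 'a \<times> (nat \<Rightarrow> 'a) \<Rightarrow> real" where
  "spread_weight K c g z = g (fst z) * (\<Prod>l<K. c ^ DIM('a) * g (fst z + c *\<^sub>R snd z l))"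

lemma nn_integral_lborel_affine:
  fixes h :: "'a::euclidean_space \<Rightarrow> ennreal"
  assumes [measurable]: "h \<in> borel_measurable borel" and c: "0 < c"
  shows "(\<integral>\<^sup>+ z. ennreal (c ^ DIM('a)) * h (x + c *\<^sub>R z) \<partial>lborel) = (\<integral>\<^sup>+ z. h z \<partial>lborel)"
proof -
  have "(\<integral>\<^sup>+ z. h z \<partial>lborel) = (\<integral>\<^sup>+ z. h z \<partial>density (distr lborel borel (\<lambda>z. x + c *\<^sub>R z)) (\<lambda>_. ennreal (\<bar>c\<bar> ^ DIM('a))))"
    using c by (subst lborel_affine[of c x]) (auto simp: ennreal_power)
  also have "\<dots> = (\<integral>\<^sup>+ z. ennreal (c ^ DIM('a)) * h (x + c *\<^sub>R z) \<partial>lborel)"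
    using c by (simp add: nn_integral_density nn_integral_distr)
  finally show ?thesis ..
qed

lemma measurable_spread:
  assumes "\<And>i. sets (M i) = sets (borel :: 'a::euclidean_space measure)"
  shows "spread K c \<in> measurable (lborel \<Otimes>\<^sub>M lborel_power K) (PiM {..<Suc K} M)"
proof -
  have [measurable_cong]: "sets (M i) = sets borel" for i by fact
  show ?thesis
    unfolding spread_def
  proof (rule measurable_restrict)
    fix i assume "i \<in> {..<Suc K}"
    then show "(\<lambda>z. case_nat (fst z) (\<lambda>l. fst z + c *\<^sub>R snd z l) i) \<in> measurable (lborel \<Otimes>\<^sub>M lborel_power K) (M i)"
    proof (cases i)
      case (Suc l)
      then have l[measurable]: "l \<in> {..<K}" using \<open>i \<in> {..<Suc K}\<close> by auto
      have "(\<lambda>z. fst z + c *\<^sub>R snd z l) \<in> measurable (lborel \<Otimes>\<^sub>M lborel_power K) (M i)"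
        by measurable
      then show ?thesis using Suc by simp
    qed simp
  qed
qed

lemma measurable_spread_weight:
  fixes g :: "'a::euclidean_space \<Rightarrow> real"
  assumes [measurable]: "g \<in> borel_measurable borel"
  shows "spread_weight K c g \<in> borel_measurable (lborel \<Otimes>\<^sub>M lborel_power K)"
  unfolding spread_weight_def[abs_def]
proof (intro borel_measurable_times borel_measurable_prod)
  fix l assume [measurable]: "l \<in> {..<K}"
  show "(\<lambda>z. g (fst z + c *\<^sub>R snd z l)) \<in> borel_measurable (lborel \<Otimes>\<^sub>M lborel_power K)" by measurable
qed measurable

text \<open>A product measure is determined on boxes. There, with the first point fixed, the
  integrand has one factor per displacement, and the affine change of variables shows that the
  integral of each factor does not depend on the first point.\<close>

lemma PiM_density_spread:
  fixes g :: "'a::euclidean_space \<Rightarrow> real"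
  assumes g[measurable]: "g \<in> borel_measurable borel" and nn: "\<And>x. 0 \<le> g x" and int: "integrable lborel g" and c: "0 < c"
  defines "\<mu> \<equiv> density lborel (\<lambda>x. ennreal (g x))"
  shows "PiM {..<Suc K} (\<lambda>_. \<mu>) =
    distr (density (lborel \<Otimes>\<^sub>M lborel_power K) (\<lambda>z. ennreal (spread_weight K c g z))) (PiM {..<Suc K} (\<lambda>_. \<mu>)) (spread K c)"
    (is "_ = distr (density ?M _) ?N _")
proof -
  interpret pair: pair_sigma_finite "lborel :: 'a measure" "lborel_power K :: (nat \<Rightarrow> 'a) measure"
    by (rule pair_sigma_finite_lborel_power)
  have "(\<integral>\<^sup>+ x. ennreal (g x) \<partial>lborel) < \<infinity>" using int nn by (simp add: integrable_iff_bounded)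
  then interpret mu: finite_measure \<mu>
    by (intro finite_measureI) (simp add: \<mu>_def emeasure_density)
  interpret prod: product_sigma_finite "\<lambda>_::nat. \<mu>" by unfold_locales
  have sets_\<mu>[measurable_cong]: "sets \<mu> = sets borel" by (simp add: \<mu>_def)
  note spread = measurable_spread[of "\<lambda>_. \<mu>" K c, OF sets_\<mu>]
  note weight = measurable_spread_weight[OF g, of K c]
  show ?thesis
  proof (rule prod.PiM_eqI[symmetric])
    fix A assume "\<And>i. i \<in> {..<Suc K} \<Longrightarrow> A i \<in> sets \<mu>"
    then have A[measurable]: "A i \<in> sets borel" if "i < Suc K" for i using that sets_\<mu> by auto
    have A0[measurable]: "A 0 \<in> sets borel" by (rule A) simp
    have AS[measurable]: "l \<in> {..<K} \<Longrightarrow> A (Suc l) \<in> sets borel" for l by (rule A) simp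
    define F where "F l z = ennreal (c ^ DIM('a)) * (ennreal (g z) * indicator (A (Suc l)) z)" for l z
    have F[measurable]: "l \<in> {..<K} \<Longrightarrow> F l \<in> borel_measurable borel" for l
      unfolding F_def[abs_def] by measurable
    have Fm: "(\<lambda>z. F l (fst z + c *\<^sub>R snd z l)) \<in> borel_measurable ?M" if [measurable]: "l \<in> {..<K}" for l
    proof -
      have [measurable]: "F l \<in> borel_measurable borel" by (rule F) fact
      show ?thesis by measurable
    qed
    have Fm': "(\<lambda>y. F l (x + c *\<^sub>R y l)) \<in> borel_measurable (lborel_power K)" if [measurable]: "l \<in> {..<K}" for l x
    proof -
      have [measurable]: "F l \<in> borel_measurable borel" by (rule F) fact
      show ?thesis by measurable
    qed
    have Fint: "(\<integral>\<^sup>+ z. F l (x + c *\<^sub>R z) \<partial>lborel) = emeasure \<mu> (A (Suc l))" if l: "l \<in> {..<K}" for l x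
      unfolding F_def \<mu>_def using AS[OF l]
      by (subst nn_integral_lborel_affine[OF _ c]) (auto simp: emeasure_density)
    have box: "(\<Pi>\<^sub>E i\<in>{..<Suc K}. A i) \<in> sets ?N"
      by (intro sets_PiM_I_finite) (auto simp: sets_\<mu> A)
    have "emeasure (distr (density ?M (\<lambda>z. ennreal (spread_weight K c g z))) ?N (spread K c)) (\<Pi>\<^sub>E i\<in>{..<Suc K}. A i) =
        emeasure (density ?M (\<lambda>z. ennreal (spread_weight K c g z))) (spread K c -` (\<Pi>\<^sub>E i\<in>{..<Suc K}. A i) \<inter> space ?M)"
      using box spread by (subst emeasure_distr) auto
    also have "\<dots> = (\<integral>\<^sup>+ z. ennreal (spread_weight K c g z) * indicator (spread K c -` (\<Pi>\<^sub>E i\<in>{..<Suc K}. A i) \<inter> space ?M) z \<partial>?M)"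
      using weight measurable_sets[OF spread box] by (intro emeasure_density) simp_all
    also have "\<dots> = (\<integral>\<^sup>+ z. (ennreal (g (fst z)) * indicator (A 0) (fst z)) * (\<Prod>l<K. F l (fst z + c *\<^sub>R snd z l)) \<partial>?M)"
    proof (intro nn_integral_cong)
      fix z assume z: "z \<in> space ?M"
      have iff: "spread K c z \<in> (\<Pi>\<^sub>E i\<in>{..<Suc K}. A i) \<longleftrightarrow> fst z \<in> A 0 \<and> (\<forall>l<K. fst z + c *\<^sub>R snd z l \<in> A (Suc l))"
      proof -
        have "spread K c z \<in> (\<Pi>\<^sub>E i\<in>{..<Suc K}. A i) \<longleftrightarrow> (\<forall>i<Suc K. case_nat (fst z) (\<lambda>l. fst z + c *\<^sub>R snd z l) i \<in> A i)"
          by (auto simp: spread_def PiE_iff)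
        then show ?thesis by (simp add: All_less_Suc2)
      qed
      show "ennreal (spread_weight K c g z) * indicator (spread K c -` (\<Pi>\<^sub>E i\<in>{..<Suc K}. A i) \<inter> space ?M) z =
        (ennreal (g (fst z)) * indicator (A 0) (fst z)) * (\<Prod>l<K. F l (fst z + c *\<^sub>R snd z l))"
      proof (cases "fst z \<in> A 0 \<and> (\<forall>l<K. fst z + c *\<^sub>R snd z l \<in> A (Suc l))")
        case True
        have "(\<Prod>l<K. F l (fst z + c *\<^sub>R snd z l)) = (\<Prod>l<K. ennreal (c ^ DIM('a) * g (fst z + c *\<^sub>R snd z l)))"
          using True c nn by (intro prod.cong) (auto simp: F_def ennreal_mult)
        also have "\<dots> = ennreal (\<Prod>l<K. c ^ DIM('a) * g (fst z + c *\<^sub>R snd z l))"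
          using c nn by (intro prod_ennreal) auto
        finally show ?thesis using True iff z nn c
          by (simp add: spread_weight_def ennreal_mult prod_nonneg)
      next
        case False
        have "indicator (A 0) (fst z) * (\<Prod>l<K. F l (fst z + c *\<^sub>R snd z l)) = 0"
        proof (cases "fst z \<in> A 0")
          case True
          then obtain l where "l < K" "fst z + c *\<^sub>R snd z l \<notin> A (Suc l)" using False by auto
          then have "(\<Prod>l<K. F l (fst z + c *\<^sub>R snd z l)) = 0"
            by (intro prod_zero) (auto intro!: bexI[of _ l] simp: F_def)
          then show ?thesis by simp
        qed simp
        then show ?thesis using False iff by (auto simp: indicator_def mult.assoc)
      qed
    qed
    also have "\<dots> = (\<integral>\<^sup>+ x. \<integral>\<^sup>+ y. (ennreal (g x) * indicator (A 0) x) * (\<Prod>l<K. F l (x + c *\<^sub>R y l)) \<partial>lborel_power K \<partial>lborel)"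
    proof (subst pair.M2.nn_integral_fst[symmetric])
      show "(\<lambda>z. (ennreal (g (fst z)) * indicator (A 0) (fst z)) * (\<Prod>l<K. F l (fst z + c *\<^sub>R snd z l))) \<in> borel_measurable ?M"
        by (intro borel_measurable_times_ennreal borel_measurable_prod_ennreal Fm) measurable
    qed simp
    also have "\<dots> = (\<integral>\<^sup>+ x. (ennreal (g x) * indicator (A 0) x) * (\<Prod>l<K. emeasure \<mu> (A (Suc l))) \<partial>lborel)"
    proof (intro nn_integral_cong)
      fix x
      have meas: "(\<lambda>z. F l (x + c *\<^sub>R z)) \<in> borel_measurable lborel" if "l \<in> {..<K}" for l
        using F[OF that] by measurable
      have "(\<integral>\<^sup>+ y. (\<Prod>l<K. F l (x + c *\<^sub>R y l)) \<partial>lborel_power K) = (\<Prod>l<K. \<integral>\<^sup>+ z. F l (x + c *\<^sub>R z) \<partial>lborel)"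
        by (rule lborel_product.product_nn_integral_prod[where f = "\<lambda>l z. F l (x + c *\<^sub>R z)"]) (auto intro: meas)
      also have "\<dots> = (\<Prod>l<K. emeasure \<mu> (A (Suc l)))"
        by (intro prod.cong Fint) auto
      finally have eq: "(\<integral>\<^sup>+ y. (\<Prod>l<K. F l (x + c *\<^sub>R y l)) \<partial>lborel_power K) = (\<Prod>l<K. emeasure \<mu> (A (Suc l)))" .
      have "(\<lambda>y. \<Prod>l<K. F l (x + c *\<^sub>R y l)) \<in> borel_measurable (lborel_power K)"
        by (intro borel_measurable_prod_ennreal Fm')
      then show "(\<integral>\<^sup>+ y. (ennreal (g x) * indicator (A 0) x) * (\<Prod>l<K. F l (x + c *\<^sub>R y l)) \<partial>lborel_power K) =
        (ennreal (g x) * indicator (A 0) x) * (\<Prod>l<K. emeasure \<mu> (A (Suc l)))"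
        by (simp add: nn_integral_cmult eq)
    qed
    also have "\<dots> = emeasure \<mu> (A 0) * (\<Prod>l<K. emeasure \<mu> (A (Suc l)))"
      by (subst nn_integral_multc) (auto simp: \<mu>_def emeasure_density)
    also have "\<dots> = (\<Prod>i<Suc K. emeasure \<mu> (A i))"
      by (simp only: prod.lessThan_Suc_shift)
    finally show "emeasure (distr (density ?M (\<lambda>z. ennreal (spread_weight K c g z))) ?N (spread K c)) (\<Pi>\<^sub>E i\<in>{..<Suc K}. A i) =
      (\<Prod>i\<in>{..<Suc K}. emeasure \<mu> (A i))" .
  qed simp_all
qed

lemma integral_PiM_density_spread:
  fixes g :: "'a::euclidean_space \<Rightarrow> real" and F :: "(nat \<Rightarrow> 'a) \<Rightarrow> real"
  assumes g: "g \<in> borel_measurable borel" and nn: "\<And>x. 0 \<le> g x" and int: "integrable lborel g" and c: "0 < c"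
    and F: "F \<in> borel_measurable (PiM {..<Suc K} (\<lambda>_. density lborel (\<lambda>x. ennreal (g x))))"
  shows "(\<integral>x. F x \<partial>PiM {..<Suc K} (\<lambda>_. density lborel (\<lambda>x. ennreal (g x)))) =
    (\<integral>z. spread_weight K c g z * F (spread K c z) \<partial>(lborel \<Otimes>\<^sub>M lborel_power K))"
proof -
  let ?N = "PiM {..<Suc K} (\<lambda>_. density lborel (\<lambda>x. ennreal (g x)))"
  let ?M = "lborel \<Otimes>\<^sub>M lborel_power K :: ('a \<times> (nat \<Rightarrow> 'a)) measure"
  have spread: "spread K c \<in> measurable ?M ?N"
    by (rule measurable_spread) simp
  have "(\<integral>x. F x \<partial>?N) = (\<integral>x. F x \<partial>distr (density ?M (\<lambda>z. ennreal (spread_weight K c g z))) ?N (spread K c))"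
    using PiM_density_spread[OF g nn int c, of K] by simp
  also have "\<dots> = (\<integral>z. F (spread K c z) \<partial>density ?M (\<lambda>z. ennreal (spread_weight K c g z)))"
    using F spread by (intro integral_distr) auto
  also have "\<dots> = (\<integral>z. spread_weight K c g z *\<^sub>R F (spread K c z) \<partial>?M)"
  proof (intro integral_density AE_I2)
    show "0 \<le> spread_weight K c g z" for z
      using c nn unfolding spread_weight_def by (intro mult_nonneg_nonneg prod_nonneg) auto
  qed (use measurable_compose[OF spread F] measurable_spread_weight[OF g] in auto)
  finally show ?thesis by simp
qed

section \<open>Laplace functional of a Poisson random measure\<close>

lemma (in poisson_rm) laplace_sum:
  assumes I: "finite I" and A: "\<And>i. i \<in> I \<Longrightarrow> A i \<in> sets \<mu>" "\<And>i. i \<in> I \<Longrightarrow> emeasure \<mu> (A i) < \<infinity>"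
    and disj: "disjoint_family_on A I" and b: "\<And>i. i \<in> I \<Longrightarrow> 0 \<le> b i"
  shows "expectation (\<lambda>\<omega>. exp (- (\<Sum>i\<in>I. b i * enn2real (emeasure (N \<omega>) (A i))))) =
    exp (- (\<Sum>i\<in>I. measure \<mu> (A i) * (1 - exp (- b i))))"
proof -
  have ind: "indep_vars (\<lambda>_. borel) (\<lambda>i \<omega>. exp (- (b i * enn2real (emeasure (N \<omega>) (A i))))) I"
    by (rule indep_vars_compose2[OF indep_N[OF I A(1) disj]]) simp_all
  have "expectation (\<lambda>\<omega>. exp (- (\<Sum>i\<in>I. b i * enn2real (emeasure (N \<omega>) (A i))))) =
      expectation (\<lambda>\<omega>. \<Prod>i\<in>I. exp (- (b i * enn2real (emeasure (N \<omega>) (A i)))))"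
    using I by (simp add: exp_sum flip: sum_negf)
  also have "\<dots> = (\<Prod>i\<in>I. expectation (\<lambda>\<omega>. exp (- (b i * enn2real (emeasure (N \<omega>) (A i))))))"
  proof (rule indep_vars_lebesgue_integral[OF I ind])
    fix i assume i: "i \<in> I"
    show "integrable \<Omega> (\<lambda>\<omega>. exp (- (b i * enn2real (emeasure (N \<omega>) (A i)))))"
    proof (rule integrable_const_bound[where B = 1])
      show "AE \<omega> in \<Omega>. norm (exp (- (b i * enn2real (emeasure (N \<omega>) (A i))))) \<le> 1"
        using b[OF i] by (intro AE_I2) simp
    qed (use A(1)[OF i] in measurable)
  qed
  also have "\<dots> = (\<Prod>i\<in>I. exp (- (measure \<mu> (A i) * (1 - exp (- b i)))))"
    using A by (intro prod.cong laplace_N) auto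
  also have "\<dots> = exp (- (\<Sum>i\<in>I. measure \<mu> (A i) * (1 - exp (- b i))))"
    using I by (simp add: exp_sum flip: sum_negf)
  finally show ?thesis .
qed

text \<open>The sets \<open>A i\<close> may overlap. They are cut into the atoms \<open>D T\<close>
  of points lying in exactly those \<open>A i\<close> with \<open>i \<in> T\<close>; counts of atoms
  are independent, and an atom carries the total weight \<open>sum a T\<close>.\<close>

lemma (in poisson_rm) laplace_functional:
  assumes I: "finite I" and A: "\<And>i. i \<in> I \<Longrightarrow> A i \<in> sets \<mu>" "\<And>i. i \<in> I \<Longrightarrow> emeasure \<mu> (A i) < \<infinity>"
    and a: "\<And>i. i \<in> I \<Longrightarrow> 0 \<le> a i"
  shows "expectation (\<lambda>\<omega>. exp (- (\<Sum>i\<in>I. a i * measure (N \<omega>) (A i)))) =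
    exp (- (\<integral>y. 1 - exp (- (\<Sum>i\<in>I. a i * indicator (A i) y)) \<partial>\<mu>))"
proof -
  define D where "D T = {y \<in> \<Union>(A ` I). {i \<in> I. y \<in> A i} = T}" for T
  \<comment> \<open>With nonempty index sets every atom lies inside some \<open>A i\<close> and has
    finite mass.\<close>
  define J where "J = Pow I - {{}}"
  define b where "b T = sum a T" for T
  have J: "finite J" using I by (simp add: J_def)
  have D_eq: "D T = (\<Inter>i\<in>T. A i) - (\<Union>i\<in>I - T. A i)" if "T \<in> J" for T
    using that by (auto simp: D_def J_def)
  have D_sets: "D T \<in> sets \<mu>" if T: "T \<in> J" for T
  proof -
    have "finite T" "T \<noteq> {}" "T \<subseteq> I" using T I by (auto simp: J_def intro: finite_subset)
    then show ?thesis unfolding D_eq[OF T] using A(1) I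
      by (intro sets.Diff sets.finite_INT sets.finite_UN) auto
  qed
  have D_sub: "D T \<subseteq> A i" if "i \<in> T" "T \<in> J" for i T using that by (auto simp: D_def J_def)
  have D_fin: "emeasure \<mu> (D T) < \<infinity>" if T: "T \<in> J" for T
  proof -
    obtain i where i: "i \<in> T" "i \<in> I" using T by (auto simp: J_def)
    have "emeasure \<mu> (D T) \<le> emeasure \<mu> (A i)" by (rule emeasure_mono[OF D_sub[OF i(1) T] A(1)[OF i(2)]])
    then show ?thesis using A(2)[OF i(2)] by (rule order_le_less_trans)
  qed
  have D_disj: "disjoint_family_on D J" by (auto simp: disjoint_family_on_def D_def)
  have A_eq: "A i = (\<Union>T\<in>{T \<in> J. i \<in> T}. D T)" if "i \<in> I" for i
    using that by (auto simp: D_def J_def)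
  have b: "0 \<le> b T" if "T \<in> J" for T using that a by (auto simp: b_def J_def intro!: sum_nonneg)
  have swap: "(\<Sum>i\<in>I. a i * (\<Sum>T\<in>{T \<in> J. i \<in> T}. v T)) = (\<Sum>T\<in>J. b T * v T)" for v :: "_ set \<Rightarrow> real"
  proof -
    have "(\<Sum>i\<in>I. a i * (\<Sum>T\<in>{T \<in> J. i \<in> T}. v T)) = (\<Sum>i\<in>I. \<Sum>T\<in>{T \<in> J. i \<in> T}. a i * v T)"
      by (simp add: sum_distrib_left)
    also have "\<dots> = (\<Sum>T\<in>J. \<Sum>i\<in>{i \<in> I. i \<in> T}. a i * v T)"
      by (rule sum.swap_restrict[OF I J])
    also have "\<dots> = (\<Sum>T\<in>J. b T * v T)"
    proof (intro sum.cong refl)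
      fix T assume "T \<in> J"
      then have "{i \<in> I. i \<in> T} = T" by (auto simp: J_def)
      then show "(\<Sum>i\<in>{i \<in> I. i \<in> T}. a i * v T) = b T * v T" by (simp add: b_def sum_distrib_right)
    qed
    finally show ?thesis .
  qed
  have ind: "indicator (A i) y = (\<Sum>T\<in>{T \<in> J. i \<in> T}. indicator (D T) y :: real)" if "i \<in> I" for i y
    unfolding A_eq[OF that] using D_disj J
    by (intro indicator_UN_disjoint) (auto simp: disjoint_family_on_def)
  \<comment> \<open>Counts of atoms are almost surely finite, so that the real-valued measures of
    the atoms add up to the measure of \<open>A i\<close>.\<close>
  have "AE \<omega> in \<Omega>. \<forall>T\<in>J. emeasure (N \<omega>) (D T) \<in> range of_nat"
    using J by (intro AE_finite_allI AE_N_nat D_sets D_fin)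
  then have AE: "AE \<omega> in \<Omega>. exp (- (\<Sum>i\<in>I. a i * measure (N \<omega>) (A i))) =
      exp (- (\<Sum>T\<in>J. b T * enn2real (emeasure (N \<omega>) (D T))))"
    using AE_space
  proof eventually_elim
    case (elim \<omega>)
    have "measure (N \<omega>) (A i) = (\<Sum>T\<in>{T \<in> J. i \<in> T}. enn2real (emeasure (N \<omega>) (D T)))" if i: "i \<in> I" for i
    proof -
      have "measure (N \<omega>) (\<Union>T\<in>{T \<in> J. i \<in> T}. D T) = (\<Sum>T\<in>{T \<in> J. i \<in> T}. measure (N \<omega>) (D T))"
      proof (rule measure_finite_Union)
        show "D ` {T \<in> J. i \<in> T} \<subseteq> sets (N \<omega>)" using D_sets sets_N[OF elim(2)] by auto
        show "disjoint_family_on D {T \<in> J. i \<in> T}" using D_disj by (auto simp: disjoint_family_on_def)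
        show "emeasure (N \<omega>) (D T) \<noteq> \<infinity>" if "T \<in> {T \<in> J. i \<in> T}" for T
          using elim(1) that by auto
      qed (use J in auto)
      then show ?thesis using A_eq[OF i] by (simp add: measure_def)
    qed
    then have "(\<Sum>i\<in>I. a i * measure (N \<omega>) (A i)) = (\<Sum>i\<in>I. a i * (\<Sum>T\<in>{T \<in> J. i \<in> T}. enn2real (emeasure (N \<omega>) (D T))))"
      by (intro sum.cong) auto
    then show ?case unfolding swap by simp
  qed
  have "expectation (\<lambda>\<omega>. exp (- (\<Sum>i\<in>I. a i * measure (N \<omega>) (A i)))) =
      expectation (\<lambda>\<omega>. exp (- (\<Sum>T\<in>J. b T * enn2real (emeasure (N \<omega>) (D T)))))"
  proof (rule integral_cong_AE[OF _ _ AE])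
    show "(\<lambda>\<omega>. exp (- (\<Sum>i\<in>I. a i * measure (N \<omega>) (A i)))) \<in> borel_measurable \<Omega>"
      unfolding measure_def using A(1) by measurable
    show "(\<lambda>\<omega>. exp (- (\<Sum>T\<in>J. b T * enn2real (emeasure (N \<omega>) (D T))))) \<in> borel_measurable \<Omega>"
      using D_sets by measurable
  qed
  also have "\<dots> = exp (- (\<Sum>T\<in>J. measure \<mu> (D T) * (1 - exp (- b T))))"
    by (rule laplace_sum[OF J D_sets D_fin D_disj b])
  also have "(\<Sum>T\<in>J. measure \<mu> (D T) * (1 - exp (- b T))) = (\<integral>y. (\<Sum>T\<in>J. (1 - exp (- b T)) * indicator (D T) y) \<partial>\<mu>)"
  proof (subst Bochner_Integration.integral_sum)
    show "integrable \<mu> (\<lambda>y. (1 - exp (- b T)) * indicator (D T) y)" if "T \<in> J" for T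
      using D_sets[OF that] D_fin[OF that] by (intro integrable_mult_right integrable_real_indicator) auto
    have "D T \<inter> space \<mu> = D T" if "T \<in> J" for T using sets.sets_into_space[OF D_sets[OF that]] by auto
    then show "(\<Sum>T\<in>J. measure \<mu> (D T) * (1 - exp (- b T))) = (\<Sum>T\<in>J. \<integral>y. (1 - exp (- b T)) * indicator (D T) y \<partial>\<mu>)"
      by (intro sum.cong) simp_all
  qed
  also have "\<dots> = (\<integral>y. 1 - exp (- (\<Sum>i\<in>I. a i * indicator (A i) y)) \<partial>\<mu>)"
  proof (intro Bochner_Integration.integral_cong refl)
    fix y
    have "(\<Sum>i\<in>I. a i * indicator (A i) y) = (\<Sum>i\<in>I. a i * (\<Sum>T\<in>{T \<in> J. i \<in> T}. indicator (D T) y))"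
      by (intro sum.cong refl arg_cong2[where f = "(*)"] ind)
    also have "\<dots> = (\<Sum>T\<in>J. b T * indicator (D T) y)" by (rule swap)
    finally have eq: "(\<Sum>i\<in>I. a i * indicator (A i) y) = (\<Sum>T\<in>J. b T * indicator (D T) y)" .
    let ?T = "{i \<in> I. y \<in> A i}"
    have D_y: "y \<in> D T \<longleftrightarrow> T = ?T" if "T \<in> J" for T using that by (auto simp: D_def J_def)
    have sum: "(\<Sum>T\<in>J. h T * indicator (D T) y) = (if ?T \<in> J then h ?T else 0)" for h :: "_ \<Rightarrow> real"
    proof -
      have "(\<Sum>T\<in>J. h T * indicator (D T) y) = (\<Sum>T\<in>J. if T = ?T then h T else 0)"
        by (intro sum.cong refl) (use D_y in \<open>auto simp: indicator_def\<close>)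
      then show ?thesis using J by (simp add: sum.delta)
    qed
    show "(\<Sum>T\<in>J. (1 - exp (- b T)) * indicator (D T) y) = 1 - exp (- (\<Sum>i\<in>I. a i * indicator (A i) y))"
      unfolding eq sum by simp
  qed
  finally show ?thesis .
qed

section \<open>Weak convergence of lattice-valued random vectors\<close>

text \<open>At \<open>z = exp_vec x\<close> its expectation is the Laplace transform with natural
  exponents \<open>a\<close>.\<close>

definition laplace_monomial :: "('m \<Rightarrow> nat) \<Rightarrow> real^'m::finite \<Rightarrow> real" where
  "laplace_monomial a z = (\<Prod>i\<in>UNIV. (z $ i) ^ a i)"

inductive_set monomial_span :: "(real^'m::finite \<Rightarrow> real) set" where
  monomial: "(\<lambda>z. c * laplace_monomial a z) \<in> monomial_span"
| add: "p \<in> monomial_span \<Longrightarrow> q \<in> monomial_span \<Longrightarrow> (\<lambda>z. p z + q z) \<in> monomial_span"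

lemma laplace_monomial_mult: "laplace_monomial a z * laplace_monomial b z = laplace_monomial (\<lambda>i. a i + b i) z"
  by (simp add: laplace_monomial_def prod.distrib power_add)

lemma continuous_laplace_monomial: "continuous_on S (laplace_monomial a)"
  unfolding laplace_monomial_def[abs_def] by (intro continuous_intros)

lemma continuous_monomial_span: "p \<in> monomial_span \<Longrightarrow> continuous_on S p"
  by (induction rule: monomial_span.induct) (auto intro!: continuous_intros continuous_laplace_monomial)

lemma monomial_span_mult:
  assumes "p \<in> monomial_span" "q \<in> monomial_span"
  shows "(\<lambda>z. p z * q z) \<in> monomial_span"
  using assms(1)
proof (induction rule: monomial_span.induct)
  case (monomial c a)
  show ?case using assms(2)
  proof (induction rule: monomial_span.induct)
    case (monomial d b)
    have "(\<lambda>z. (c * laplace_monomial a z) * (d * laplace_monomial b z)) = (\<lambda>z. (c * d) * laplace_monomial (\<lambda>i. a i + b i) z)"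
      by (simp add: fun_eq_iff laplace_monomial_mult[symmetric])
    then show ?case using monomial_span.monomial by metis
  next
    case (add p q)
    from monomial_span.add[OF add.IH] show ?case by (simp add: distrib_left)
  qed
next
  case (add p p')
  from monomial_span.add[OF add.IH] show ?case by (simp add: distrib_right)
qed

lemma function_ring_monomial_span: "function_ring_on monomial_span (cbox 0 (1 :: real^'m::finite))"
proof
  show "(\<lambda>_. c) \<in> monomial_span" for c
    using monomial_span.monomial[of c "\<lambda>_. 0"] by (simp add: laplace_monomial_def)
  show "\<exists>f\<in>monomial_span. f x \<noteq> f y" if xy: "x \<noteq> y" for x y :: "real^'m"
  proof -
    obtain i where i: "x $ i \<noteq> y $ i" using xy by (metis vec_eq_iff)
    have "laplace_monomial (\<lambda>j. of_bool (j = i)) z = z $ i" for z :: "real^'m"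
    proof -
      have "laplace_monomial (\<lambda>j. of_bool (j = i)) z = (\<Prod>j\<in>UNIV. if j = i then z $ j else 1)"
        unfolding laplace_monomial_def by (intro prod.cong) auto
      then show ?thesis by simp
    qed
    then show ?thesis using i monomial_span.monomial[of 1 "\<lambda>j. of_bool (j = i)"]
      by (intro bexI[of _ "\<lambda>z. 1 * laplace_monomial (\<lambda>j. of_bool (j = i)) z"]) simp_all
  qed
qed (auto intro: continuous_monomial_span monomial_span.add monomial_span_mult)

definition exp_vec :: "real^'m \<Rightarrow> real^'m::finite" where
  "exp_vec x = (\<chi> i. exp (- (x $ i)))"

definition nat_vec :: "('m \<Rightarrow> nat) \<Rightarrow> real^'m::finite" where
  "nat_vec v = (\<chi> i. real (v i))"

text \<open>A continuous tent that equals 1 at the image of the lattice point \<open>v\<close> and 0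
  at the images of all others. Its half-width is the gap to the next smaller value, the narrower of
  the two neighbouring gaps.\<close>

definition lattice_bump :: "('m \<Rightarrow> nat) \<Rightarrow> real^'m::finite \<Rightarrow> real" where
  "lattice_bump v z = (\<Prod>i\<in>UNIV. max 0 (1 - \<bar>z $ i - exp (- real (v i))\<bar> / (exp (- real (v i)) - exp (- real (Suc (v i))))))"

text \<open>Values with \<open>k > j\<close> lie below \<open>exp (- (j + 1))\<close>. Those with
  \<open>k < j\<close> are at least \<open>2 * exp (- j)\<close> because
  \<open>exp 1 \<ge> 2\<close>, and so they are even further away.\<close>

lemma exp_gap:
  fixes j k :: nat assumes "j \<noteq> k"
  shows "exp (- real j) - exp (- real (Suc j)) \<le> \<bar>exp (- real k) - exp (- real j)\<bar>"
proof (cases "j < k")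
  case True
  then have "exp (- real k) \<le> exp (- real (Suc j))" by simp
  then show ?thesis by linarith
next
  case False
  then have jk: "Suc k \<le> j" using assms by simp
  have e: "exp (- real (Suc j)) = exp (- real j) * exp (- 1)" by (simp flip: exp_add)
  have "exp (- real j) \<le> exp (- real (Suc k))" using jk by simp
  also have "\<dots> = exp (- real k) * exp (- 1)" by (simp flip: exp_add)
  finally have 1: "exp (- real j) * exp 1 \<le> exp (- real k)" by (simp add: exp_minus field_simps)
  have "(2::real) \<le> exp 1" using exp_ge_add_one_self[of 1] by simp
  then have "exp (- real j) * 2 \<le> exp (- real j) * exp 1" by (intro mult_left_mono) auto
  then have "2 * exp (- real j) \<le> exp (- real k)" using 1 by linarith
  moreover have "0 \<le> exp (- real (Suc j))" by simp
  ultimately show ?thesis by linarith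
qed

lemma lattice_bump_nat_vec: "lattice_bump v (exp_vec (nat_vec w)) = of_bool (w = v)"
proof (cases "w = v")
  case False
  then obtain i where i: "v i \<noteq> w i" by (metis ext)
  let ?g = "exp (- real (v i)) - exp (- real (Suc (v i)))"
  have "0 < ?g" by simp
  then have "1 - \<bar>exp (- real (w i)) - exp (- real (v i))\<bar> / ?g \<le> 0"
    using exp_gap[OF i] by (simp add: field_simps)
  then have "max 0 (1 - \<bar>exp_vec (nat_vec w) $ i - exp (- real (v i))\<bar> / ?g) = 0"
    by (simp only: exp_vec_def nat_vec_def vec_lambda_beta max_absorb1)
  then have "lattice_bump v (exp_vec (nat_vec w)) = 0"
    unfolding lattice_bump_def by (intro prod_zero bexI[OF _ UNIV_I]) simp_all
  then show ?thesis using False by simp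
qed (simp add: lattice_bump_def exp_vec_def nat_vec_def)

lemma continuous_lattice_bump: "continuous_on S (lattice_bump v)"
proof -
  have "exp (- real (v i)) - exp (- real (Suc (v i))) \<noteq> 0" for i by simp
  then show ?thesis unfolding lattice_bump_def[abs_def] by (intro continuous_intros) auto
qed

lemma measurable_exp_vec[measurable]: "exp_vec \<in> borel_measurable borel"
  unfolding exp_vec_def[abs_def] by (intro borel_measurable_continuous_onI continuous_intros)

lemma laplace_monomial_exp_vec: "laplace_monomial a (exp_vec x) = exp (- (\<Sum>i\<in>UNIV. real (a i) * x $ i))"
proof -
  have "laplace_monomial a (exp_vec x) = (\<Prod>i\<in>UNIV. exp (- (real (a i) * x $ i)))"
    unfolding laplace_monomial_def exp_vec_def by (intro prod.cong) (simp_all flip: exp_of_nat_mult)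
  then show ?thesis by (simp add: exp_sum flip: sum_negf)
qed

section \<open>Laws on the nonnegative integer lattice\<close>

locale lattice_vector = prob_space M for M :: "'w measure" +
  fixes X :: "'w \<Rightarrow> real^'m::finite"
  assumes X[measurable]: "X \<in> borel_measurable M" and X_nat: "AE \<omega> in M. X \<omega> \<in> range nat_vec"
begin

lemma AE_exp_vec: "AE \<omega> in M. exp_vec (X \<omega>) \<in> cbox 0 1"
  using X_nat by eventually_elim (auto simp: mem_box_cart exp_vec_def nat_vec_def)

lemma integrable_exp_vec:
  assumes q: "continuous_on UNIV q"
  shows "integrable M (\<lambda>\<omega>. q (exp_vec (X \<omega>)) :: real)"
proof -
  have "compact (q ` cbox 0 1)"
    by (intro compact_continuous_image continuous_on_subset[OF q]) auto
  then obtain B where B: "\<And>z. z \<in> cbox 0 1 \<Longrightarrow> norm (q z) \<le> B"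
    by (meson bounded_iff compact_imp_bounded imageI)
  have [measurable]: "q \<in> borel_measurable borel" using q by (rule borel_measurable_continuous_onI)
  show ?thesis
    by (rule integrable_const_bound[of _ B]) (use AE_exp_vec B in \<open>auto elim!: eventually_mono\<close>)
qed

lemma expectation_approx:
  fixes p q :: "real^'m \<Rightarrow> real"
  assumes "continuous_on UNIV p" "continuous_on UNIV q" "\<And>z. z \<in> cbox 0 1 \<Longrightarrow> \<bar>p z - q z\<bar> \<le> e"
  shows "\<bar>expectation (\<lambda>\<omega>. p (exp_vec (X \<omega>))) - expectation (\<lambda>\<omega>. q (exp_vec (X \<omega>)))\<bar> \<le> e"
proof -
  note int = integrable_exp_vec[OF assms(1)] integrable_exp_vec[OF assms(2)]
  have "\<bar>expectation (\<lambda>\<omega>. p (exp_vec (X \<omega>)) - q (exp_vec (X \<omega>)))\<bar> \<le> expectation (\<lambda>\<omega>. \<bar>p (exp_vec (X \<omega>)) - q (exp_vec (X \<omega>))\<bar>)"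
    by (rule integral_abs_bound)
  also have "\<dots> \<le> expectation (\<lambda>\<omega>. e)"
    using int AE_exp_vec assms(3) by (intro integral_mono_AE) (auto elim!: eventually_mono)
  finally show ?thesis using int by (simp add: prob_space)
qed

lemma expectation_bump: "expectation (\<lambda>\<omega>. lattice_bump v (exp_vec (X \<omega>))) = prob {\<omega> \<in> space M. X \<omega> = nat_vec v}"
proof -
  have inj: "nat_vec w = nat_vec v \<longleftrightarrow> w = v" for w v :: "'m \<Rightarrow> nat"
    by (auto simp: nat_vec_def vec_eq_iff fun_eq_iff)
  have "expectation (\<lambda>\<omega>. lattice_bump v (exp_vec (X \<omega>))) = expectation (indicator {\<omega> \<in> space M. X \<omega> = nat_vec v})"
  proof (rule integral_cong_AE)
    show "AE \<omega> in M. lattice_bump v (exp_vec (X \<omega>)) = indicator {\<omega> \<in> space M. X \<omega> = nat_vec v} \<omega>"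
      using X_nat AE_space by eventually_elim (auto simp: lattice_bump_nat_vec inj indicator_def)
    show "(\<lambda>\<omega>. lattice_bump v (exp_vec (X \<omega>))) \<in> borel_measurable M"
      using integrable_exp_vec[OF continuous_lattice_bump] by auto
  qed measurable
  then show ?thesis by (simp add: Collect_conj_eq Int_assoc[symmetric])
qed

lemma expectation_finite_approx:
  assumes g[measurable]: "g \<in> borel_measurable borel" and B: "\<And>x. \<bar>g x\<bar> \<le> B" and F: "finite F"
  shows "\<bar>expectation (\<lambda>\<omega>. g (X \<omega>)) - (\<Sum>v\<in>F. g (nat_vec v) * prob {\<omega> \<in> space M. X \<omega> = nat_vec v})\<bar>
    \<le> B * (1 - (\<Sum>v\<in>F. prob {\<omega> \<in> space M. X \<omega> = nat_vec v}))"
proof -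
  let ?E = "\<lambda>v. {\<omega> \<in> space M. X \<omega> = nat_vec v}"
  have inj: "nat_vec w = nat_vec v \<longleftrightarrow> w = v" for w v :: "'m \<Rightarrow> nat"
    by (auto simp: nat_vec_def vec_eq_iff fun_eq_iff)
  have [measurable]: "?E v \<in> events" for v by measurable
  \<comment> \<open>On the sample space this is the indicator that \<open>X\<close> misses the
    lattice points of \<open>F\<close>, so it carries exactly the mass left out of the finite
    sum.\<close>
  define R where "R \<omega> = (1 - (\<Sum>v\<in>F. indicator (?E v) \<omega>) :: real)" for \<omega>
  have R01: "0 \<le> R \<omega>" and gR: "g (X \<omega>) - (\<Sum>v\<in>F. g (nat_vec v) * indicator (?E v) \<omega>) = g (X \<omega>) * R \<omega>" for \<omega>
  proof -
    have "(\<Sum>v\<in>F. h v * indicator (?E v) \<omega>) = (if \<omega> \<in> space M \<and> X \<omega> \<in> nat_vec ` F then h (the_inv nat_vec (X \<omega>)) else 0)" for h :: "_ \<Rightarrow> real"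
    proof (cases "\<omega> \<in> space M \<and> X \<omega> \<in> nat_vec ` F")
      case True
      then obtain v where v: "v \<in> F" "X \<omega> = nat_vec v" by auto
      have "(\<Sum>w\<in>F. h w * indicator (?E w) \<omega>) = (\<Sum>w\<in>F. if w = v then h w else 0)"
        using True v by (intro sum.cong) (auto simp: inj indicator_def)
      moreover have "the_inv nat_vec (X \<omega>) = v" using v inj by (simp add: the_inv_f_f inj_on_def)
      ultimately show ?thesis using True v F by simp
    next
      case False
      then show ?thesis by (auto intro!: sum.neutral simp: indicator_def)
    qed
    note s = this
    show "0 \<le> R \<omega>" using s[of "\<lambda>_. 1"] by (simp add: R_def)
    show "g (X \<omega>) - (\<Sum>v\<in>F. g (nat_vec v) * indicator (?E v) \<omega>) = g (X \<omega>) * R \<omega>"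
      using s[of "\<lambda>_. 1"] s[of "\<lambda>v. g (nat_vec v)"] inj by (auto simp: R_def the_inv_f_f inj_on_def)
  qed
  have int_g: "integrable M (\<lambda>\<omega>. g (X \<omega>))"
    using B by (intro integrable_const_bound[of _ B]) auto
  have int_E: "integrable M (indicator (?E v) :: _ \<Rightarrow> real)" for v
    by (rule integrable_const_bound[of _ 1]) (auto simp: indicator_def)
  have int_sum: "integrable M (\<lambda>\<omega>. \<Sum>v\<in>F. h v * indicator (?E v) \<omega>)" for h :: "_ \<Rightarrow> real"
    by (intro Bochner_Integration.integrable_sum integrable_mult_right int_E)
  have E_sum: "expectation (\<lambda>\<omega>. \<Sum>v\<in>F. h v * indicator (?E v) \<omega>) = (\<Sum>v\<in>F. h v * prob (?E v))" for h :: "_ \<Rightarrow> real"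
  proof -
    have "?E v \<inter> space M = ?E v" for v by auto
    then show ?thesis
      by (subst Bochner_Integration.integral_sum) (simp_all add: int_E)
  qed
  have int_R: "integrable M R" unfolding R_def[abs_def] using int_sum[of "\<lambda>_. 1"] by simp
  have E_R: "expectation R = 1 - (\<Sum>v\<in>F. prob (?E v))"
    unfolding R_def[abs_def] using int_sum[of "\<lambda>_. 1"] E_sum[of "\<lambda>_. 1"] by (simp add: prob_space)
  have int_gR: "integrable M (\<lambda>\<omega>. g (X \<omega>) * R \<omega>)"
    unfolding gR[symmetric] by (intro Bochner_Integration.integrable_diff int_sum int_g)
  have "expectation (\<lambda>\<omega>. g (X \<omega>)) - (\<Sum>v\<in>F. g (nat_vec v) * prob (?E v)) = expectation (\<lambda>\<omega>. g (X \<omega>) * R \<omega>)"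
    unfolding gR[symmetric] using int_g int_sum E_sum by simp
  moreover have "\<bar>expectation (\<lambda>\<omega>. g (X \<omega>) * R \<omega>)\<bar> \<le> expectation (\<lambda>\<omega>. B * R \<omega>)"
  proof (rule order_trans[OF integral_abs_bound], rule integral_mono)
    show "\<bar>g (X \<omega>) * R \<omega>\<bar> \<le> B * R \<omega>" for \<omega>
      using B[of "X \<omega>"] R01[of \<omega>] by (simp add: abs_mult mult_right_mono)
  qed (use int_gR int_R in auto)
  ultimately show ?thesis using E_R by simp
qed

text \<open>Tightness of a single lattice law, by exhausting the lattice with growing cubes.\<close>

lemma finite_mass:
  assumes "0 < e"
  obtains F where "finite F" "1 - e < (\<Sum>v\<in>F. prob {\<omega> \<in> space M. X \<omega> = nat_vec v})"
proof -
  let ?E = "\<lambda>v. {\<omega> \<in> space M. X \<omega> = nat_vec v}"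
  have inj: "nat_vec w = nat_vec v \<longleftrightarrow> w = v" for w v :: "'m \<Rightarrow> nat"
    by (auto simp: nat_vec_def vec_eq_iff fun_eq_iff)
  define F where "F k = {v :: 'm \<Rightarrow> nat. \<forall>i. v i \<le> k}" for k
  have fin: "finite (F k)" for k
  proof -
    have "F k = (UNIV \<rightarrow>\<^sub>E {..k})" by (auto simp: F_def PiE_def extensional_def)
    then show ?thesis by (simp add: finite_PiE)
  qed
  have [measurable]: "?E v \<in> events" for v by measurable
  have "incseq (\<lambda>k. \<Union>v\<in>F k. ?E v)" 
  proof (rule incseq_SucI)
    fix k
    have "F k \<subseteq> F (Suc k)" by (auto simp: F_def le_Suc_eq)
    then show "(\<Union>v\<in>F k. ?E v) \<subseteq> (\<Union>v\<in>F (Suc k). ?E v)" by (rule UN_mono) simp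
  qed
  moreover have "range (\<lambda>k. \<Union>v\<in>F k. ?E v) \<subseteq> events" using fin by auto
  ultimately have "(\<lambda>k. prob (\<Union>v\<in>F k. ?E v)) \<longlonglongrightarrow> prob (\<Union>k. \<Union>v\<in>F k. ?E v)"
    by (intro finite_Lim_measure_incseq)
  moreover have "prob (\<Union>k. \<Union>v\<in>F k. ?E v) = 1"
  proof (rule prob_eq_1[THEN iffD2])
    show "AE \<omega> in M. \<omega> \<in> (\<Union>k. \<Union>v\<in>F k. ?E v)"
      using X_nat AE_space
    proof eventually_elim
      case (elim \<omega>)
      then obtain v where v: "X \<omega> = nat_vec v" by auto
      have "v \<in> F (Max (range v))" by (auto simp: F_def)
      then show ?case using v elim(2) by blast
    qed
  qed (use fin in auto)
  moreover have "prob (\<Union>v\<in>F k. ?E v) = (\<Sum>v\<in>F k. prob (?E v))" for k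
    using fin inj by (intro finite_measure_finite_Union) (auto simp: disjoint_family_on_def)
  ultimately have "(\<lambda>k. \<Sum>v\<in>F k. prob (?E v)) \<longlonglongrightarrow> 1" by simp
  then have "\<forall>\<^sub>F k in sequentially. 1 - e < (\<Sum>v\<in>F k. prob (?E v))"
    using assms by (intro order_tendstoD) auto
  then obtain k where "1 - e < (\<Sum>v\<in>F k. prob (?E v))" by (auto simp: eventually_sequentially)
  with fin that show ?thesis by blast
qed

end

text \<open>As a function of \<open>exp_vec x\<close>, the test function \<open>g\<close> need not
  extend continuously to the faces where a coordinate vanishes. Uniform approximation by polynomials
  is therefore applied to the bumps, which gives convergence of point masses. The limiting masses
  sum to 1, so one finite set carries nearly all mass of the limit and of \<open>X n\<close> for
  large \<open>n\<close>.\<close>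

lemma lattice_weak_convergence:
  fixes X :: "nat \<Rightarrow> 'w \<Rightarrow> real^'m::finite" and Y :: "'v \<Rightarrow> real^'m" and g :: "real^'m \<Rightarrow> real"
  assumes X: "\<And>n. lattice_vector (M n) (X n)" and Y: "lattice_vector M' Y"
    and laplace: "\<And>a :: 'm \<Rightarrow> nat. (\<lambda>n. \<integral>\<omega>. exp (- (\<Sum>i\<in>UNIV. real (a i) * X n \<omega> $ i)) \<partial>M n)
      \<longlonglongrightarrow> (\<integral>\<omega>. exp (- (\<Sum>i\<in>UNIV. real (a i) * Y \<omega> $ i)) \<partial>M')"
    and g: "continuous_on UNIV g" "bounded (range g)"
  shows "(\<lambda>n. \<integral>\<omega>. g (X n \<omega>) \<partial>M n) \<longlonglongrightarrow> (\<integral>\<omega>. g (Y \<omega>) \<partial>M')"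
proof -
  interpret X: lattice_vector "M n" "X n" for n by (rule X)
  interpret Y: lattice_vector M' Y by (rule Y)
  interpret ring: function_ring_on monomial_span "cbox 0 (1 :: real^'m)" by (rule function_ring_monomial_span)
  have poly: "(\<lambda>n. \<integral>\<omega>. p (exp_vec (X n \<omega>)) \<partial>M n) \<longlonglongrightarrow> (\<integral>\<omega>. p (exp_vec (Y \<omega>)) \<partial>M')" if "p \<in> monomial_span" for p
    using that
  proof (induction rule: monomial_span.induct)
    case (monomial c a)
    show ?case unfolding laplace_monomial_exp_vec by (simp, intro tendsto_mult tendsto_const laplace)
  next
    case (add p q)
    have "(\<integral>\<omega>. p (exp_vec (X n \<omega>)) + q (exp_vec (X n \<omega>)) \<partial>M n) = (\<integral>\<omega>. p (exp_vec (X n \<omega>)) \<partial>M n) + (\<integral>\<omega>. q (exp_vec (X n \<omega>)) \<partial>M n)" for n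
      using add by (intro Bochner_Integration.integral_add X.integrable_exp_vec continuous_monomial_span)
    moreover have "(\<integral>\<omega>. p (exp_vec (Y \<omega>)) + q (exp_vec (Y \<omega>)) \<partial>M') = (\<integral>\<omega>. p (exp_vec (Y \<omega>)) \<partial>M') + (\<integral>\<omega>. q (exp_vec (Y \<omega>)) \<partial>M')"
      using add by (intro Bochner_Integration.integral_add Y.integrable_exp_vec continuous_monomial_span)
    ultimately show ?case using tendsto_add[OF add.IH] by simp
  qed
  have cont: "(\<lambda>n. \<integral>\<omega>. q (exp_vec (X n \<omega>)) \<partial>M n) \<longlonglongrightarrow> (\<integral>\<omega>. q (exp_vec (Y \<omega>)) \<partial>M')" if q: "continuous_on UNIV q" for q :: "real^'m \<Rightarrow> real"
  proof (rule LIMSEQ_I)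
    fix e :: real assume e: "0 < e"
    then obtain p where p: "p \<in> monomial_span" "\<And>z. z \<in> cbox 0 1 \<Longrightarrow> \<bar>q z - p z\<bar> < e / 3"
      using ring.Stone_Weierstrass_basic[OF continuous_on_subset[OF q], of "e / 3"] by auto
    note cp = continuous_monomial_span[OF p(1)]
    obtain n0 where n0: "\<And>n. n \<ge> n0 \<Longrightarrow> norm ((\<integral>\<omega>. p (exp_vec (X n \<omega>)) \<partial>M n) - (\<integral>\<omega>. p (exp_vec (Y \<omega>)) \<partial>M')) < e / 3"
      using LIMSEQ_D[OF poly[OF p(1)], of "e / 3"] e by auto
    have 1: "\<bar>(\<integral>\<omega>. q (exp_vec (X n \<omega>)) \<partial>M n) - (\<integral>\<omega>. p (exp_vec (X n \<omega>)) \<partial>M n)\<bar> \<le> e / 3" for n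
      using p(2) by (intro X.expectation_approx q cp) (auto intro: less_imp_le)
    have 2: "\<bar>(\<integral>\<omega>. q (exp_vec (Y \<omega>)) \<partial>M') - (\<integral>\<omega>. p (exp_vec (Y \<omega>)) \<partial>M')\<bar> \<le> e / 3"
      using p(2) by (intro Y.expectation_approx q cp) (auto intro: less_imp_le)
    have "norm ((\<integral>\<omega>. q (exp_vec (X n \<omega>)) \<partial>M n) - (\<integral>\<omega>. q (exp_vec (Y \<omega>)) \<partial>M')) < e" if "n \<ge> n0" for n
      using 1[of n] 2 n0[OF that] unfolding real_norm_def by linarith
    then show "\<exists>n0. \<forall>n\<ge>n0. norm ((\<integral>\<omega>. q (exp_vec (X n \<omega>)) \<partial>M n) - (\<integral>\<omega>. q (exp_vec (Y \<omega>)) \<partial>M')) < e" by blast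
  qed
  let ?p = "\<lambda>n v. X.prob n {\<omega> \<in> space (M n). X n \<omega> = nat_vec v}" and ?q = "\<lambda>v. Y.prob {\<omega> \<in> space M'. Y \<omega> = nat_vec v}"
  have pmf: "(\<lambda>n. ?p n v) \<longlonglongrightarrow> ?q v" for v
    using cont[OF continuous_lattice_bump] unfolding X.expectation_bump Y.expectation_bump .
  obtain B where B: "0 < B" "\<And>x. \<bar>g x\<bar> \<le> B"
    using g(2) by (auto simp: bounded_pos)
  have gm: "g \<in> borel_measurable borel" using g(1) by (rule borel_measurable_continuous_onI)
  show ?thesis
  proof (rule LIMSEQ_I)
    fix e :: real assume e: "0 < e"
    \<comment> \<open>Three errors of size \<open>B * d\<close> occur: the tails of
      \<open>X n\<close> and of \<open>Y\<close>, and the difference of the finite sums.\<close>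
    define d where "d = e / (5 * B)"
    have d: "0 < d" using e B by (simp add: d_def)
    obtain F where F: "finite F" "1 - d < (\<Sum>v\<in>F. ?q v)" using Y.finite_mass[OF d] .
    have "(\<lambda>n. \<Sum>v\<in>F. ?p n v) \<longlonglongrightarrow> (\<Sum>v\<in>F. ?q v)" by (intro tendsto_sum pmf)
    then have ev1: "\<forall>\<^sub>F n in sequentially. 1 - d < (\<Sum>v\<in>F. ?p n v)" using F by (intro order_tendstoD)
    have "(\<lambda>n. \<Sum>v\<in>F. g (nat_vec v) * ?p n v) \<longlonglongrightarrow> (\<Sum>v\<in>F. g (nat_vec v) * ?q v)"
      by (intro tendsto_sum tendsto_mult tendsto_const pmf)
    then have ev2: "\<forall>\<^sub>F n in sequentially. dist (\<Sum>v\<in>F. g (nat_vec v) * ?p n v) (\<Sum>v\<in>F. g (nat_vec v) * ?q v) < B * d"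
      using B d by (intro tendstoD) auto
    have "\<forall>\<^sub>F n in sequentially. norm ((\<integral>\<omega>. g (X n \<omega>) \<partial>M n) - (\<integral>\<omega>. g (Y \<omega>) \<partial>M')) < e"
      using ev1 ev2
    proof eventually_elim
      case (elim n)
      have "B * (1 - (\<Sum>v\<in>F. ?p n v)) \<le> B * d" "B * (1 - (\<Sum>v\<in>F. ?q v)) \<le> B * d"
        using elim(1) F(2) B by (auto intro!: mult_left_mono)
      moreover have "B * d * 5 = e" using B by (simp add: d_def)
      ultimately show ?case
        using X.expectation_finite_approx[OF gm B(2) F(1), of n] Y.expectation_finite_approx[OF gm B(2) F(1)] elim(2) e
        unfolding real_norm_def dist_real_def by linarith
    qed
    then show "\<exists>n0. \<forall>n\<ge>n0. norm ((\<integral>\<omega>. g (X n \<omega>) \<partial>M n) - (\<integral>\<omega>. g (Y \<omega>) \<partial>M')) < e"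
      by (auto simp: eventually_sequentially)
  qed
qed

section \<open>Grids and blocks\<close>

definition grid_cell :: "real \<Rightarrow> real^'d \<Rightarrow> int^'d::finite" where
  "grid_cell h x = (\<chi> i. \<lfloor>x $ i / h\<rfloor>)"

definition grid_point :: "real \<Rightarrow> int^'d \<Rightarrow> real^'d::finite" where
  "grid_point h w = (\<chi> i. h * real_of_int (w $ i))"

definition block :: "int \<Rightarrow> int \<Rightarrow> int^'d \<Rightarrow> int^'d::finite" where
  "block J z u = (\<chi> i. (u $ i - z) div J)"

text \<open>
  The fine cells touching the boundary of a block: neighbouring cells in different blocks both
  lie in the layer.
\<close>

definition layer :: "int \<Rightarrow> int \<Rightarrow> (int^'d::finite) set" where
  "layer J z = {u. \<exists>i. (u $ i - z) mod J = 0 \<or> (u $ i - z) mod J = J - 1}"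

lemma dist_grid_point:
  fixes x :: "real^'d::finite"
  assumes h: "0 < h"
  shows "dist (grid_point h (grid_cell h x)) x \<le> real CARD('d) * h"
proof -
  have le: "\<bar>(grid_point h (grid_cell h x) - x) $ i\<bar> \<le> h" for i
  proof -
    have "h * real_of_int \<lfloor>x $ i / h\<rfloor> \<le> h * (x $ i / h)" using h by (intro mult_left_mono) auto
    moreover have "h * (x $ i / h) \<le> h * (real_of_int \<lfloor>x $ i / h\<rfloor> + 1)"
      using h by (intro mult_left_mono) linarith+
    ultimately have "h * real_of_int \<lfloor>x $ i / h\<rfloor> \<le> x $ i" "x $ i \<le> h * real_of_int \<lfloor>x $ i / h\<rfloor> + h"
      using h by (simp_all add: algebra_simps)
    then show ?thesis by (simp add: grid_point_def grid_cell_def)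
  qed
  have "dist (grid_point h (grid_cell h x)) x \<le> (\<Sum>i\<in>UNIV. \<bar>(grid_point h (grid_cell h x) - x) $ i\<bar>)"
    unfolding dist_norm by (rule norm_le_l1_cart)
  also have "\<dots> \<le> (\<Sum>i\<in>(UNIV :: 'd set). h)" by (intro sum_mono le)
  finally show ?thesis by simp
qed

lemma countable_int_vec: "countable (S :: (int^'d::finite) set)"
proof -
  have "countable ((UNIV :: 'd set) \<rightarrow>\<^sub>E (UNIV :: int set))" by (intro countable_PiE) auto
  moreover have "vec_nth ` S \<subseteq> ((UNIV :: 'd set) \<rightarrow>\<^sub>E (UNIV :: int set))" by auto
  ultimately have "countable (vec_nth ` S)" by (rule countable_subset[rotated])
  then show ?thesis by (rule countable_image_inj_on) (auto simp: inj_on_def vec_eq_iff)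
qed

lemma grid_cell_vimage: "grid_cell h -` S \<in> sets (borel :: (real^'d::finite) measure)"
proof -
  have cell: "grid_cell h -` {c} \<in> sets (borel :: (real^'d) measure)" for c
  proof -
    have "grid_cell h -` {c} = (\<Inter>i\<in>UNIV. {x :: real^'d. real_of_int (c $ i) \<le> x $ i / h \<and> x $ i / h < real_of_int (c $ i) + 1})"
      by (auto simp: grid_cell_def vec_eq_iff floor_eq_iff)
    also have "\<dots> \<in> sets borel" by (intro sets.finite_INT) auto
    finally show ?thesis .
  qed
  have "grid_cell h -` S = (\<Union>c\<in>S. grid_cell h -` {c})" by auto
  also have "\<dots> \<in> sets borel" by (rule sets.countable_UN'[OF countable_int_vec]) (use cell in auto)
  finally show ?thesis .
qed

lemma grid_cell_Collect: "{x. Q (grid_cell h x)} \<in> sets (borel :: (real^'d::finite) measure)"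
  using grid_cell_vimage[of h "Collect Q"] by (simp add: vimage_def)

text \<open>Halving the mesh nests the grids, so at every level a block is a union of whole cells
  and its content can be read from their occupation numbers.\<close>

lemma grid_cell_refine: "grid_cell h x = (\<chi> i. grid_cell (h / 2 ^ m) x $ i div 2 ^ m)"
proof -
  have "\<lfloor>x $ i / h\<rfloor> = \<lfloor>x $ i / (h / 2 ^ m)\<rfloor> div 2 ^ m" for i
    using floor_divide_real_eq_div[of "2 ^ m" "x $ i / (h / 2 ^ m)"] by simp
  then show ?thesis by (simp add: grid_cell_def vec_eq_iff)
qed

lemma grid_cell_near:
  fixes x y :: "real^'d::finite"
  assumes "dist x y < h"
  shows "\<bar>grid_cell h y $ i - grid_cell h x $ i\<bar> \<le> 1"
proof -
  have h: "0 < h" using assms zero_le_dist[of x y] by linarith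
  have "\<bar>x $ i - y $ i\<bar> < h" using component_le_norm_cart[of "x - y" i] assms by (simp add: dist_norm)
  then have "\<bar>x $ i / h - y $ i / h\<bar> < 1" using h by (simp add: abs_less_iff field_simps)
  then have "\<bar>\<lfloor>y $ i / h\<rfloor> - \<lfloor>x $ i / h\<rfloor>\<bar> \<le> 1" by linarith
  then show ?thesis by (simp add: grid_cell_def)
qed

text \<open>A remainder other than 0 and \<open>J - 1\<close> stays in range under a change by at
  most 1, so the quotient is unchanged.\<close>

lemma block_near:
  assumes J: "1 \<le> J" and u: "u \<notin> layer J z" and v: "\<And>i. \<bar>v $ i - u $ i\<bar> \<le> 1"
  shows "block J z v = block J z u"
proof -
  have "(v $ i - z) div J = (u $ i - z) div J" for i
  proof -
    let ?r = "(u $ i - z) mod J" and ?q = "(u $ i - z) div J"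
    have r: "?r \<noteq> 0" "?r \<noteq> J - 1" using u by (auto simp: layer_def)
    have "0 \<le> ?r" "?r < J" using J by auto
    moreover have "u $ i - z = J * ?q + ?r" by simp
    ultimately show ?thesis using v[of i] r
      by (intro int_div_pos_eq[of _ J ?q "?r + (v $ i - u $ i)"]) linarith+
  qed
  then show ?thesis by (simp add: block_def vec_eq_iff)
qed

text \<open>For a fixed cell, each coordinate produces the remainders 0 and \<open>J - 1\<close> for
  at most two of the \<open>J\<close> shifts. Averaging this count yields a shift with a thin layer
  in \<open>choose_shift\<close>.\<close>

lemma layer_shifts:
  fixes u :: "int^'d::finite"
  assumes J: "1 \<le> J"
  shows "(\<Sum>z\<in>{0..<J}. of_bool (u \<in> layer J z)) \<le> 2 * real CARD('d)"
proof -
  let ?Z = "\<lambda>i. {z \<in> {0..<J}. (u $ i - z) mod J = 0 \<or> (u $ i - z) mod J = J - 1}"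
  have sub: "?Z i \<subseteq> {u $ i mod J, (u $ i + 1) mod J}" for i
  proof
    fix z assume z: "z \<in> ?Z i"
    then have zJ: "z mod J = z" by auto
    from z consider "(u $ i - z) mod J = 0" | "(u $ i - z) mod J = J - 1" by auto
    then show "z \<in> {u $ i mod J, (u $ i + 1) mod J}"
    proof cases
      case 1
      then have "u $ i mod J = z mod J" by (simp add: mod_eq_dvd_iff dvd_eq_mod_eq_0)
      then show ?thesis using zJ by simp
    next
      case 2
      have "(u $ i + 1 - z) mod J = ((u $ i - z) mod J + 1) mod J" by (simp add: mod_simps algebra_simps)
      then have "(u $ i + 1 - z) mod J = 0" using 2 by simp
      then have "(u $ i + 1) mod J = z mod J" by (simp add: mod_eq_dvd_iff dvd_eq_mod_eq_0)
      then show ?thesis using zJ by simp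
    qed
  qed
  have card2: "card (?Z i) \<le> 2" for i
  proof -
    have "card (?Z i) \<le> card {u $ i mod J, (u $ i + 1) mod J}" by (rule card_mono[OF _ sub]) simp
    also have "\<dots> \<le> 2" by (simp add: card_insert_if)
    finally show ?thesis .
  qed
  have "{z \<in> {0..<J}. u \<in> layer J z} = (\<Union>i\<in>UNIV. ?Z i)"
  proof (intro equalityI subsetI)
    fix z assume "z \<in> {z \<in> {0..<J}. u \<in> layer J z}"
    then have "z \<in> {0..<J}" "\<exists>i. (u $ i - z) mod J = 0 \<or> (u $ i - z) mod J = J - 1"
      by (simp_all only: layer_def mem_Collect_eq)
    then obtain i where "(u $ i - z) mod J = 0 \<or> (u $ i - z) mod J = J - 1" by (elim exE)
    with \<open>z \<in> {0..<J}\<close> have "z \<in> ?Z i" by (intro CollectI conjI)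
    then show "z \<in> (\<Union>i\<in>UNIV. ?Z i)" by (rule UN_I[OF UNIV_I])
  next
    fix z assume "z \<in> (\<Union>i\<in>UNIV. ?Z i)"
    then obtain i where "z \<in> ?Z i" by (rule UN_E)
    then have "z \<in> {0..<J} \<and> ((u $ i - z) mod J = 0 \<or> (u $ i - z) mod J = J - 1)" by (rule CollectD)
    then show "z \<in> {z \<in> {0..<J}. u \<in> layer J z}"
      unfolding layer_def by (intro CollectI conjI exI[of _ i]; elim conjE)
  qed
  then have "card {z \<in> {0..<J}. u \<in> layer J z} \<le> (\<Sum>i\<in>UNIV. card (?Z i))" by (simp add: card_UN_le)
  also have "\<dots> \<le> (\<Sum>i\<in>(UNIV :: 'd set). 2)" by (intro sum_mono card2)
  finally have "real (card {z \<in> {0..<J}. u \<in> layer J z}) \<le> 2 * real CARD('d)" by simp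
  then show ?thesis by (simp add: of_bool_def sum.If_cases Int_def)
qed

lemma finite_vec_Collect:
  fixes A :: "'d::finite \<Rightarrow> int set"
  assumes "\<And>i. finite (A i)"
  shows "finite {w :: int^'d. \<forall>i. w $ i \<in> A i}"
proof (rule finite_subset)
  show "{w :: int^'d. \<forall>i. w $ i \<in> A i} \<subseteq> vec_lambda ` (\<Pi>\<^sub>E i\<in>UNIV. A i)"
    by (auto intro!: image_eqI[of _ vec_lambda "vec_nth _"] simp: vec_nth_inverse)
  show "finite (vec_lambda ` (\<Pi>\<^sub>E i\<in>UNIV. A i))" using assms by (intro finite_imageI finite_PiE) auto
qed

lemma finite_block:
  fixes q :: "int^'d::finite"
  assumes J: "1 \<le> J" and b: "1 \<le> b"
  shows "finite {w :: int^'d. block J z (\<chi> i. w $ i div b) = q}"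
proof (rule finite_subset)
  show "{w. block J z (\<chi> i. w $ i div b) = q} \<subseteq> {w. \<forall>i. w $ i \<in> {b * (z + J * q $ i)..b * (z + J * q $ i + J)}}"
  proof (clarify)
    fix w :: "int^'d" and i
    let ?w = "\<chi> i. w $ i div b"
    have "J * ((w $ i div b - z) div J) \<le> w $ i div b - z" using J by (simp add: mult.commute minus_mod_eq_mult_div[symmetric])
    moreover have "w $ i div b - z < J * ((w $ i div b - z) div J) + J"
      using J mult_div_mod_eq[of J "w $ i div b - z"] pos_mod_bound[of J "w $ i div b - z"] by linarith
    ultimately have "z + J * block J z ?w $ i \<le> w $ i div b" "w $ i div b + 1 \<le> z + J * block J z ?w $ i + J"
      by (simp_all add: block_def)
    then have "b * (z + J * block J z ?w $ i) \<le> b * (w $ i div b)" "b * (w $ i div b + 1) \<le> b * (z + J * block J z ?w $ i + J)"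
      using b by (auto intro!: mult_left_mono)
    moreover have "b * (w $ i div b) \<le> w $ i" "w $ i \<le> b * (w $ i div b + 1)"
    proof -
      have "b * (w $ i div b) + w $ i mod b = w $ i" "0 \<le> w $ i mod b" "w $ i mod b < b" using b by auto
      then show "b * (w $ i div b) \<le> w $ i" "w $ i \<le> b * (w $ i div b + 1)"
        unfolding distrib_left mult_1_right by linarith+
    qed
    ultimately show "w $ i \<in> {b * (z + J * block J z ?w $ i)..b * (z + J * block J z ?w $ i + J)}" by auto
  qed
qed (rule finite_vec_Collect, simp)

section \<open>The block approximation of the Betti numbers\<close>

locale cech_process = poisson_proc \<Omega> \<mu> P
  for \<Omega> :: "'w measure" and \<mu> :: "(real^'d::finite) measure" and P :: "'w \<Rightarrow> (real^'d) set" +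
  fixes k :: nat and s :: real and t :: "'m::finite \<Rightarrow> real" and tm :: real
    and g :: "real^'d \<Rightarrow> real" and G :: real and a :: "'m \<Rightarrow> real"
    and J z :: int and Q :: "(int^'d) set"
  assumes k: "1 \<le> k" and s: "0 < s" and tm: "0 < tm" and t_le: "\<And>i. t i \<le> tm"
    and g: "g \<in> borel_measurable borel" "\<And>x. 0 \<le> g x" "\<And>x. g x \<le> G"
    and \<mu>_eq: "\<mu> = density lborel (\<lambda>x. ennreal (g x))"
    and a: "\<And>i. 0 \<le> a i" and J: "1 \<le> J" and finQ: "finite Q"
begin

text \<open>The cluster condition concerns balls of radius \<open>2 * (s * t i)\<close>; with cells
  of this side such a ball reaches only adjacent cells.\<close>

definition h :: real where "h = 2 * s * tm"
definition B :: "int^'d \<Rightarrow> (real^'d) set" where "B q = {x. block J z (grid_cell h x) = q}"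
definition outside :: "(real^'d) set" where "outside = {x. block J z (grid_cell h x) \<notin> Q}"
definition seam :: "(real^'d) set" where "seam = {x. grid_cell h x \<in> layer J z}"
definition \<kappa> :: "nat \<Rightarrow> real^'d \<Rightarrow> int^'d" where "\<kappa> m = grid_cell (h / 2 ^ m)"
definition C :: "nat \<Rightarrow> int^'d \<Rightarrow> (int^'d) set" where "C m q = {w. block J z (\<chi> i. w $ i div 2 ^ m) = q}"
definition \<delta> :: "nat \<Rightarrow> real" where "\<delta> m = real CARD('d) * (h / 2 ^ m)"
text \<open>The complement \<open>1 - weight b\<close> is the Laplace factor of one block, so a
  product over blocks is the exponential of the total number of hollow simplices.\<close>

definition weight :: "('m \<Rightarrow> bool) \<Rightarrow> real" where "weight b = 1 - exp (- (\<Sum>i\<in>UNIV. a i * of_bool (b i)))"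
definition \<psi> :: "(real^'d) set \<Rightarrow> real" where "\<psi> X = weight (\<lambda>i. hollow_simplex k (s * t i) X)"
definition \<phi> :: "nat \<Rightarrow> (int^'d) set \<Rightarrow> real" where
  "\<phi> m S = (if card S = k + 2
    then weight (\<lambda>i. hollow_simplex k (s * t i - 2 * \<delta> m) (grid_point (h / 2 ^ m) ` S)) else 0)"

lemma h_pos: "0 < h" using s tm by (simp add: h_def)

lemma weight_bounds: "0 \<le> weight b" "weight b \<le> 1"
  using a by (auto simp: weight_def intro!: sum_nonneg)

lemma approximation_grid: "approximation (\<lambda>m x. grid_point (h / 2 ^ m) (\<kappa> m x)) \<delta>"
proof
  show "dist (grid_point (h / 2 ^ m) (\<kappa> m x)) x \<le> \<delta> m" for m x
    unfolding \<kappa>_def \<delta>_def using h_pos by (intro dist_grid_point) simp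
  have "(\<lambda>m. real CARD('d) * h * (1 / 2) ^ m) \<longlonglongrightarrow> real CARD('d) * h * 0"
    by (intro tendsto_intros LIMSEQ_power_zero) auto
  moreover have "\<delta> = (\<lambda>m. real CARD('d) * h * (1 / 2) ^ m)"
    by (simp add: \<delta>_def fun_eq_iff power_divide)
  ultimately show "\<delta> \<longlonglongrightarrow> 0" by simp
qed

sublocale appr: approximation "\<lambda>m x. grid_point (h / 2 ^ m) (\<kappa> m x)" \<delta>
  by (rule approximation_grid)

lemma \<kappa>_inj: "finite X \<Longrightarrow> \<forall>\<^sub>F m in sequentially. inj_on (\<kappa> m) X"
  using appr.eventually_inj_on[of X]
  by (rule eventually_mono) (auto intro: inj_on_imageI2[of "grid_point _"] simp: o_def)

lemma \<phi>_lim: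
  assumes X: "finite X" shows "(\<lambda>m. \<phi> m (\<kappa> m ` X)) \<longlonglongrightarrow> \<psi> X"
proof (rule tendsto_eventually)
  have "\<forall>\<^sub>F m in sequentially. \<forall>i\<in>(UNIV :: 'm set). inj_on (\<lambda>x. grid_point (h / 2 ^ m) (\<kappa> m x)) X \<and>
      (hollow_simplex k (s * t i - 2 * \<delta> m) ((\<lambda>x. grid_point (h / 2 ^ m) (\<kappa> m x)) ` X) \<longleftrightarrow> hollow_simplex k (s * t i) X)"
    by (intro eventually_ball_finite ballI appr.eventually_hollow_simplex_iff X) simp
  then show "\<forall>\<^sub>F m in sequentially. \<phi> m (\<kappa> m ` X) = \<psi> X"
    using \<kappa>_inj[OF X]
  proof eventually_elim
    case (elim m)
    have card: "card (\<kappa> m ` X) = card X" using elim(2) by (rule card_image)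
    have im: "grid_point (h / 2 ^ m) ` \<kappa> m ` X = (\<lambda>x. grid_point (h / 2 ^ m) (\<kappa> m x)) ` X" by (simp add: image_image)
    show ?case
    proof (cases "card X = k + 2")
      case True
      have "hollow_simplex k (s * t i - 2 * \<delta> m) (grid_point (h / 2 ^ m) ` \<kappa> m ` X) = hollow_simplex k (s * t i) X" for i
        unfolding im using elim(1) by blast
      then show ?thesis using True card by (simp add: \<phi>_def \<psi>_def)
    next
      case False
      then have "\<not> hollow_simplex k (s * t i) X" for i by (simp add: hollow_simplex_def)
      then show ?thesis using False card by (simp add: \<phi>_def \<psi>_def weight_def)
    qed
  qed
qed

text \<open>Tuples have length \<open>k + 2\<close> because \<open>\<psi>\<close> and its
  approximations vanish on all other cardinalities.\<close>

sublocale block_functional \<Omega> \<mu> P Q B C \<kappa> \<psi> \<phi> "k + 2"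
proof
  show "\<kappa> m -` {c} \<in> sets borel" for m c unfolding \<kappa>_def by (rule grid_cell_vimage)
  show "finite (C m q)" for m q unfolding C_def using J by (intro finite_block) auto
  show "B q = \<kappa> m -` C m q" for q m
    unfolding B_def C_def \<kappa>_def by (subst grid_cell_refine[of h _ m]) auto
  show "disjoint_family_on (C m) Q" for m by (auto simp: disjoint_family_on_def C_def)
  show "0 \<le> \<phi> m S" "\<phi> m S \<le> 1" for m S using weight_bounds by (auto simp: \<phi>_def)
qed (use finQ \<phi>_lim \<kappa>_inj in \<open>auto simp: \<phi>_def\<close>)

lemma measure_box:
  assumes S: "S \<in> sets borel" and r: "0 \<le> r" and sub: "\<And>x i. x \<in> S \<Longrightarrow> lo i \<le> x $ i \<and> x $ i \<le> lo i + r"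
  shows "measure \<mu> S \<le> G * r ^ CARD('d)"
proof -
  let ?c = "cbox (\<chi> i. lo i) (\<chi> i. lo i + r)"
  have G: "0 \<le> G" using g(2,3)[of 0] by linarith
  have "measure lborel ?c = r ^ CARD('d)"
    using r by (subst content_cbox_cart) (auto simp: interval_eq_empty_cart not_less)
  then have c: "emeasure lborel ?c = ennreal (r ^ CARD('d))"
    using emeasure_lborel_cbox_finite[of "\<chi> i. lo i" "\<chi> i. lo i + r"]
    by (simp add: emeasure_eq_ennreal_measure less_top)
  have "S \<subseteq> ?c" using sub by (auto simp: mem_box_cart)
  then have "emeasure \<mu> S \<le> emeasure \<mu> ?c" by (intro emeasure_mono) (auto simp: sets_\<mu>)
  also have "\<dots> = (\<integral>\<^sup>+ x. ennreal (g x) * indicator ?c x \<partial>lborel)"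
    unfolding \<mu>_eq using g(1) by (intro emeasure_density) auto
  also have "\<dots> \<le> (\<integral>\<^sup>+ x. ennreal G * indicator ?c x \<partial>lborel)"
    using g(3) by (intro nn_integral_mono mult_right_mono) (auto intro: ennreal_leI)
  also have "\<dots> = ennreal (G * r ^ CARD('d))"
    using c G r by (simp add: nn_integral_cmult ennreal_mult)
  finally show ?thesis
    using G r by (simp add: mu.emeasure_eq_measure)
qed

definition near :: "int^'d \<Rightarrow> (real^'d) set" where
  "near c = {x. \<forall>i. \<bar>grid_cell h x $ i - c $ i\<bar> \<le> 1}"

lemma sets_sets: "B q \<in> sets borel" "outside \<in> sets borel" "seam \<in> sets borel" "near c \<in> sets borel" "grid_cell h -` {c} \<in> sets borel"
  unfolding B_def outside_def seam_def near_def by (rule grid_cell_Collect grid_cell_vimage)+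

lemma grid_cell_bounds:
  "h * real_of_int (grid_cell h x $ i) \<le> x $ i" "x $ i \<le> h * real_of_int (grid_cell h x $ i) + h"
proof -
  have "h * real_of_int \<lfloor>x $ i / h\<rfloor> \<le> h * (x $ i / h)" using h_pos by (intro mult_left_mono) auto
  moreover have "h * (x $ i / h) \<le> h * (real_of_int \<lfloor>x $ i / h\<rfloor> + 1)"
    using h_pos by (intro mult_left_mono) linarith+
  ultimately show "h * real_of_int (grid_cell h x $ i) \<le> x $ i" "x $ i \<le> h * real_of_int (grid_cell h x $ i) + h"
    using h_pos by (simp_all add: grid_cell_def algebra_simps)
qed

text \<open>\<open>\<eta>\<close> bounds the mass of a block of \<open>J\<close> cells per side, and
  \<open>\<theta>\<close> the mass of a cell together with its adjacent cells, three per
  side.\<close>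

definition \<eta> :: real where "\<eta> = G * (real_of_int J * h) ^ CARD('d)"
definition \<theta> :: real where "\<theta> = G * (3 * h) ^ CARD('d)"

lemma measure_B: "measure \<mu> (B q) \<le> \<eta>"
  unfolding \<eta>_def
proof (rule measure_box[where lo = "\<lambda>i. h * real_of_int (z + J * q $ i)"])
  show "0 \<le> real_of_int J * h" using J h_pos by simp
  fix x i assume "x \<in> B q"
  then have q: "q $ i = (grid_cell h x $ i - z) div J" by (auto simp: B_def block_def)
  let ?u = "grid_cell h x $ i"
  have "z + J * q $ i \<le> ?u" "?u + 1 \<le> z + J * q $ i + J"
    unfolding q using J mult_div_mod_eq[of J "?u - z"] pos_mod_bound[of J "?u - z"] pos_mod_sign[of J "?u - z"] by linarith+
  then have "h * real_of_int (z + J * q $ i) \<le> h * real_of_int ?u" "h * real_of_int (?u + 1) \<le> h * real_of_int (z + J * q $ i + J)"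
    using h_pos by (auto intro!: mult_left_mono simp del: of_int_add)
  then show "h * real_of_int (z + J * q $ i) \<le> x $ i \<and> x $ i \<le> h * real_of_int (z + J * q $ i) + real_of_int J * h"
    using grid_cell_bounds[of x i] by (simp add: algebra_simps)
qed (rule sets_sets)

lemma measure_near: "measure \<mu> (near c) \<le> \<theta>"
  unfolding \<theta>_def
proof (rule measure_box[where lo = "\<lambda>i. h * real_of_int (c $ i - 1)"])
  show "0 \<le> 3 * h" using h_pos by simp
  fix x i assume "x \<in> near c"
  then have "\<bar>grid_cell h x $ i - c $ i\<bar> \<le> 1" by (auto simp: near_def)
  then have "c $ i - 1 \<le> grid_cell h x $ i" "grid_cell h x $ i + 1 \<le> c $ i + 2" by auto
  then have "h * real_of_int (c $ i - 1) \<le> h * real_of_int (grid_cell h x $ i)" "h * real_of_int (grid_cell h x $ i + 1) \<le> h * real_of_int (c $ i + 2)"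
    using h_pos by (auto intro!: mult_left_mono simp del: of_int_add of_int_diff)
  then show "h * real_of_int (c $ i - 1) \<le> x $ i \<and> x $ i \<le> h * real_of_int (c $ i - 1) + 3 * h"
    using grid_cell_bounds[of x i] by (simp add: algebra_simps)
qed (rule sets_sets)

end

section \<open>Elementary inequalities for the error estimates\<close>

lemma abs_exp_minus_diff_le:
  fixes x y :: real
  assumes "0 \<le> x" "0 \<le> y"
  shows "\<bar>exp (- x) - exp (- y)\<bar> \<le> \<bar>x - y\<bar>"
proof -
  have *: "exp (- x) - exp (- y) \<le> y - x" if "0 \<le> x" "x \<le> y" for x y :: real
  proof -
    have "1 - exp (- (y - x)) \<le> y - x" using exp_ge_add_one_self[of "- (y - x)"] by linarith
    then have "exp (- x) * (1 - exp (- (y - x))) \<le> 1 * (y - x)"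
      using that by (intro mult_mono) auto
    moreover have "exp (- x) * exp (- (y - x)) = exp (- y)" by (simp flip: exp_add)
    ultimately show ?thesis by (simp add: right_diff_distrib)
  qed
  show ?thesis
  proof (cases "x \<le> y")
    case True
    then show ?thesis using *[of x y] assms by auto
  next
    case False
    then show ?thesis using *[of y x] assms by auto
  qed
qed

lemma abs_one_minus_exp_le:
  fixes q :: real
  assumes "0 \<le> q" "q \<le> 1"
  shows "\<bar>1 - q - exp (- q)\<bar> \<le> q\<^sup>2"
proof -
  \<comment> \<open>The product is \<open>1 + q ^ 3\<close>; the factor \<open>1 + q\<close> is then
    enlarged to \<open>exp q\<close>.\<close>
  have "1 \<le> (1 - q + q\<^sup>2) * (1 + q)" using assms by (simp add: algebra_simps power2_eq_square)
  also have "\<dots> \<le> (1 - q + q\<^sup>2) * exp q" using assms by (intro mult_left_mono) auto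
  finally have "exp (- q) \<le> 1 - q + q\<^sup>2" by (simp add: exp_minus field_simps)
  moreover have "1 - q \<le> exp (- q)" using exp_ge_add_one_self[of "- q"] by simp
  ultimately show ?thesis by simp
qed

lemma power_Suc_le:
  fixes x y :: real assumes "0 \<le> x" "x \<le> y" shows "x ^ Suc n \<le> y ^ n * x"
  using mult_right_mono[OF power_mono[OF assms(2,1), of n] assms(1)] by (simp add: mult.commute)

context cech_process
begin

text \<open>Restricted to the blocks in \<open>Q\<close>, which makes the set finite; points in
  other blocks are excluded through \<open>outside\<close>.\<close>

definition seam_cells :: "(int^'d) set" where
  "seam_cells = {c \<in> layer J z. block J z c \<in> Q}"

lemma finite_seam_cells: "finite seam_cells"
proof (rule finite_subset)
  show "seam_cells \<subseteq> (\<Union>q\<in>Q. {w. block J z (\<chi> i. w $ i div 1) = q})"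
    by (auto simp: seam_cells_def)
  show "finite (\<Union>q\<in>Q. {w. block J z (\<chi> i. w $ i div 1) = q})"
    using J by (intro finite_UN_I finQ finite_block) auto
qed

text \<open>
  Off this event the Cech complexes are clustered, and no hollow simplex crosses the boundary of a
  block, for it would put \<open>k + 2\<close> points near a single cell of the seam.
\<close>

definition bad :: "'w set" where
  "bad = {\<omega> \<in> space \<Omega>. 1 \<le> emeasure (N \<omega>) outside}
    \<union> (\<Union>q\<in>Q. {\<omega> \<in> space \<Omega>. of_nat (k + 3) \<le> emeasure (N \<omega>) (B q)})
    \<union> (\<Union>c\<in>seam_cells. {\<omega> \<in> space \<Omega>. 1 \<le> emeasure (N \<omega>) (grid_cell h -` {c})
        \<and> of_nat (Suc (k + 1)) \<le> emeasure (N \<omega>) (near c)})"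

lemma bad_event: "bad \<in> events"
proof -
  note [measurable] = sets_sets
  show ?thesis unfolding bad_def
    by (intro sets.Un sets.finite_UN finQ finite_seam_cells) measurable
qed

lemma \<eta>_nonneg: "0 \<le> \<eta>" using measure_B[of 0] measure_nonneg[of \<mu> "B 0"] by linarith
lemma \<theta>_nonneg: "0 \<le> \<theta>" using measure_near[of 0] measure_nonneg[of \<mu> "near 0"] by linarith

lemma sum_measure_B_le: "(\<Sum>q\<in>Q. measure \<mu> (B q)) \<le> measure \<mu> UNIV"
proof -
  have "(\<Sum>q\<in>Q. measure \<mu> (B q)) = measure \<mu> (\<Union>q\<in>Q. B q)"
    using finQ sets_sets sets_\<mu>
    by (intro mu.finite_measure_finite_Union[symmetric]) (auto simp: disjoint_family_on_def B_def)
  also have "\<dots> \<le> measure \<mu> UNIV" by (intro mu.finite_measure_mono) (auto simp: sets_\<mu>)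
  finally show ?thesis .
qed

lemma sum_power_measure_B_le: "(\<Sum>q\<in>Q. measure \<mu> (B q) ^ Suc n) \<le> \<eta> ^ n * measure \<mu> UNIV"
proof -
  have "(\<Sum>q\<in>Q. measure \<mu> (B q) ^ Suc n) \<le> (\<Sum>q\<in>Q. \<eta> ^ n * measure \<mu> (B q))"
    by (intro sum_mono power_Suc_le measure_B) simp
  also have "\<dots> = \<eta> ^ n * (\<Sum>q\<in>Q. measure \<mu> (B q))" by (simp add: sum_distrib_left)
  also have "\<dots> \<le> \<eta> ^ n * measure \<mu> UNIV" using \<eta>_nonneg by (intro mult_left_mono sum_measure_B_le) auto
  finally show ?thesis .
qed

text \<open>A crowded block contributes \<open>measure \<mu> (B q) ^ (k + 3)\<close>, of which one
  factor is summed over the blocks. For the seam, \<open>prob_cluster\<close> leaves one factor with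
  the mass of the cell, and these masses add up to at most that of the seam.\<close>

lemma prob_bad:
  "prob bad \<le> measure \<mu> outside + \<eta> ^ (k + 2) * measure \<mu> UNIV + real (k + 2) * \<theta> ^ (k + 1) * measure \<mu> seam"
proof -
  let ?E1 = "{\<omega> \<in> space \<Omega>. 1 \<le> emeasure (N \<omega>) outside}"
  let ?E2 = "\<lambda>q. {\<omega> \<in> space \<Omega>. of_nat (k + 3) \<le> emeasure (N \<omega>) (B q)}"
  let ?E3 = "\<lambda>c. {\<omega> \<in> space \<Omega>. 1 \<le> emeasure (N \<omega>) (grid_cell h -` {c}) \<and> of_nat (Suc (k + 1)) \<le> emeasure (N \<omega>) (near c)}"
  note [measurable] = sets_sets
  have E[measurable]: "?E1 \<in> events" "?E2 q \<in> events" "?E3 c \<in> events" for q c by measurable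
  have 1: "prob ?E1 \<le> measure \<mu> outside" using prob_ge[of outside 1] sets_sets by simp
  have "prob (\<Union>q\<in>Q. ?E2 q) \<le> (\<Sum>q\<in>Q. prob (?E2 q))"
    using finQ E by (intro finite_measure_subadditive_finite) auto
  also have "\<dots> \<le> (\<Sum>q\<in>Q. measure \<mu> (B q) ^ Suc (k + 2))"
    using prob_ge[OF sets_sets(1), of "k + 3"] by (intro sum_mono) (simp add: eval_nat_numeral)
  also have "\<dots> \<le> \<eta> ^ (k + 2) * measure \<mu> UNIV" by (rule sum_power_measure_B_le)
  finally have 2: "prob (\<Union>q\<in>Q. ?E2 q) \<le> \<eta> ^ (k + 2) * measure \<mu> UNIV" .
  have "prob (\<Union>c\<in>seam_cells. ?E3 c) \<le> (\<Sum>c\<in>seam_cells. prob (?E3 c))"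
    using finite_seam_cells E by (intro finite_measure_subadditive_finite) auto
  also have "\<dots> \<le> (\<Sum>c\<in>seam_cells. real (k + 2) * \<theta> ^ (k + 1) * measure \<mu> (grid_cell h -` {c}))"
  proof (intro sum_mono)
    fix c
    have "grid_cell h -` {c} \<subseteq> near c" by (auto simp: near_def)
    then have "prob (?E3 c) \<le> real (Suc (k + 1)) * (measure \<mu> (grid_cell h -` {c}) * measure \<mu> (near c) ^ (k + 1))"
      by (intro prob_cluster sets_sets)
    also have "\<dots> \<le> real (Suc (k + 1)) * (measure \<mu> (grid_cell h -` {c}) * \<theta> ^ (k + 1))"
      by (intro mult_left_mono power_mono measure_near) auto
    finally show "prob (?E3 c) \<le> real (k + 2) * \<theta> ^ (k + 1) * measure \<mu> (grid_cell h -` {c})" by (simp add: mult_ac)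
  qed
  also have "\<dots> = real (k + 2) * \<theta> ^ (k + 1) * (\<Sum>c\<in>seam_cells. measure \<mu> (grid_cell h -` {c}))"
    by (simp add: sum_distrib_left)
  also have "(\<Sum>c\<in>seam_cells. measure \<mu> (grid_cell h -` {c})) = measure \<mu> (\<Union>c\<in>seam_cells. grid_cell h -` {c})"
  proof (rule mu.finite_measure_finite_Union[symmetric, OF finite_seam_cells])
    show "(\<lambda>c. grid_cell h -` {c}) ` seam_cells \<subseteq> sets \<mu>"
      by (rule image_subsetI) (simp only: sets_\<mu> sets_sets(5))
    show "disjoint_family_on (\<lambda>c. grid_cell h -` {c}) seam_cells"
      by (auto simp: disjoint_family_on_def)
  qed
  also have "real (k + 2) * \<theta> ^ (k + 1) * measure \<mu> (\<Union>c\<in>seam_cells. grid_cell h -` {c}) \<le> real (k + 2) * \<theta> ^ (k + 1) * measure \<mu> seam"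
  proof (intro mult_left_mono mu.finite_measure_mono)
    show "(\<Union>c\<in>seam_cells. grid_cell h -` {c}) \<subseteq> seam" by (auto simp: seam_cells_def seam_def)
    show "seam \<in> sets \<mu>" by (simp only: sets_\<mu> sets_sets(3))
  qed (use \<theta>_nonneg in simp)
  finally have 3: "prob (\<Union>c\<in>seam_cells. ?E3 c) \<le> real (k + 2) * \<theta> ^ (k + 1) * measure \<mu> seam" .
  have "prob bad \<le> prob (?E1 \<union> (\<Union>q\<in>Q. ?E2 q)) + prob (\<Union>c\<in>seam_cells. ?E3 c)"
    unfolding bad_def using E finQ finite_seam_cells
    by (intro measure_Un_le sets.Un sets.finite_UN) auto
  also have "prob (?E1 \<union> (\<Union>q\<in>Q. ?E2 q)) \<le> prob ?E1 + prob (\<Union>q\<in>Q. ?E2 q)"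
    using E finQ by (intro measure_Un_le sets.finite_UN) auto
  finally show ?thesis using 1 2 3 by linarith
qed

text \<open>Off \<open>bad\<close>, the ball of radius \<open>h\<close> around a point stays in one
  block with at most \<open>k + 2\<close> points, or the point lies in a seam cell with at most
  \<open>k + 1\<close> points around it. Either way the complex is clustered, and hollow simplices
  avoid the seam.\<close>

lemma not_bad_betti:
  assumes \<omega>: "\<omega> \<in> space \<Omega>" "\<omega> \<notin> bad" and fin: "finite (P \<omega>)"
  shows "betti_number k (cech_complex (P \<omega>) (s * t i)) = (\<Sum>q\<in>Q. of_bool (hollow_simplex k (s * t i) (P \<omega> \<inter> B q)))"
proof -
  let ?X = "P \<omega>" and ?hol = "hollow_simplex k (s * t i)"
  have N_card: "emeasure (N \<omega>) A = of_nat (card (?X \<inter> A))" if "A \<in> sets borel" for A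
    using N_eq[OF that, of \<omega>] fin by simp
  have "\<not> 1 \<le> emeasure (N \<omega>) outside" using \<omega> by (auto simp: bad_def)
  then have "card (?X \<inter> outside) = 0"
    unfolding N_card[OF sets_sets(2)] by (metis One_nat_def Suc_leI neq0_conv of_nat_1 of_nat_le_iff)
  then have inQ: "block J z (grid_cell h x) \<in> Q" if "x \<in> ?X" for x
    using that fin by (auto simp: outside_def)
  have B_card: "card (?X \<inter> B q) \<le> k + 2" if "q \<in> Q" for q
  proof -
    have "\<not> (of_nat (k + 3) :: ennreal) \<le> of_nat (card (?X \<inter> B q))"
      using \<omega> that unfolding bad_def N_card[OF sets_sets(1), symmetric] by blast
    then have "\<not> k + 3 \<le> card (?X \<inter> B q)" by (simp only: of_nat_le_iff not_False_eq_True)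
    then show ?thesis by simp
  qed
  have seam_card: "card (?X \<inter> near c) \<le> k + 1" if c: "c \<in> layer J z" "x \<in> ?X" "grid_cell h x = c" for c x
  proof -
    have cs: "c \<in> seam_cells" using c inQ[OF c(2)] by (simp add: seam_cells_def)
    have "card (?X \<inter> grid_cell h -` {c}) \<noteq> 0" using c fin by auto
    then have "(of_nat 1 :: ennreal) \<le> of_nat (card (?X \<inter> grid_cell h -` {c}))" by (simp only: of_nat_le_iff)
    then have "1 \<le> emeasure (N \<omega>) (grid_cell h -` {c})" unfolding N_card[OF sets_sets(5)] by simp
    then have "\<not> of_nat (Suc (k + 1)) \<le> emeasure (N \<omega>) (near c)"
      using \<omega> cs unfolding bad_def by blast
    then have "\<not> Suc (k + 1) \<le> card (?X \<inter> near c)" unfolding N_card[OF sets_sets(4)] by (simp only: of_nat_le_iff not_False_eq_True)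
    then show ?thesis by simp
  qed
  have ball_near: "?X \<inter> ball x h \<subseteq> ?X \<inter> near (grid_cell h x)" for x
    using grid_cell_near[of x _ h] by (auto simp: near_def)
  have ball_B: "?X \<inter> ball x h \<subseteq> ?X \<inter> B (block J z (grid_cell h x))" if "grid_cell h x \<notin> layer J z" for x
  proof
    fix y assume y: "y \<in> ?X \<inter> ball x h"
    have "block J z (grid_cell h y) = block J z (grid_cell h x)"
      by (rule block_near[OF J that]) (use y grid_cell_near[of x y h] in auto)
    then show "y \<in> ?X \<inter> B (block J z (grid_cell h x))" using y by (simp add: B_def)
  qed
  have sti: "s * t i \<le> s * tm" using s t_le[of i] by simp
  have ball_card: "card (?X \<inter> ball x h) \<le> k + 2" if x: "x \<in> ?X" for x
  proof (cases "grid_cell h x \<in> layer J z")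
    case True
    have "card (?X \<inter> ball x h) \<le> card (?X \<inter> near (grid_cell h x))" using fin ball_near by (intro card_mono) auto
    then show ?thesis using seam_card[OF True x refl] by linarith
  next
    case False
    have "card (?X \<inter> ball x h) \<le> card (?X \<inter> B (block J z (grid_cell h x)))" using fin ball_B[OF False] by (intro card_mono) auto
    then show ?thesis using B_card[OF inQ[OF x]] by linarith
  qed
  have "betti_number k (cech_complex ?X (s * t i)) = card {Y. Y \<subseteq> ?X \<and> ?hol Y}"
  proof (rule betti_number_cech_complex[OF fin k])
    fix x assume x: "x \<in> ?X"
    have "ball x (2 * (s * t i)) \<subseteq> ball x h" using sti by (intro subset_ball) (simp add: h_def)
    then have "card (?X \<inter> ball x (2 * (s * t i))) \<le> card (?X \<inter> ball x h)" using fin by (intro card_mono) auto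
    then show "card (?X \<inter> ball x (2 * (s * t i))) \<le> k + 2" using ball_card[OF x] by linarith
  qed
  also have "{Y. Y \<subseteq> ?X \<and> ?hol Y} = (\<lambda>q. ?X \<inter> B q) ` {q \<in> Q. ?hol (?X \<inter> B q)}"
  proof (intro equalityI subsetI)
    fix Y assume Y: "Y \<in> {Y. Y \<subseteq> ?X \<and> ?hol Y}"
    then have Y': "finite Y" "card Y = k + 2" "Y \<subseteq> ?X" by (auto simp: hollow_simplex_def)
    then obtain x where x: "x \<in> Y" "x \<in> ?X" by (metis card.empty all_not_in_conv subsetD add_is_0 zero_neq_numeral)
    have "dist x y < h" if y: "y \<in> Y" for y
    proof -
      have "dist x y < s * t i" using hollow_simplex_dist[OF _ k x(1) y, of "s * t i"] Y by simp
      moreover have "s * tm \<le> h" using s tm by (simp add: h_def)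
      ultimately show ?thesis using sti by linarith
    qed
    then have Yball: "Y \<subseteq> ?X \<inter> ball x h" using Y' by auto
    \<comment> \<open>A hollow simplex has \<open>k + 2\<close> points, one more than fit near an
      occupied seam cell.\<close>
    have nl: "grid_cell h x \<notin> layer J z"
    proof
      assume l: "grid_cell h x \<in> layer J z"
      have "card Y \<le> card (?X \<inter> near (grid_cell h x))" using fin Yball ball_near by (intro card_mono) auto
      then show False using seam_card[OF l x(2) refl] Y' by linarith
    qed
    let ?q = "block J z (grid_cell h x)"
    \<comment> \<open>The block holds at most \<open>k + 2\<close> points, hence the hollow simplex
      is the entire content of its block.\<close>
    have "Y \<subseteq> ?X \<inter> B ?q" using Yball ball_B[OF nl] by auto
    moreover have "card (?X \<inter> B ?q) \<le> card Y" using B_card[OF inQ[OF x(2)]] Y' by simp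
    ultimately have "Y = ?X \<inter> B ?q" using fin by (intro card_seteq) auto
    then show "Y \<in> (\<lambda>q. ?X \<inter> B q) ` {q \<in> Q. ?hol (?X \<inter> B q)}"
      using Y inQ[OF x(2)] by (intro image_eqI[of _ _ ?q]) auto
  qed auto
  also have "card \<dots> = card {q \<in> Q. ?hol (?X \<inter> B q)}"
  proof (rule card_image, rule inj_onI)
    fix q q' assume q: "q \<in> {q \<in> Q. ?hol (?X \<inter> B q)}" "q' \<in> {q \<in> Q. ?hol (?X \<inter> B q)}" "?X \<inter> B q = ?X \<inter> B q'"
    then have "card (?X \<inter> B q) = k + 2" by (simp add: hollow_simplex_def)
    then have "?X \<inter> B q \<noteq> {}" by (metis card.empty add_is_0 zero_neq_numeral)
    then obtain x where "x \<in> B q" "x \<in> B q'" using q(3) by blast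
    then show "q = q'" by (simp add: B_def)
  qed
  also have "\<dots> = (\<Sum>q\<in>Q. of_bool (?hol (?X \<inter> B q)))"
    using finQ by (simp add: of_bool_def sum.If_cases Int_def)
  finally show ?thesis .
qed

lemma not_bad_prod:
  assumes \<omega>: "\<omega> \<in> space \<Omega>" "\<omega> \<notin> bad" and fin: "finite (P \<omega>)"
  shows "(\<Prod>q\<in>Q. 1 - \<psi> (P \<omega> \<inter> B q)) = exp (- (\<Sum>i\<in>UNIV. a i * real (betti_number k (cech_complex (P \<omega>) (s * t i)))))"
proof -
  let ?b = "\<lambda>i q. of_bool (hollow_simplex k (s * t i) (P \<omega> \<inter> B q)) :: real"
  have "(\<Sum>i\<in>UNIV. a i * real (betti_number k (cech_complex (P \<omega>) (s * t i)))) = (\<Sum>i\<in>UNIV. \<Sum>q\<in>Q. a i * ?b i q)"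
    unfolding not_bad_betti[OF assms] by (simp add: sum_distrib_left)
  also have "\<dots> = (\<Sum>q\<in>Q. \<Sum>i\<in>UNIV. a i * ?b i q)" by (rule sum.swap)
  finally have "exp (- (\<Sum>i\<in>UNIV. a i * real (betti_number k (cech_complex (P \<omega>) (s * t i))))) =
      (\<Prod>q\<in>Q. exp (- (\<Sum>i\<in>UNIV. a i * ?b i q)))"
    using finQ by (simp add: exp_sum flip: sum_negf)
  then show ?thesis by (simp add: \<psi>_def weight_def)
qed

section \<open>Probability of a block and comparison with the exponential\<close>

definition block_prob :: "int^'d \<Rightarrow> real" where
  "block_prob q = exp (- measure \<mu> (B q)) / fact (k + 2) * tuple_integral q"

lemma tuple_integral_bounds:
  assumes q: "q \<in> Q"
  shows "0 \<le> tuple_integral q" "tuple_integral q \<le> measure \<mu> (B q) ^ (k + 2)"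
proof -
  interpret F: finite_measure "PiM {..<k + 2} (\<lambda>_. \<mu>)" by (rule finite_measure_tuples)
  have ind: "0 \<le> (\<Prod>i<k + 2. indicator (B q) (x i) :: real)" "(\<Prod>i<k + 2. indicator (B q) (x i) :: real) \<le> 1" for x :: "nat \<Rightarrow> real^'d"
    by (auto intro!: prod_nonneg prod_le_1 simp: indicator_def)
  have \<psi>01: "0 \<le> \<psi> X" "\<psi> X \<le> 1" for X using weight_bounds by (auto simp: \<psi>_def)
  show "0 \<le> tuple_integral q"
    unfolding tuple_integral_def using ind(1) \<psi>01(1) by (intro integral_nonneg_AE AE_I2 mult_nonneg_nonneg)
  have Bm: "B q \<in> sets \<mu>" using sets_sets sets_\<mu> by simp
  have meas: "(\<lambda>x. \<Prod>i<k + 2. indicator (B q) (x i) :: real) \<in> borel_measurable (PiM {..<k + 2} (\<lambda>_. \<mu>))"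
  proof (intro borel_measurable_prod)
    fix i assume "i \<in> {..<k + 2}"
    then have "(\<lambda>x. x i) \<in> measurable (PiM {..<k + 2} (\<lambda>_. \<mu>)) \<mu>" by (rule measurable_component_singleton)
    from measurable_compose[OF this borel_measurable_indicator[OF Bm]]
    show "(\<lambda>x. indicator (B q) (x i) :: real) \<in> borel_measurable (PiM {..<k + 2} (\<lambda>_. \<mu>))" .
  qed
  have "tuple_integral q \<le> (\<integral>x. (\<Prod>i<k + 2. indicator (B q) (x i)) \<partial>PiM {..<k + 2} (\<lambda>_. \<mu>))"
    unfolding tuple_integral_def
  proof (rule integral_mono)
    show "integrable (PiM {..<k + 2} (\<lambda>_. \<mu>)) (\<lambda>x. \<Prod>i<k + 2. indicator (B q) (x i) :: real)"
      using ind meas by (intro F.integrable_const_bound[of _ 1] AE_I2) auto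
    show "integrable (PiM {..<k + 2} (\<lambda>_. \<mu>)) (\<lambda>x. \<psi> (x ` {..<k + 2}) * (\<Prod>i<k + 2. indicator (B q) (x i)))"
    proof (rule F.integrable_const_bound[of _ 1])
      show "AE x in PiM {..<k + 2} (\<lambda>_. \<mu>). norm (\<psi> (x ` {..<k + 2}) * (\<Prod>i<k + 2. indicator (B q) (x i))) \<le> 1"
      proof (rule AE_I2)
        fix x :: "nat \<Rightarrow> real^'d"
        have "0 \<le> \<psi> (x ` {..<k + 2}) * (\<Prod>i<k + 2. indicator (B q) (x i))"
          using ind(1) \<psi>01(1) by (rule mult_nonneg_nonneg[rotated])
        moreover have "\<psi> (x ` {..<k + 2}) * (\<Prod>i<k + 2. indicator (B q) (x i)) \<le> 1"
          using ind \<psi>01 by (intro mult_le_one)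
        ultimately show "norm (\<psi> (x ` {..<k + 2}) * (\<Prod>i<k + 2. indicator (B q) (x i))) \<le> 1"
          by (simp only: real_norm_def abs_of_nonneg)
      qed
    qed (rule measurable_tuple_limit[OF q])
    show "\<psi> (x ` {..<k + 2}) * (\<Prod>i<k + 2. indicator (B q) (x i)) \<le> (\<Prod>i<k + 2. indicator (B q) (x i))" for x
      using ind(1)[of x] \<psi>01[of "x ` {..<k + 2}"] by (rule mult_left_le_one_le[OF _ _]) 
  qed
  also have "\<dots> = (\<Prod>i<k + 2. \<integral>x. indicator (B q) x \<partial>\<mu>)"
    using Bm emeasure_\<mu>_finite by (intro tuples.product_integral_prod) (auto simp: integrable_indicator_iff)
  also have "\<dots> = measure \<mu> (B q) ^ (k + 2)" by (simp add: space_\<mu>)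
  finally show "tuple_integral q \<le> measure \<mu> (B q) ^ (k + 2)" .
qed

lemma block_prob_bounds:
  assumes q: "q \<in> Q"
  shows "0 \<le> block_prob q" "block_prob q \<le> 1" "block_prob q \<le> measure \<mu> (B q) ^ (k + 2)"
    "\<bar>block_prob q - tuple_integral q / fact (k + 2)\<bar> \<le> measure \<mu> (B q) ^ (k + 3)"
proof -
  let ?x = "measure \<mu> (B q)"
  note I = tuple_integral_bounds[OF q]
  show "0 \<le> block_prob q" using I by (simp add: block_prob_def)
  have "block_prob q \<le> exp (- ?x) / fact (k + 2) * ?x ^ (k + 2)"
    unfolding block_prob_def using I by (intro mult_left_mono) auto
  \<comment> \<open>The upper bound is the probability that the block contains exactly
    \<open>k + 2\<close> points.\<close>
  also have "\<dots> = pmf (poisson0_pmf ?x) (k + 2)" by (simp add: pmf_poisson0)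
  also have "\<dots> \<le> 1" by (rule pmf_le_1)
  finally show "block_prob q \<le> 1" .
  have f: "(1::real) \<le> fact (k + 2)" by (rule fact_ge_1)
  have If: "tuple_integral q / fact (k + 2) \<le> ?x ^ (k + 2)"
    using I f by (simp add: divide_le_eq) (smt (verit) mult_left_mono mult_cancel_left1 zero_le_power measure_nonneg)
  have bp: "block_prob q = exp (- ?x) * (tuple_integral q / fact (k + 2))" by (simp add: block_prob_def)
  have "block_prob q \<le> 1 * (tuple_integral q / fact (k + 2))"
    unfolding bp using I by (intro mult_right_mono) auto
  then show "block_prob q \<le> ?x ^ (k + 2)" using If by linarith
  \<comment> \<open>Dropping the void probability \<open>exp (- ?x)\<close> costs one further power
    of the mass of the block.\<close>
  have "tuple_integral q / fact (k + 2) - block_prob q = (1 - exp (- ?x)) * (tuple_integral q / fact (k + 2))"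
    unfolding bp by (simp only: left_diff_distrib mult_1_left)
  also have "\<dots> \<le> ?x * ?x ^ (k + 2)"
  proof (rule mult_mono)
    show "1 - exp (- ?x) \<le> ?x" using exp_ge_add_one_self[of "- ?x"] by linarith
  qed (use If I in auto)
  also have "?x * ?x ^ (k + 2) = ?x ^ (k + 3)" by (simp add: eval_nat_numeral)
  finally show "\<bar>block_prob q - tuple_integral q / fact (k + 2)\<bar> \<le> ?x ^ (k + 3)"
    using \<open>block_prob q \<le> 1 * (tuple_integral q / fact (k + 2))\<close> by linarith
qed

text \<open>The terms come from replacing the Betti numbers by block functionals, products of
  \<open>1 - p\<close> by exponentials, block probabilities by tuple integrals, and finally their
  sum by \<open>\<Lambda>\<close>.\<close>

lemma laplace_error:
  assumes Y: "Y \<in> borel_measurable \<Omega>"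
    and Y_eq: "AE \<omega> in \<Omega>. Y \<omega> = exp (- (\<Sum>i\<in>UNIV. a i * real (betti_number k (cech_complex (P \<omega>) (s * t i)))))"
    and \<Lambda>: "0 \<le> \<Lambda>"
  shows "\<bar>expectation Y - exp (- \<Lambda>)\<bar> \<le>
    measure \<mu> outside + real (k + 2) * \<theta> ^ (k + 1) * measure \<mu> seam
    + (2 * \<eta> ^ (k + 2) + \<eta> ^ (k + 2) * \<eta> ^ (k + 1)) * measure \<mu> UNIV
    + \<bar>(\<Sum>q\<in>Q. tuple_integral q) / fact (k + 2) - \<Lambda>\<bar>"
proof -
  let ?T = "measure \<mu> UNIV"
  let ?f = "\<lambda>\<omega>. indicator {\<omega> \<in> space \<Omega>. finite (P \<omega>)} \<omega> * (\<Prod>q\<in>Q. 1 - \<psi> (P \<omega> \<inter> B q))"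
  have f_meas: "?f \<in> borel_measurable \<Omega>" and f_exp: "expectation ?f = (\<Prod>q\<in>Q. 1 - block_prob q)"
    using expectation_prod_blocks by (simp_all add: block_prob_def)
  have \<psi>01: "0 \<le> \<psi> X" "\<psi> X \<le> 1" for X using weight_bounds by (auto simp: \<psi>_def)
  have prod01: "0 \<le> (\<Prod>q\<in>Q. 1 - \<psi> (P \<omega> \<inter> B q))" "(\<Prod>q\<in>Q. 1 - \<psi> (P \<omega> \<inter> B q)) \<le> 1" for \<omega>
    using \<psi>01 by (auto intro!: prod_nonneg prod_le_1)
  have f01: "0 \<le> ?f \<omega>" "?f \<omega> \<le> 1" for \<omega>
    using prod01[of \<omega>] by (auto simp: indicator_def)
  have sum_a: "0 \<le> (\<Sum>i\<in>UNIV. a i * real (b i))" for b using a by (intro sum_nonneg) auto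
  have Y_le: "AE \<omega> in \<Omega>. norm (Y \<omega>) \<le> 1"
    using Y_eq by eventually_elim (simp add: sum_a)
  have int_f: "integrable \<Omega> ?f" by (rule integrable_const_bound[of _ 1]) (use f01 f_meas in auto)
  have int_Y: "integrable \<Omega> Y" by (rule integrable_const_bound[of _ 1]) (use Y Y_le in auto)
  have AE: "AE \<omega> in \<Omega>. \<bar>Y \<omega> - ?f \<omega>\<bar> \<le> indicator bad \<omega>"
    using Y_eq AE_finite AE_space
  proof eventually_elim
    case (elim \<omega>)
    show ?case
    proof (cases "\<omega> \<in> bad")
      case True
      have "0 \<le> Y \<omega>" "Y \<omega> \<le> 1" using elim(1) sum_a by auto
      then show ?thesis using True f01[of \<omega>] by auto
    next
      case False
      then show ?thesis using not_bad_prod[OF elim(3) False elim(2)] elim by simp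
    qed
  qed
  have "\<bar>expectation Y - expectation ?f\<bar> = \<bar>expectation (\<lambda>\<omega>. Y \<omega> - ?f \<omega>)\<bar>"
    using int_f int_Y by simp
  also have "\<dots> \<le> expectation (\<lambda>\<omega>. \<bar>Y \<omega> - ?f \<omega>\<bar>)" by (rule integral_abs_bound)
  also have "\<dots> \<le> expectation (indicator bad)"
    using AE int_f int_Y bad_event
    by (intro integral_mono_AE) (auto intro!: integrable_real_indicator simp: less_top[symmetric])
  also have "\<dots> = prob bad"
    using bad_event sets.sets_into_space[OF bad_event] by (simp add: Int_absorb2)
  finally have 1: "\<bar>expectation Y - (\<Prod>q\<in>Q. 1 - block_prob q)\<bar> \<le> prob bad" unfolding f_exp .
  \<comment> \<open>All factors have absolute value at most 1, so the products differ by at most the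
    sum of the differences of their factors.\<close>
  have "\<bar>(\<Prod>q\<in>Q. 1 - block_prob q) - (\<Prod>q\<in>Q. exp (- block_prob q))\<bar> \<le> (\<Sum>q\<in>Q. \<bar>1 - block_prob q - exp (- block_prob q)\<bar>)"
    using norm_prod_diff[of Q "\<lambda>q. 1 - block_prob q" "\<lambda>q. exp (- block_prob q)"] block_prob_bounds by (simp add: abs_le_iff)
  also have "\<dots> \<le> (\<Sum>q\<in>Q. (block_prob q)\<^sup>2)"
    using block_prob_bounds by (intro sum_mono abs_one_minus_exp_le) auto
  also have "\<dots> \<le> (\<Sum>q\<in>Q. \<eta> ^ (k + 2) * measure \<mu> (B q) ^ Suc (k + 1))"
  proof (intro sum_mono)
    fix q assume q: "q \<in> Q"
    have "block_prob q \<le> \<eta> ^ (k + 2)"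
      using block_prob_bounds(3)[OF q] power_mono[OF measure_B measure_nonneg, of q "k + 2"] by linarith
    then have "block_prob q * block_prob q \<le> \<eta> ^ (k + 2) * measure \<mu> (B q) ^ Suc (k + 1)"
      using block_prob_bounds(1,3)[OF q] \<eta>_nonneg by (intro mult_mono) auto
    then show "(block_prob q)\<^sup>2 \<le> \<eta> ^ (k + 2) * measure \<mu> (B q) ^ Suc (k + 1)" by (simp only: power2_eq_square)
  qed
  also have "\<dots> = \<eta> ^ (k + 2) * (\<Sum>q\<in>Q. measure \<mu> (B q) ^ Suc (k + 1))" by (simp only: sum_distrib_left)
  also have "\<dots> \<le> \<eta> ^ (k + 2) * (\<eta> ^ (k + 1) * ?T)"
    using \<eta>_nonneg by (intro mult_left_mono sum_power_measure_B_le) auto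
  finally have 2: "\<bar>(\<Prod>q\<in>Q. 1 - block_prob q) - exp (- (\<Sum>q\<in>Q. block_prob q))\<bar> \<le> \<eta> ^ (k + 2) * (\<eta> ^ (k + 1) * ?T)"
    using finQ by (simp add: exp_sum flip: sum_negf)
  have 3: "\<bar>exp (- (\<Sum>q\<in>Q. block_prob q)) - exp (- \<Lambda>)\<bar> \<le> \<bar>(\<Sum>q\<in>Q. block_prob q) - \<Lambda>\<bar>"
    using block_prob_bounds(1) \<Lambda> by (intro abs_exp_minus_diff_le sum_nonneg) auto
  have "\<bar>(\<Sum>q\<in>Q. block_prob q) - (\<Sum>q\<in>Q. tuple_integral q) / fact (k + 2)\<bar> = \<bar>\<Sum>q\<in>Q. block_prob q - tuple_integral q / fact (k + 2)\<bar>"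
    by (simp add: sum_subtractf sum_divide_distrib)
  also have "\<dots> \<le> (\<Sum>q\<in>Q. measure \<mu> (B q) ^ Suc (k + 2))"
    using block_prob_bounds(4) by (intro order_trans[OF sum_abs] sum_mono) (simp add: eval_nat_numeral)
  also have "\<dots> \<le> \<eta> ^ (k + 2) * ?T" by (rule sum_power_measure_B_le)
  finally have 4: "\<bar>(\<Sum>q\<in>Q. block_prob q) - (\<Sum>q\<in>Q. tuple_integral q) / fact (k + 2)\<bar> \<le> \<eta> ^ (k + 2) * ?T" .
  \<comment> \<open>The two equal terms stem from crowded blocks and from dropping the void
    probabilities.\<close>
  have 5: "(2 * \<eta> ^ (k + 2) + \<eta> ^ (k + 2) * \<eta> ^ (k + 1)) * ?T =
      \<eta> ^ (k + 2) * ?T + \<eta> ^ (k + 2) * ?T + \<eta> ^ (k + 2) * (\<eta> ^ (k + 1) * ?T)" by (simp add: algebra_simps)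
  show ?thesis unfolding 5 using 1 2 3 4 prob_bad by linarith
qed

end

section \<open>The limiting intensity\<close>

lemma common_ball_similarity:
  fixes \<sigma> :: "'a::real_normed_vector set"
  assumes c: "0 < c"
  shows "common_ball (c * r) ((\<lambda>y. x + c *\<^sub>R y) ` \<sigma>) \<longleftrightarrow> common_ball r \<sigma>"
proof -
  have d: "dist (x + c *\<^sub>R y) (x + c *\<^sub>R p) < c * r \<longleftrightarrow> dist y p < r" for y p
    using c by (simp add: dist_norm flip: scaleR_diff_right)
  have "x + c *\<^sub>R ((1 / c) *\<^sub>R (p - x)) = p" for p using c by simp
  then have "(\<exists>p. \<forall>y\<in>\<sigma>. dist (x + c *\<^sub>R y) p < c * r) \<longleftrightarrow> (\<exists>p. \<forall>y\<in>\<sigma>. dist (x + c *\<^sub>R y) (x + c *\<^sub>R p) < c * r)"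
    by metis
  then show ?thesis unfolding d by (simp add: common_ball_def)
qed

lemma hollow_simplex_similarity:
  fixes Y :: "'a::real_normed_vector set"
  assumes c: "0 < c"
  shows "hollow_simplex k (c * t) ((\<lambda>y. x + c *\<^sub>R y) ` Y) \<longleftrightarrow> hollow_simplex k t Y"
proof -
  let ?f = "\<lambda>y. x + c *\<^sub>R y"
  have inj: "inj_on ?f A" for A using c by (auto simp: inj_on_def)
  have b: "common_ball (c * t / 2) (?f ` \<sigma>) \<longleftrightarrow> common_ball (t / 2) \<sigma>" for \<sigma>
    using common_ball_similarity[OF c, of "t / 2" x \<sigma>] by simp
  have "?f ` Y - {?f y} = ?f ` (Y - {y})" if "y \<in> Y" for y
    using inj_on_image_set_diff[OF inj, of Y Y "{y}"] that c by auto
  then have "(\<forall>y\<in>?f ` Y. common_ball (c * t / 2) (?f ` Y - {y})) \<longleftrightarrow> (\<forall>y\<in>Y. common_ball (t / 2) (Y - {y}))"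
    by (simp add: b)
  then show ?thesis
    unfolding hollow_simplex_def using b[of Y] by (simp add: card_image[OF inj] finite_image_iff[OF inj])
qed

lemma measurable_of_bool:
  assumes "{w \<in> space M. p w} \<in> sets M"
  shows "(\<lambda>w. of_bool (p w) :: real) \<in> borel_measurable M"
  unfolding of_bool_def using assms by (intro measurable_If) auto

text \<open>A finite intersection of open balls is open, so a common centre may be sought in a
  countable dense set.\<close>

lemma sets_common_ball:
  fixes X :: "'i \<Rightarrow> 'w \<Rightarrow> 'a::{metric_space, second_countable_topology}"
  assumes I: "finite I" and X: "\<And>i. i \<in> I \<Longrightarrow> X i \<in> borel_measurable M"
  shows "{w \<in> space M. common_ball r ((\<lambda>i. X i w) ` I)} \<in> sets M"
proof -
  obtain D :: "'a set" where D: "countable D" "\<And>U. open U \<Longrightarrow> U \<noteq> {} \<Longrightarrow> \<exists>d\<in>D. d \<in> U"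
    using countable_dense_exists[where 'a = 'a] by auto
  have eq: "common_ball r ((\<lambda>i. X i w) ` I) \<longleftrightarrow> (\<exists>d\<in>D. \<forall>i\<in>I. dist (X i w) d < r)" for w
  proof
    assume "common_ball r ((\<lambda>i. X i w) ` I)"
    then obtain p where "\<forall>i\<in>I. dist (X i w) p < r" by (auto simp: common_ball_def)
    then have "p \<in> (\<Inter>i\<in>I. ball (X i w) r)" by simp
    moreover have "open (\<Inter>i\<in>I. ball (X i w) r)" using I by (intro open_INT) auto
    ultimately obtain d where "d \<in> D" "d \<in> (\<Inter>i\<in>I. ball (X i w) r)" using D(2) by blast
    then show "\<exists>d\<in>D. \<forall>i\<in>I. dist (X i w) d < r" by auto
  qed (auto simp: common_ball_def)
  have "{w \<in> space M. common_ball r ((\<lambda>i. X i w) ` I)} = (\<Union>d\<in>D. {w \<in> space M. \<forall>i\<in>I. dist (X i w) d < r})"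
    unfolding eq by auto
  also have "\<dots> \<in> sets M"
  proof (rule sets.countable_UN'[OF D(1)], rule image_subsetI)
    fix d
    show "{w \<in> space M. \<forall>i\<in>I. dist (X i w) d < r} \<in> sets M"
    proof (rule sets.sets_Collect_finite_All[OF _ I])
      fix i assume "i \<in> I"
      note [measurable] = X[OF this]
      show "{w \<in> space M. dist (X i w) d < r} \<in> sets M" by measurable
    qed
  qed
  finally show ?thesis .
qed

lemma measurable_cech_h:
  fixes X :: "nat \<Rightarrow> 'w \<Rightarrow> 'a::{metric_space, second_countable_topology}"
  assumes X: "\<And>i. i < k + 2 \<Longrightarrow> X i \<in> borel_measurable M"
  shows "(\<lambda>w. cech_h k t (\<lambda>i. X i w)) \<in> borel_measurable M"
  unfolding cech_h_def Inter_ball_nonempty_iff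
  by (intro borel_measurable_diff borel_measurable_prod measurable_of_bool sets_common_ball X) auto

lemma measurable_cech_h_origin:
  "(\<lambda>y. cech_h k t (case_nat 0 y)) \<in> borel_measurable (lborel_power (k + 1) :: (nat \<Rightarrow> 'a::euclidean_space) measure)"
proof (rule measurable_cech_h)
  fix i assume i: "i < k + 2"
  show "(\<lambda>y. case i of 0 \<Rightarrow> 0 | Suc l \<Rightarrow> y l) \<in> borel_measurable (lborel_power (k + 1) :: (nat \<Rightarrow> 'a) measure)"
  proof (cases i)
    case (Suc l)
    then have "l \<in> {..<k + 1}" using i by simp
    then have "(\<lambda>y. y l) \<in> measurable (lborel_power (k + 1)) (lborel :: 'a measure)" by (rule measurable_component_singleton)
    then show ?thesis using Suc by simp
  qed simp
qed

lemma cech_h_origin_support: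
  assumes "cech_h k t (case_nat (0 :: 'a::real_normed_vector) y) \<noteq> 0" "1 \<le> k" "l < k + 1"
  shows "norm (y l) < t"
proof -
  have hol: "hollow_simplex k t (case_nat 0 y ` {..<k + 2})" using assms(1) by (simp add: cech_h_eq split: if_splits)
  have "case_nat 0 y 0 \<in> case_nat 0 y ` {..<k + 2}" "case_nat 0 y (Suc l) \<in> case_nat 0 y ` {..<k + 2}"
    using assms(3) by (intro imageI; simp)+
  from hollow_simplex_dist[OF hol assms(2) this] show ?thesis by simp
qed

text \<open>The block functional with the first point moved to the origin and the scale removed. It
  links the two sides: \<open>\<psi>_spread\<close> produces it from the process,
  \<open>laplace_functional\<close> from the limiting measure.\<close>

definition Psi :: "nat \<Rightarrow> ('m::finite \<Rightarrow> real) \<Rightarrow> ('m \<Rightarrow> real) \<Rightarrow> (nat \<Rightarrow> 'a::real_normed_vector) \<Rightarrow> real" where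
  "Psi k a t y = 1 - exp (- (\<Sum>i\<in>UNIV. a i * cech_h k (t i) (case_nat 0 y)))"

lemma cech_h_nonneg: "0 \<le> cech_h k t x"
  by (simp add: cech_h_eq)

lemma Psi_bounds:
  assumes "\<And>i. 0 \<le> a i" shows "0 \<le> Psi k a t y" "Psi k a t y \<le> 1"
  using assms by (auto simp: Psi_def intro!: sum_nonneg mult_nonneg_nonneg cech_h_nonneg)

text \<open>The bounded support gives integrability over relative coordinates and keeps the whole
  configuration near its first point.\<close>

lemma Psi_support:
  assumes "Psi k a t y \<noteq> 0" "1 \<le> k" "l < k + 1" "\<And>i. t i \<le> tm"
  shows "norm (y l) < tm"
proof -
  have "\<exists>i. cech_h k (t i) (case_nat 0 y) \<noteq> 0"
  proof (rule ccontr)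
    assume "\<not> ?thesis"
    then have "Psi k a t y = 0" by (simp add: Psi_def)
    with assms(1) show False by simp
  qed
  then obtain i where "cech_h k (t i) (case_nat 0 y) \<noteq> 0" by blast
  from cech_h_origin_support[OF this assms(2,3)] assms(4)[of i] show ?thesis by linarith
qed

lemma measurable_Psi:
  "(Psi k a t :: (nat \<Rightarrow> 'a::euclidean_space) \<Rightarrow> real) \<in> borel_measurable (lborel_power (k + 1))"
proof -
  have [measurable]: "(\<lambda>y :: nat \<Rightarrow> 'a. cech_h k (t i) (case_nat 0 y)) \<in> borel_measurable (lborel_power (k + 1))" for i
    by (rule measurable_cech_h_origin)
  show ?thesis unfolding Psi_def[abs_def] by measurable
qed

lemma emeasure_power_cball:
  "emeasure (lborel_power K) (\<Pi>\<^sub>E l\<in>{..<K}. cball (0 :: 'a::euclidean_space) r) < \<infinity>"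
proof -
  have "emeasure (lborel_power K) (\<Pi>\<^sub>E l\<in>{..<K}. cball (0 :: 'a) r) = (\<Prod>l<K. emeasure lborel (cball (0 :: 'a) r))"
    by (rule lborel_product.emeasure_PiM) auto
  also have "\<dots> < \<infinity>"
    using emeasure_lborel_cball_finite[of "0 :: 'a" r] by (simp add: power_less_top_ennreal)
  finally show ?thesis .
qed

lemma integrable_Psi:
  fixes a t :: "'m::finite \<Rightarrow> real"
  assumes a: "\<And>i. 0 \<le> a i" and k: "1 \<le> k"
  shows "integrable (lborel_power (k + 1)) (Psi k a t :: (nat \<Rightarrow> 'a::euclidean_space) \<Rightarrow> real)"
proof (rule Bochner_Integration.integrable_bound[OF _ measurable_Psi])
  define tm where "tm = Max (range t)"
  let ?S = "\<Pi>\<^sub>E l\<in>{..<k + 1}. cball (0 :: 'a) tm"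
  have tm: "t i \<le> tm" for i by (simp add: tm_def)
  have "?S \<in> sets (lborel_power (k + 1))" by (intro sets_PiM_I_finite) auto
  then show "integrable (lborel_power (k + 1)) (indicator ?S :: _ \<Rightarrow> real)"
    using emeasure_power_cball by (intro integrable_real_indicator) auto
  show "AE y in lborel_power (k + 1). norm (Psi k a t y) \<le> norm (indicator ?S y :: real)"
  proof (rule AE_I2)
    fix y :: "nat \<Rightarrow> 'a" assume y: "y \<in> space (lborel_power (k + 1))"
    show "norm (Psi k a t y) \<le> norm (indicator ?S y :: real)"
    proof (cases "Psi k a t y = 0")
      case False
      have "norm (y l) \<le> tm" if "l < k + 1" for l using Psi_support[OF False k that tm] by simp
      then have "y \<in> ?S" using y by (auto simp: space_PiM PiE_iff)
      then show ?thesis by (simp add: Psi_bounds a)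
    qed simp
  qed
qed

section \<open>Block integrals in relative coordinates\<close>

context cech_process
begin

lemma \<psi>_spread:
  "\<psi> (spread (k + 1) s x ` {..<k + 2}) = Psi k a t (snd x)"
proof -
  have "spread (k + 1) s x ` {..<k + 2} = (\<lambda>w. fst x + s *\<^sub>R w) ` case_nat 0 (snd x) ` {..<k + 2}"
    unfolding image_image spread_def by (rule image_cong) (auto split: nat.split)
  then show ?thesis
    by (simp only: \<psi>_def weight_def Psi_def hollow_simplex_similarity[OF s] cech_h_eq)
qed

text \<open>The indicator that all points of the configuration lie in one common block of
  \<open>Q\<close>.\<close>

definition same_block :: "(real^'d) \<times> (nat \<Rightarrow> real^'d) \<Rightarrow> real" where
  "same_block x = (\<Sum>q\<in>Q. \<Prod>i<k + 2. indicator (B q) (spread (k + 1) s x i))"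

lemma same_block_bounds: "0 \<le> same_block x" "same_block x \<le> 1"
proof -
  show "0 \<le> same_block x" unfolding same_block_def by (intro sum_nonneg prod_nonneg) auto
  \<comment> \<open>Only the factor of the first point is kept; that point lies in one
    block.\<close>
  have "same_block x \<le> (\<Sum>q\<in>Q. indicator (B q) (spread (k + 1) s x 0))"
    unfolding same_block_def
  proof (rule sum_mono)
    fix q
    have "(\<Prod>i<k + 2. indicator (B q) (spread (k + 1) s x i)) =
        (indicator (B q) (spread (k + 1) s x 0) * (\<Prod>i<k + 1. indicator (B q) (spread (k + 1) s x (Suc i))) :: real)"
      using prod.lessThan_Suc_shift[of "\<lambda>i. indicator (B q) (spread (k + 1) s x i) :: real" "k + 1"] by simp
    also have "\<dots> \<le> indicator (B q) (spread (k + 1) s x 0)"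
      by (intro mult_right_le_one_le prod_nonneg prod_le_1) (auto simp: indicator_def)
    finally show "(\<Prod>i<k + 2. indicator (B q) (spread (k + 1) s x i)) \<le> (indicator (B q) (spread (k + 1) s x 0) :: real)" .
  qed
  also have "\<dots> = (\<Sum>q\<in>Q. if q = block J z (grid_cell h (spread (k + 1) s x 0)) then 1 else 0)"
    by (intro sum.cong) (auto simp: B_def indicator_def)
  also have "\<dots> \<le> 1" using finQ by (simp add: sum.delta)
  finally show "same_block x \<le> 1" .
qed

lemma same_block_eq_1:
  assumes x: "fst x \<notin> seam" "fst x \<notin> outside" and near: "\<And>l. l < k + 1 \<Longrightarrow> norm (snd x l) < tm"
  shows "same_block x = 1"
proof -
  let ?q = "block J z (grid_cell h (fst x))"
  have q: "?q \<in> Q" using x by (simp add: outside_def)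
  have blk: "block J z (grid_cell h (spread (k + 1) s x i)) = ?q" if "i < k + 2" for i
  proof (cases i)
    case 0
    then show ?thesis by (simp add: spread_def)
  next
    case (Suc l)
    then have l: "l < k + 1" using that by simp
    have eq: "spread (k + 1) s x i = fst x + s *\<^sub>R snd x l" using Suc l by (simp add: spread_def)
    have "dist (fst x) (fst x + s *\<^sub>R snd x l) = s * norm (snd x l)" using s by (simp add: dist_norm)
    also have "\<dots> < h" using mult_strict_left_mono[OF near[OF l] s] s tm by (simp add: h_def)
    finally have d: "dist (fst x) (fst x + s *\<^sub>R snd x l) < h" .
    show ?thesis unfolding eq
      by (rule block_near[OF J]) (use x grid_cell_near[OF d] in \<open>auto simp: seam_def\<close>)
  qed
  have "same_block x = (\<Sum>q\<in>Q. if q = ?q then 1 else 0)"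
    unfolding same_block_def
  proof (rule sum.cong[OF refl])
    fix q
    have "indicator (B q) (spread (k + 1) s x i) = (if q = ?q then 1 else 0 :: real)" if "i < k + 2" for i
      using blk[OF that] by (auto simp: B_def indicator_def)
    then have "(\<Prod>i<k + 2. indicator (B q) (spread (k + 1) s x i)) = (\<Prod>i<k + 2. if q = ?q then 1 else 0 :: real)"
      by (intro prod.cong) auto
    then show "(\<Prod>i<k + 2. indicator (B q) (spread (k + 1) s x i)) = (if q = ?q then 1 else 0 :: real)"
      by (cases "q = ?q") simp_all
  qed
  also have "\<dots> = 1" using finQ q by (simp add: sum.delta)
  finally show ?thesis .
qed

abbreviation config :: "((real^'d) \<times> (nat \<Rightarrow> real^'d)) measure" where
  "config \<equiv> lborel \<Otimes>\<^sub>M lborel_power (k + 1)"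

lemma measurable_same_block: "same_block \<in> borel_measurable config"
  unfolding same_block_def[abs_def]
proof (intro borel_measurable_sum borel_measurable_prod)
  fix q i assume i: "i \<in> {..<k + 2}"
  have "spread (k + 1) s \<in> measurable config (PiM {..<Suc (k + 1)} (\<lambda>_. borel))" by (rule measurable_spread) simp
  moreover have "(\<lambda>x. x i) \<in> measurable (PiM {..<Suc (k + 1)} (\<lambda>_. borel)) (borel :: (real^'d) measure)"
    using i by (intro measurable_component_singleton) auto
  ultimately have "(\<lambda>x. spread (k + 1) s x i) \<in> measurable config borel" by (rule measurable_compose)
  from measurable_compose[OF this borel_measurable_indicator[OF sets_sets(1)]]
  show "(\<lambda>x. indicator (B q) (spread (k + 1) s x i) :: real) \<in> borel_measurable config" .
qed

lemma sum_tuple_integral: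
  assumes int: "integrable lborel g"
  shows "(\<Sum>q\<in>Q. tuple_integral q) = (\<integral>x. spread_weight (k + 1) s g x * (Psi k a t (snd x) * same_block x) \<partial>config)"
    and "integrable config (\<lambda>x. spread_weight (k + 1) s g x * (Psi k a t (snd x) * same_block x))"
proof -
  let ?F = "\<lambda>q x. \<psi> (x ` {..<k + 2}) * (\<Prod>i<k + 2. indicator (B q) (x i)) :: real"
  let ?N = "PiM {..<Suc (k + 1)} (\<lambda>_. density lborel (\<lambda>x. ennreal (g x)))"
  have k2: "k + 2 = Suc (k + 1)" by simp
  have F: "?F q \<in> borel_measurable ?N" if "q \<in> Q" for q
    using measurable_tuple_limit[OF that] unfolding \<mu>_eq k2 .
  have comp: "?F q (spread (k + 1) s x) = Psi k a t (snd x) * (\<Prod>i<k + 2. indicator (B q) (spread (k + 1) s x i))" for q x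
    by (simp only: \<psi>_spread)
  have eq: "tuple_integral q = (\<integral>x. spread_weight (k + 1) s g x * ?F q (spread (k + 1) s x) \<partial>config)" if "q \<in> Q" for q
  proof -
    have "tuple_integral q = (\<integral>x. ?F q x \<partial>PiM {..<k + 2} (\<lambda>_. \<mu>))" by (simp only: tuple_integral_def)
    also have "\<dots> = (\<integral>x. ?F q x \<partial>?N)" by (simp only: \<mu>_eq k2)
    finally show ?thesis using integral_PiM_density_spread[OF g(1,2) int s F[OF that]] by simp
  qed
  have Psi[measurable]: "(\<lambda>x. Psi k a t (snd x)) \<in> borel_measurable config"
    by (rule measurable_compose[OF measurable_snd measurable_Psi])
  have wt[measurable]: "spread_weight (k + 1) s g \<in> borel_measurable config" by (rule measurable_spread_weight[OF g(1)])
  have G: "0 \<le> G" using g(2,3)[of 0] by linarith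
  interpret pair: pair_sigma_finite "lborel :: (real^'d) measure" "lborel_power (k + 1) :: (nat \<Rightarrow> real^'d) measure"
    by (rule pair_sigma_finite_lborel_power)
  \<comment> \<open>A majorant: the intensity is bounded by \<open>G\<close> at the displaced points
    and kept at the first one, and \<open>Psi\<close> controls the displacements.\<close>
  have dom: "integrable config (\<lambda>x. (s ^ CARD('d) * G) ^ (k + 1) * (g (fst x) * Psi k a t (snd x)))"
    by (intro integrable_mult_right pair.integral_prod_mult(1) int integrable_Psi a k)
  have wt_nn: "0 \<le> spread_weight (k + 1) s g x" for x
    unfolding spread_weight_def using s g(2) by (intro mult_nonneg_nonneg prod_nonneg) auto
  have wt_le: "spread_weight (k + 1) s g x \<le> (s ^ CARD('d) * G) ^ (k + 1) * g (fst x)" for x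
  proof -
    have "(\<Prod>l<k + 1. s ^ DIM(real^'d) * g (fst x + s *\<^sub>R snd x l)) \<le> (\<Prod>l<k + 1. s ^ CARD('d) * G)"
      using s g by (intro prod_mono) (auto intro!: mult_left_mono)
    also have "\<dots> = (s ^ CARD('d) * G) ^ (k + 1)" by simp
    finally show ?thesis
      unfolding spread_weight_def mult.commute[of "(s ^ CARD('d) * G) ^ (k + 1)"] by (rule mult_left_mono[OF _ g(2)])
  qed
  have int_chi: "integrable config (\<lambda>x. spread_weight (k + 1) s g x * (Psi k a t (snd x) * \<xi> x))"
    if \<xi>: "\<xi> \<in> borel_measurable config" "\<And>x. 0 \<le> \<xi> x" "\<And>x. \<xi> x \<le> 1" for \<xi>
  proof (rule Bochner_Integration.integrable_bound[OF dom])
    show "AE x in config. norm (spread_weight (k + 1) s g x * (Psi k a t (snd x) * \<xi> x))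
        \<le> norm ((s ^ CARD('d) * G) ^ (k + 1) * (g (fst x) * Psi k a t (snd x)))"
    proof (rule AE_I2)
      fix x :: "(real^'d) \<times> (nat \<Rightarrow> real^'d)"
      have P: "0 \<le> Psi k a t (snd x)" by (rule Psi_bounds[OF a])
      have "Psi k a t (snd x) * \<xi> x \<le> Psi k a t (snd x)" using P \<xi>(2,3)[of x] by (intro mult_right_le_one_le)
      then have "spread_weight (k + 1) s g x * (Psi k a t (snd x) * \<xi> x) \<le> (s ^ CARD('d) * G) ^ (k + 1) * g (fst x) * Psi k a t (snd x)"
        using wt_nn[of x] wt_le[of x] P \<xi>(2)[of x] s G g(2)[of "fst x"] by (intro mult_mono) auto
      moreover have "0 \<le> spread_weight (k + 1) s g x * (Psi k a t (snd x) * \<xi> x)"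
        using wt_nn[of x] P \<xi>(2)[of x] by simp
      ultimately show "norm (spread_weight (k + 1) s g x * (Psi k a t (snd x) * \<xi> x))
        \<le> norm ((s ^ CARD('d) * G) ^ (k + 1) * (g (fst x) * Psi k a t (snd x)))"
        by (simp add: mult.assoc)
    qed
  qed (use \<xi>(1) in measurable)
  show "integrable config (\<lambda>x. spread_weight (k + 1) s g x * (Psi k a t (snd x) * same_block x))"
    by (rule int_chi[OF measurable_same_block same_block_bounds])
  have spr: "(\<lambda>x. spread (k + 1) s x i) \<in> measurable config borel" if "i < k + 2" for i
  proof -
    have "spread (k + 1) s \<in> measurable config (PiM {..<Suc (k + 1)} (\<lambda>_. borel))" by (rule measurable_spread) simp
    moreover have "(\<lambda>x. x i) \<in> measurable (PiM {..<Suc (k + 1)} (\<lambda>_. borel)) (borel :: (real^'d) measure)"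
      using that by (intro measurable_component_singleton) auto
    ultimately show ?thesis by (rule measurable_compose)
  qed
  have int_q: "integrable config (\<lambda>x. spread_weight (k + 1) s g x * ?F q (spread (k + 1) s x))" for q
    unfolding comp
  proof (rule int_chi)
    show "(\<lambda>x. \<Prod>i<k + 2. indicator (B q) (spread (k + 1) s x i) :: real) \<in> borel_measurable config"
    proof (rule borel_measurable_prod)
      fix i assume "i \<in> {..<k + 2}"
      then have "i < k + 2" by simp
      from measurable_compose[OF spr[OF this] borel_measurable_indicator[OF sets_sets(1)]]
      show "(\<lambda>x. indicator (B q) (spread (k + 1) s x i) :: real) \<in> borel_measurable config" .
    qed
  qed (auto intro!: prod_nonneg prod_le_1 simp: indicator_def)
  have "(\<Sum>q\<in>Q. tuple_integral q) = (\<Sum>q\<in>Q. \<integral>x. spread_weight (k + 1) s g x * ?F q (spread (k + 1) s x) \<partial>config)"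
    by (rule sum.cong[OF refl eq])
  also have "\<dots> = (\<integral>x. (\<Sum>q\<in>Q. spread_weight (k + 1) s g x * ?F q (spread (k + 1) s x)) \<partial>config)"
    by (rule Bochner_Integration.integral_sum[symmetric]) (rule int_q)
  also have "\<dots> = (\<integral>x. spread_weight (k + 1) s g x * (Psi k a t (snd x) * same_block x) \<partial>config)"
    unfolding comp same_block_def by (simp only: sum_distrib_left)
  finally show "(\<Sum>q\<in>Q. tuple_integral q) = (\<integral>x. spread_weight (k + 1) s g x * (Psi k a t (snd x) * same_block x) \<partial>config)" .
qed

end

section \<open>Measurability of the Betti numbers\<close>

text \<open>The event says that every cell of \<open>S\<close> is hit and that the union of all
  remaining cells is empty, which involves counts of Borel sets only. Infinite configurations are
  counted as empty.\<close>

lemma (in poisson_proc) prob_occupied_cells: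
  fixes \<kappa> :: "'b \<Rightarrow> 'c"
  assumes \<kappa>: "\<And>S. \<kappa> -` S \<in> sets borel" and S: "finite S"
  shows "{\<omega> \<in> space \<Omega>. \<kappa> ` (if finite (P \<omega>) then P \<omega> else {}) = S} \<in> events"
proof -
  let ?F = "{\<omega> \<in> space \<Omega>. finite (P \<omega>)}"
  define p where "p \<omega> \<longleftrightarrow> (\<forall>c\<in>S. emeasure (N \<omega>) (\<kappa> -` {c}) \<noteq> 0) \<and> emeasure (N \<omega>) (\<kappa> -` (- S)) = 0" for \<omega>
  have F: "?F \<in> events"
  proof -
    have "?F = {\<omega> \<in> space \<Omega>. emeasure (N \<omega>) UNIV \<noteq> \<infinity>}"
      using N_eq[of UNIV] by auto
    also have "\<dots> \<in> events" by measurable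
    finally show ?thesis .
  qed
  have occ: "\<kappa> ` P \<omega> = S \<longleftrightarrow> p \<omega>"
    if fin: "finite (P \<omega>)" for \<omega>
  proof -
    have "emeasure (N \<omega>) (\<kappa> -` A) = 0 \<longleftrightarrow> P \<omega> \<inter> \<kappa> -` A = {}" for A
      using N_eq[OF \<kappa>, of \<omega> A] fin by simp
    then show ?thesis unfolding p_def by auto
  qed
  have "{\<omega> \<in> space \<Omega>. \<kappa> ` (if finite (P \<omega>) then P \<omega> else {}) = S} =
      {\<omega> \<in> ?F. p \<omega>} \<union> (if S = {} then space \<Omega> - ?F else {})"
    by (auto simp: occ[symmetric])
  also have "\<dots> \<in> events"
  proof (rule sets.Un)
    have [measurable]: "\<kappa> -` A \<in> sets borel" for A by (rule \<kappa>)
    have "{\<omega> \<in> ?F. p \<omega>} = ?F \<inter> ({\<omega> \<in> space \<Omega>. \<forall>c\<in>S. emeasure (N \<omega>) (\<kappa> -` {c}) \<noteq> 0} \<inter> {\<omega> \<in> space \<Omega>. emeasure (N \<omega>) (\<kappa> -` (- S)) = 0})"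
      unfolding p_def by auto
    also have "\<dots> \<in> events"
    proof (intro sets.Int F sets.sets_Collect_finite_All S)
      show "{\<omega> \<in> space \<Omega>. emeasure (N \<omega>) (\<kappa> -` {c}) \<noteq> 0} \<in> events" for c by measurable
      show "{\<omega> \<in> space \<Omega>. emeasure (N \<omega>) (\<kappa> -` (- S)) = 0} \<in> events" by measurable
    qed
    finally show "{\<omega> \<in> ?F. p \<omega>} \<in> events" .
    show "(if S = {} then space \<Omega> - ?F else {}) \<in> events" using F by auto
  qed
  finally show ?thesis .
qed

text \<open>At a fixed mesh the set of occupied cells takes countably many values, so every function
  of it is measurable. The Betti number is the pointwise limit of such functions, as the
  approximations are eventually constant.\<close>

lemma measurable_betti_number:
  fixes P :: "'w \<Rightarrow> (real^'d::finite) set"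
  assumes "poisson_proc \<Omega> \<mu> P"
  shows "(\<lambda>\<omega>. real (betti_number k (cech_complex (if finite (P \<omega>) then P \<omega> else {}) t))) \<in> borel_measurable \<Omega>"
proof -
  interpret poisson_proc \<Omega> \<mu> P by fact
  define X where "X \<omega> = (if finite (P \<omega>) then P \<omega> else {})" for \<omega>
  have fin: "finite (X \<omega>)" for \<omega> by (simp add: X_def)
  define R where "R m x = grid_point (1 / 2 ^ m) (grid_cell (1 / 2 ^ m) x)" for m and x :: "real^'d"
  define \<delta> where "\<delta> m = real CARD('d) * (1 / 2 ^ m)" for m
  interpret approximation R \<delta>
  proof
    show "dist (R m x) x \<le> \<delta> m" for m x unfolding R_def \<delta>_def by (rule dist_grid_point) simp
    have "(\<lambda>m. real CARD('d) * (1 / 2) ^ m) \<longlonglongrightarrow> real CARD('d) * 0"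
      by (intro tendsto_intros LIMSEQ_power_zero) auto
    moreover have "\<delta> = (\<lambda>m. real CARD('d) * (1 / 2) ^ m)" by (simp add: \<delta>_def fun_eq_iff power_divide)
    ultimately show "\<delta> \<longlonglongrightarrow> 0" by simp
  qed
  have meas: "(\<lambda>\<omega>. real (betti_number k (cech_complex (R m ` X \<omega>) (t - 2 * \<delta> m)))) \<in> borel_measurable \<Omega>" for m
  proof -
    let ?occ = "\<lambda>\<omega>. grid_cell (1 / 2 ^ m) ` X \<omega>" and ?A = "{S :: (int^'d) set. finite S \<and> S \<subseteq> UNIV}"
    let ?f = "\<lambda>S. real (betti_number k (cech_complex (grid_point (1 / 2 ^ m) ` S) (t - 2 * \<delta> m)))"
    have "countable ?A" by (rule countable_Collect_finite_subset[OF countable_int_vec])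
    moreover have "?occ -` {S} \<inter> space \<Omega> \<in> events" if "S \<in> ?A" for S
    proof -
      have "?occ -` {S} \<inter> space \<Omega> = {\<omega> \<in> space \<Omega>. grid_cell (1 / 2 ^ m) ` (if finite (P \<omega>) then P \<omega> else {}) = S}"
        by (auto simp: X_def)
      also have "\<dots> \<in> events" using that by (intro prob_occupied_cells grid_cell_vimage) auto
      finally show ?thesis .
    qed
    moreover have "?occ \<in> space \<Omega> \<rightarrow> ?A" using fin by auto
    ultimately have "?occ \<in> measurable \<Omega> (count_space ?A)"
      by (subst measurable_count_space_eq_countable) auto
    from measurable_compose[OF this, of ?f borel]
    have "(\<lambda>\<omega>. ?f (?occ \<omega>)) \<in> borel_measurable \<Omega>" by simp
    then show ?thesis by (simp add: R_def image_image)
  qed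
  have "(\<lambda>m. real (betti_number k (cech_complex (R m ` X \<omega>) (t - 2 * \<delta> m)))) \<longlonglongrightarrow> real (betti_number k (cech_complex (X \<omega>) t))" for \<omega>
    by (rule tendsto_eventually, rule eventually_mono[OF eventually_betti_number[OF fin[of \<omega>], where p = k and t = t]]) simp
  from borel_measurable_LIMSEQ_real[OF this meas] show ?thesis by (simp add: X_def)
qed

text \<open>The first error replaces \<open>f\<close> at the displaced points by \<open>f\<close> at
  the first point. The second arises where the first point lies in the seam or outside
  \<open>Q\<close>; elsewhere \<open>same_block\<close> is 1 on the support of
  \<open>Psi\<close>.\<close>

lemma (in cech_process) sum_tuple_integral_error:
  fixes f :: "real^'d \<Rightarrow> real" and b :: real and n :: nat
  assumes f: "f \<in> borel_measurable borel" "\<And>x. 0 \<le> f x" "\<And>x. f x \<le> b" "integrable lborel f"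
    and n: "1 \<le> n" and g_eq: "g = (\<lambda>x. real n * f x)"
    and scale: "real n ^ (k + 2) * s ^ (CARD('d) * (k + 1)) = 1"
  shows "\<bar>(\<Sum>q\<in>Q. tuple_integral q) - (\<integral>x. f x ^ (k + 2) \<partial>lborel) * (\<integral>y. Psi k a t (y :: nat \<Rightarrow> real^'d) \<partial>lborel_power (k + 1))\<bar> \<le>
    (\<integral>x. f (fst x) * \<bar>(\<Prod>l<k + 1. f (fst x + s *\<^sub>R snd x l)) - f (fst x) ^ (k + 1)\<bar> * Psi k a t (snd x) \<partial>config)
    + b ^ (k + 1) * (\<integral>y. Psi k a t (y :: nat \<Rightarrow> real^'d) \<partial>lborel_power (k + 1)) * ((measure \<mu> seam + measure \<mu> outside) / real n)"
    (is "\<bar>_ - ?lam\<bar> \<le> ?E1 + _ * ?I * _")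
proof -
  note [measurable] = f(1)
  interpret pair: pair_sigma_finite "lborel :: (real^'d) measure" "lborel_power (k + 1) :: (nat \<Rightarrow> real^'d) measure"
    by (rule pair_sigma_finite_lborel_power)
  have b: "0 \<le> b" using f(2,3)[of 0] by linarith
  let ?P = "\<lambda>x :: (real^'d) \<times> (nat \<Rightarrow> real^'d). Psi k a t (snd x)"
  let ?p = "\<lambda>x :: (real^'d) \<times> (nat \<Rightarrow> real^'d). \<Prod>l<k + 1. f (fst x + s *\<^sub>R snd x l)"
  let ?A = "seam \<union> outside"
  have A[measurable]: "?A \<in> sets borel" using sets_sets by auto
  have P01: "0 \<le> ?P x" "?P x \<le> 1" for x by (rule Psi_bounds, rule a)+
  have p01: "0 \<le> ?p x" "?p x \<le> b ^ (k + 1)" for x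
  proof -
    show "0 \<le> ?p x" using f(2) by (intro prod_nonneg) auto
    have "?p x \<le> (\<Prod>l<k + 1. b)" using f(2,3) by (intro prod_mono) auto
    then show "?p x \<le> b ^ (k + 1)" by simp
  qed
  have fp: "0 \<le> f x ^ (k + 1)" "f x ^ (k + 1) \<le> b ^ (k + 1)" for x using f(2,3) by (auto intro: power_mono simp del: power_Suc)
  have g_int: "integrable lborel g" unfolding g_eq using f(4) by simp
  \<comment> \<open>The first point contributes \<open>n\<close> and each of the
    \<open>k + 1\<close> displacements \<open>s ^ d * n\<close>; by \<open>scale\<close> these
    factors multiply to 1.\<close>
  have weight: "spread_weight (k + 1) s g x = f (fst x) * ?p x" for x
  proof -
    have "spread_weight (k + 1) s g x = real n * f (fst x) * (\<Prod>l<k + 1. (s ^ CARD('d) * real n) * f (fst x + s *\<^sub>R snd x l))"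
      unfolding spread_weight_def g_eq by (simp add: mult.assoc)
    also have "\<dots> = real n * f (fst x) * ((s ^ CARD('d) * real n) ^ (k + 1) * ?p x)"
      by (simp only: prod.distrib prod_constant card_lessThan power_mult_distrib)
    also have "\<dots> = ((real n * real n ^ (k + 1)) * (s ^ CARD('d)) ^ (k + 1)) * (f (fst x) * ?p x)"
      by (simp only: power_mult_distrib mult_ac)
    also have "real n * real n ^ (k + 1) = real n ^ (k + 2)" by simp
    also have "(s ^ CARD('d)) ^ (k + 1) = s ^ (CARD('d) * (k + 1))" by (simp only: power_mult)
    finally show ?thesis unfolding scale by simp
  qed
  have Psi_m[measurable]: "?P \<in> borel_measurable config"
    by (rule measurable_compose[OF measurable_snd measurable_Psi])
  have p_m[measurable]: "?p \<in> borel_measurable config"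
  proof (rule borel_measurable_prod)
    fix l assume [measurable]: "l \<in> {..<k + 1}"
    show "(\<lambda>x. f (fst x + s *\<^sub>R snd x l)) \<in> borel_measurable config" by measurable
  qed
  have sb: "(\<Sum>q\<in>Q. tuple_integral q) = (\<integral>x. f (fst x) * ?p x * (?P x * same_block x) \<partial>config)"
    "integrable config (\<lambda>x. f (fst x) * ?p x * (?P x * same_block x))"
    using sum_tuple_integral[OF g_int] unfolding weight .
  have f_pow: "integrable lborel (\<lambda>x. f x ^ (k + 2))"
  proof (rule Bochner_Integration.integrable_bound)
    show "integrable lborel (\<lambda>x. b ^ (k + 1) * f x)" using f(4) by simp
    have "f x ^ (k + 2) \<le> b ^ (k + 1) * f x" for x
      using mult_right_mono[OF fp(2) f(2)] by (simp add: mult.commute mult.left_commute)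
    then show "AE x in lborel. norm (f x ^ (k + 2)) \<le> norm (b ^ (k + 1) * f x)" using f(2) b by simp
  qed measurable
  have IP: "integrable (lborel_power (k + 1)) (Psi k a t :: (nat \<Rightarrow> real^'d) \<Rightarrow> real)" by (rule integrable_Psi[OF a k])
  have lam: "?lam = (\<integral>x. f (fst x) ^ (k + 2) * ?P x \<partial>config)" "integrable config (\<lambda>x. f (fst x) ^ (k + 2) * ?P x)"
    using pair.integral_prod_mult[OF f_pow IP] by simp_all
  have fA: "integrable lborel (\<lambda>x. f x * indicator ?A x)"
    using f(4) by (intro integrable_real_mult_indicator) auto
  have E2: "integrable config (\<lambda>x. b ^ (k + 1) * ((f (fst x) * indicator ?A (fst x)) * ?P x))"
    "(\<integral>x. b ^ (k + 1) * ((f (fst x) * indicator ?A (fst x)) * ?P x) \<partial>config) = b ^ (k + 1) * ((\<integral>x. f x * indicator ?A x \<partial>lborel) * ?I)"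
    using pair.integral_prod_mult[OF fA IP] by simp_all
  have E1: "integrable config (\<lambda>x. f (fst x) * \<bar>?p x - f (fst x) ^ (k + 1)\<bar> * ?P x)"
  proof (rule Bochner_Integration.integrable_bound)
    show "integrable config (\<lambda>x. b ^ (k + 1) * (f (fst x) * ?P x))"
      using pair.integral_prod_mult(1)[OF f(4) IP] by simp
    show "AE x in config. norm (f (fst x) * \<bar>?p x - f (fst x) ^ (k + 1)\<bar> * ?P x) \<le> norm (b ^ (k + 1) * (f (fst x) * ?P x))"
    proof (rule AE_I2)
      fix x :: "(real^'d) \<times> (nat \<Rightarrow> real^'d)"
      have "\<bar>?p x - f (fst x) ^ (k + 1)\<bar> \<le> b ^ (k + 1)" using p01[of x] fp[of "fst x"] by linarith
      then have "\<bar>?p x - f (fst x) ^ (k + 1)\<bar> * (f (fst x) * ?P x) \<le> b ^ (k + 1) * (f (fst x) * ?P x)"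
        using f(2) P01 by (intro mult_right_mono mult_nonneg_nonneg)
      moreover have "norm (f (fst x) * \<bar>?p x - f (fst x) ^ (k + 1)\<bar> * ?P x) = \<bar>?p x - f (fst x) ^ (k + 1)\<bar> * (f (fst x) * ?P x)"
        using f(2)[of "fst x"] P01(1)[of x] by (simp only: real_norm_def abs_mult abs_idempotent abs_of_nonneg mult.assoc mult.left_commute)
      moreover have "norm (b ^ (k + 1) * (f (fst x) * ?P x)) = b ^ (k + 1) * (f (fst x) * ?P x)"
        using f(2)[of "fst x"] P01(1)[of x] b by simp
      ultimately show "norm (f (fst x) * \<bar>?p x - f (fst x) ^ (k + 1)\<bar> * ?P x) \<le> norm (b ^ (k + 1) * (f (fst x) * ?P x))"
        by linarith
    qed
  qed measurable
  have point: "\<bar>f (fst x) * ?p x * (?P x * same_block x) - f (fst x) ^ (k + 2) * ?P x\<bar> \<le>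
      f (fst x) * \<bar>?p x - f (fst x) ^ (k + 1)\<bar> * ?P x + b ^ (k + 1) * ((f (fst x) * indicator ?A (fst x)) * ?P x)" for x
  proof -
    let ?f = "f (fst x)" and ?c = "same_block x"
    \<comment> \<open>The density at the displaced points is exchanged first, and then the condition
      of lying in one block is dropped.\<close>
    have eq: "?f * ?p x * (?P x * ?c) - ?f ^ (k + 2) * ?P x =
        ?f * (?p x - ?f ^ (k + 1)) * ?P x * ?c - ?f ^ (k + 1) * (?f * (1 - ?c) * ?P x)"
      by (simp add: algebra_simps)
    have c: "0 \<le> ?c" "?c \<le> 1" using same_block_bounds by auto
    have "\<bar>?f * (?p x - ?f ^ (k + 1)) * ?P x * ?c\<bar> = (?f * \<bar>?p x - ?f ^ (k + 1)\<bar> * ?P x) * ?c"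
      using f(2)[of "fst x"] P01(1)[of x] c by (simp only: abs_mult abs_of_nonneg)
    also have "\<dots> \<le> ?f * \<bar>?p x - ?f ^ (k + 1)\<bar> * ?P x"
      using f(2)[of "fst x"] P01(1)[of x] c by (intro mult_right_le_one_le mult_nonneg_nonneg) auto
    finally have 1: "\<bar>?f * (?p x - ?f ^ (k + 1)) * ?P x * ?c\<bar> \<le> ?f * \<bar>?p x - ?f ^ (k + 1)\<bar> * ?P x" .
    have le: "(1 - ?c) * ?P x \<le> indicator ?A (fst x) * ?P x"
    proof (cases "fst x \<in> ?A \<or> ?P x = 0")
      case True
      then show ?thesis
      proof
        assume "fst x \<in> ?A"
        then have "indicator ?A (fst x) = (1::real)" by simp
        moreover have "(1 - ?c) * ?P x \<le> 1 * ?P x" using c P01(1) by (intro mult_right_mono) auto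
        ultimately show ?thesis by simp
      qed (simp only: mult_zero_right)
    next
      case False
      have "?c = 1" by (rule same_block_eq_1) (use False Psi_support[of k a t "snd x"] k t_le in auto)
      then show ?thesis using P01(1)[of x] by simp
    qed
    have "\<bar>?f ^ (k + 1) * (?f * (1 - ?c) * ?P x)\<bar> = ?f ^ (k + 1) * (?f * ((1 - ?c) * ?P x))"
      using f(2)[of "fst x"] P01(1)[of x] c fp(1)[of "fst x"]
      by (simp add: mult.assoc)
    also have "\<dots> \<le> b ^ (k + 1) * (?f * (indicator ?A (fst x) * ?P x))"
    proof (rule mult_mono[OF fp(2) mult_left_mono[OF le f(2)]])
      show "0 \<le> b ^ (k + 1)" using b by simp
      show "0 \<le> ?f * ((1 - ?c) * ?P x)" using f(2) P01(1) c by (intro mult_nonneg_nonneg) auto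
    qed
    finally have 2: "\<bar>?f ^ (k + 1) * (?f * (1 - ?c) * ?P x)\<bar> \<le> b ^ (k + 1) * ((?f * indicator ?A (fst x)) * ?P x)"
      by (simp only: mult.assoc)
    show ?thesis unfolding eq using 1 2 by linarith
  qed
  define D where "D x = f (fst x) * ?p x * (?P x * same_block x) - f (fst x) ^ (k + 2) * ?P x" for x
  define E where "E x = f (fst x) * \<bar>?p x - f (fst x) ^ (k + 1)\<bar> * ?P x" for x
  define E' where "E' x = b ^ (k + 1) * ((f (fst x) * indicator ?A (fst x)) * ?P x)" for x
  have D_int: "integrable config D" "(\<integral>x. D x \<partial>config) = (\<Sum>q\<in>Q. tuple_integral q) - ?lam"
    unfolding D_def[abs_def] sb(1) lam(1)
    by (rule Bochner_Integration.integrable_diff[OF sb(2) lam(2)], rule Bochner_Integration.integral_diff[OF sb(2) lam(2)])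
  have E_int: "integrable config E" "(\<integral>x. E x \<partial>config) = ?E1" using E1 by (simp_all only: E_def[abs_def])
  have E'_int: "integrable config E'" "(\<integral>x. E' x \<partial>config) = b ^ (k + 1) * ((\<integral>x. f x * indicator ?A x \<partial>lborel) * ?I)"
    using E2 by (simp_all only: E'_def[abs_def])
  have DE: "\<bar>D x\<bar> \<le> E x + E' x" for x using point[of x] by (simp only: D_def E_def E'_def)
  have "\<bar>(\<Sum>q\<in>Q. tuple_integral q) - ?lam\<bar> = \<bar>\<integral>x. D x \<partial>config\<bar>" by (simp only: D_int(2))
  also have "\<dots> \<le> (\<integral>x. \<bar>D x\<bar> \<partial>config)" by (rule integral_abs_bound)
  also have "\<dots> \<le> (\<integral>x. E x + E' x \<partial>config)"
    by (rule integral_mono[OF integrable_abs[OF D_int(1)] Bochner_Integration.integrable_add[OF E_int(1) E'_int(1)] DE])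
  also have "\<dots> = ?E1 + b ^ (k + 1) * ((\<integral>x. f x * indicator ?A x \<partial>lborel) * ?I)"
    unfolding Bochner_Integration.integral_add[OF E_int(1) E'_int(1)] E_int(2) E'_int(2) ..
  finally have main: "\<bar>(\<Sum>q\<in>Q. tuple_integral q) - ?lam\<bar> \<le> ?E1 + b ^ (k + 1) * ((\<integral>x. f x * indicator ?A x \<partial>lborel) * ?I)" .
  \<comment> \<open>The intensity is \<open>n * f\<close>, which explains the division by
    \<open>n\<close> in the bound.\<close>
  have "measure \<mu> ?A = real n * (\<integral>x. f x * indicator ?A x \<partial>lborel)"
  proof -
    have "emeasure \<mu> ?A = (\<integral>\<^sup>+ x. ennreal (real n * (f x * indicator ?A x)) \<partial>lborel)"
      unfolding \<mu>_eq g_eq using A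
      by (subst emeasure_density) (auto intro!: nn_integral_cong simp: indicator_def)
    also have "\<dots> = ennreal (\<integral>x. real n * (f x * indicator ?A x) \<partial>lborel)"
      using fA f(2) by (intro nn_integral_eq_integral) auto
    finally have "measure \<mu> ?A = (\<integral>x. real n * (f x * indicator ?A x) \<partial>lborel)"
      using f(2) by (intro measure_eq_emeasure_eq_ennreal integral_nonneg_AE) auto
    then show ?thesis by simp
  qed
  moreover have "measure \<mu> ?A \<le> measure \<mu> seam + measure \<mu> outside"
    using sets_sets sets_\<mu> by (intro measure_Un_le) auto
  ultimately have "(\<integral>x. f x * indicator ?A x \<partial>lborel) \<le> (measure \<mu> seam + measure \<mu> outside) / real n"
    using n by (simp add: pos_le_divide_eq mult.commute)
  moreover have "0 \<le> ?I" by (intro integral_nonneg_AE AE_I2 Psi_bounds a)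
  ultimately have "b ^ (k + 1) * ((\<integral>x. f x * indicator ?A x \<partial>lborel) * ?I) \<le> b ^ (k + 1) * (((measure \<mu> seam + measure \<mu> outside) / real n) * ?I)"
    using b by (intro mult_left_mono mult_right_mono) auto
  then show ?thesis using main by (simp only: mult.assoc mult.commute[of ?I])
qed

section \<open>Vanishing errors\<close>

lemma (in pair_sigma_finite) AE_fst:
  assumes "AE x in M1. p x" shows "AE z in M1 \<Otimes>\<^sub>M M2. p (fst z)"
proof -
  from assms obtain A where A: "{x \<in> space M1. \<not> p x} \<subseteq> A" "A \<in> sets M1" "emeasure M1 A = 0"
    by (rule AE_E)
  show ?thesis
  proof (rule AE_I)
    show "{z \<in> space (M1 \<Otimes>\<^sub>M M2). \<not> p (fst z)} \<subseteq> A \<times> space M2"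
      using A(1) by (auto simp: space_pair_measure)
    show "emeasure (M1 \<Otimes>\<^sub>M M2) (A \<times> space M2) = 0"
      using A by (subst M2.emeasure_pair_measure_Times) auto
    show "A \<times> space M2 \<in> sets (M1 \<Otimes>\<^sub>M M2)" using A(2) by auto
  qed
qed

text \<open>For fixed relative coordinates the displaced points converge to the first one, so
  continuity of \<open>f\<close> at that point is enough; the bound \<open>b\<close> provides the
  majorant.\<close>

lemma local_average_error:
  fixes f :: "'a::euclidean_space \<Rightarrow> real" and s :: "nat \<Rightarrow> real" and w :: "(nat \<Rightarrow> 'a) \<Rightarrow> real"
  assumes f: "f \<in> borel_measurable borel" "\<And>x. 0 \<le> f x" "\<And>x. f x \<le> b" "integrable lborel f" "AE x in lborel. isCont f x"
    and w: "integrable (lborel_power K) w" "\<And>y. 0 \<le> w y" and s: "s \<longlonglongrightarrow> 0"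
  shows "(\<lambda>n. \<integral>x. f (fst x) * \<bar>(\<Prod>l<K. f (fst x + s n *\<^sub>R snd x l)) - f (fst x) ^ K\<bar> * w (snd x) \<partial>(lborel \<Otimes>\<^sub>M lborel_power K)) \<longlonglongrightarrow> 0"
proof -
  note [measurable] = f(1)
  let ?M = "lborel \<Otimes>\<^sub>M lborel_power K :: ('a \<times> (nat \<Rightarrow> 'a)) measure"
  interpret pair: pair_sigma_finite "lborel :: 'a measure" "lborel_power K :: (nat \<Rightarrow> 'a) measure"
    by (rule pair_sigma_finite_lborel_power)
  let ?F = "\<lambda>n x. f (fst x) * \<bar>(\<Prod>l<K. f (fst x + s n *\<^sub>R snd x l)) - f (fst x) ^ K\<bar> * w (snd x)"
  have b: "0 \<le> b" using f(2,3)[of 0] by linarith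
  have [measurable]: "w \<in> borel_measurable (lborel_power K)" using w(1) by auto
  have p_m[measurable]: "(\<lambda>x. \<Prod>l<K. f (fst x + c *\<^sub>R snd x l)) \<in> borel_measurable ?M" for c
  proof (rule borel_measurable_prod)
    fix l assume [measurable]: "l \<in> {..<K}"
    show "(\<lambda>x. f (fst x + c *\<^sub>R snd x l)) \<in> borel_measurable ?M" by measurable
  qed
  have "(\<lambda>n. \<integral>x. ?F n x \<partial>?M) \<longlonglongrightarrow> (\<integral>x. 0 \<partial>?M)"
  proof (rule integral_dominated_convergence)
    show "integrable ?M (\<lambda>x. b ^ K * (f (fst x) * w (snd x)))"
      using pair.integral_prod_mult(1)[OF f(4) w(1)] by simp
    show "AE x in ?M. (\<lambda>n. ?F n x) \<longlonglongrightarrow> 0"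
      using pair.AE_fst[OF f(5)]
    proof eventually_elim
      case (elim x)
      have "(\<lambda>n. f (fst x + s n *\<^sub>R snd x l)) \<longlonglongrightarrow> f (fst x)" for l
      proof (rule isCont_tendsto_compose[OF elim])
        have "(\<lambda>n. fst x + s n *\<^sub>R snd x l) \<longlonglongrightarrow> fst x + 0 *\<^sub>R snd x l" by (intro tendsto_intros s)
        then show "(\<lambda>n. fst x + s n *\<^sub>R snd x l) \<longlonglongrightarrow> fst x" by simp
      qed
      then have "(\<lambda>n. ?F n x) \<longlonglongrightarrow> f (fst x) * \<bar>(\<Prod>l<K. f (fst x)) - f (fst x) ^ K\<bar> * w (snd x)"
        by (intro tendsto_intros)
      then show ?case by simp
    qed
    show "AE x in ?M. norm (?F n x) \<le> b ^ K * (f (fst x) * w (snd x))" for n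
    proof (rule AE_I2)
      fix x :: "'a \<times> (nat \<Rightarrow> 'a)"
      have "0 \<le> (\<Prod>l<K. f (fst x + s n *\<^sub>R snd x l))" using f(2) by (intro prod_nonneg) auto
      moreover have "(\<Prod>l<K. f (fst x + s n *\<^sub>R snd x l)) \<le> (\<Prod>l<K. b)" using f(2,3) by (intro prod_mono) auto
      moreover have "0 \<le> f (fst x) ^ K" "f (fst x) ^ K \<le> b ^ K" using f(2,3) by (auto intro: power_mono)
      ultimately have "\<bar>(\<Prod>l<K. f (fst x + s n *\<^sub>R snd x l)) - f (fst x) ^ K\<bar> \<le> b ^ K" by simp
      then have "\<bar>(\<Prod>l<K. f (fst x + s n *\<^sub>R snd x l)) - f (fst x) ^ K\<bar> * (f (fst x) * w (snd x)) \<le> b ^ K * (f (fst x) * w (snd x))"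
        using f(2) w(2) by (intro mult_right_mono mult_nonneg_nonneg)
      moreover have "norm (?F n x) = \<bar>(\<Prod>l<K. f (fst x + s n *\<^sub>R snd x l)) - f (fst x) ^ K\<bar> * (f (fst x) * w (snd x))"
        using f(2)[of "fst x"] w(2)[of "snd x"] by (simp add: abs_mult)
      ultimately show "norm (?F n x) \<le> b ^ K * (f (fst x) * w (snd x))" by linarith
    qed
  qed measurable
  then show ?thesis by simp
qed

text \<open>If every layer were too heavy, the masses over the \<open>J\<close> shifts would sum to
  more than \<open>2 * d\<close>, against \<open>layer_shifts\<close>.\<close>

lemma choose_shift:
  fixes \<nu> :: "(real^'d::finite) measure"
  assumes "prob_space \<nu>" and sets: "sets \<nu> = sets borel" and J: "1 \<le> J"
  shows "\<exists>z. measure \<nu> {x. grid_cell h x \<in> layer J z} \<le> 2 * real CARD('d) / real_of_int J"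
proof (rule ccontr)
  interpret prob_space \<nu> by fact
  let ?L = "\<lambda>z. {x. grid_cell h x \<in> layer J z}"
  have L: "?L z \<in> events" for z unfolding sets by (rule grid_cell_Collect)
  have spc: "space \<nu> = UNIV" using sets_eq_imp_space_eq[OF sets] by simp
  assume "\<not> ?thesis"
  then have gt: "2 * real CARD('d) / real_of_int J < prob (?L z)" for z by (simp add: not_le)
  have "2 * real CARD('d) = (\<Sum>z\<in>{0..<J}. 2 * real CARD('d) / real_of_int J)" using J by simp
  also have "\<dots> < (\<Sum>z\<in>{0..<J}. prob (?L z))"
    using J by (intro sum_strict_mono gt) auto
  also have "\<dots> = expectation (\<lambda>x. \<Sum>z\<in>{0..<J}. indicator (?L z) x)"
    using L by (subst Bochner_Integration.integral_sum) (auto simp: spc intro!: integrable_real_indicator simp: less_top[symmetric])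
  also have "\<dots> \<le> expectation (\<lambda>x. 2 * real CARD('d))"
  proof (rule integral_mono)
    show "integrable \<nu> (\<lambda>x. \<Sum>z\<in>{0..<J}. indicator (?L z) x :: real)"
      using L by (intro Bochner_Integration.integrable_sum integrable_real_indicator) (auto simp: less_top[symmetric])
    show "(\<Sum>z\<in>{0..<J}. indicator (?L z) x) \<le> 2 * real CARD('d)" for x :: "real^'d"
      using layer_shifts[OF J, of "grid_cell h x"] by (simp add: indicator_def)
  qed simp
  also have "\<dots> = 2 * real CARD('d)" using prob_space by (simp add: spc)
  finally show False by simp
qed

text \<open>The complements of growing cubes of blocks decrease to the empty set, so their mass
  tends to 0.\<close>

lemma choose_blocks:
  fixes \<nu> :: "(real^'d::finite) measure"
  assumes "prob_space \<nu>" and sets: "sets \<nu> = sets borel" and e: "0 < e"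
  shows "\<exists>Q. finite Q \<and> measure \<nu> {x. block J z (grid_cell h x) \<notin> Q} < e"
proof -
  interpret prob_space \<nu> by fact
  define Q where "Q m = {q :: int^'d. \<forall>i. q $ i \<in> {- int m..int m}}" for m
  let ?D = "\<lambda>m. {x. block J z (grid_cell h x) \<notin> Q m}"
  have fin: "finite (Q m)" for m unfolding Q_def by (rule finite_vec_Collect) simp
  have D: "?D m \<in> events" for m unfolding sets by (rule grid_cell_Collect)
  have mono: "Q m \<subseteq> Q (Suc m)" for m
  proof
    fix q assume q: "q \<in> Q m"
    have "q $ i \<in> {- int (Suc m)..int (Suc m)}" for i
    proof -
      have "q $ i \<in> {- int m..int m}" using q by (simp add: Q_def)
      then show ?thesis by simp
    qed
    then have "\<forall>i. q $ i \<in> {- int (Suc m)..int (Suc m)}" by (rule allI)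
    then show "q \<in> Q (Suc m)" unfolding Q_def by (rule CollectI)
  qed
  have "(\<lambda>m. prob (?D m)) \<longlonglongrightarrow> prob (\<Inter>m. ?D m)"
  proof (rule finite_Lim_measure_decseq)
    show "range ?D \<subseteq> events" using D by auto
    show "decseq ?D" by (rule decseq_SucI) (use mono in auto)
  qed
  moreover have "(\<Inter>m. ?D m) = {}"
  proof -
    have "q \<in> Q (nat (Max (range (\<lambda>i. \<bar>q $ i\<bar>))))" for q :: "int^'d"
    proof -
      have "\<bar>q $ i\<bar> \<le> Max (range (\<lambda>i. \<bar>q $ i\<bar>))" for i by (rule Max_ge) auto
      then have "q $ i \<in> {- int (nat (Max (range (\<lambda>i. \<bar>q $ i\<bar>))))..int (nat (Max (range (\<lambda>i. \<bar>q $ i\<bar>))))}" for i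
        by (smt (verit) atLeastAtMost_iff int_nat_eq)
      then show ?thesis unfolding Q_def by (intro CollectI allI)
    qed
    then show ?thesis by blast
  qed
  ultimately have "(\<lambda>m. prob (?D m)) \<longlonglongrightarrow> 0" by simp
  then have "\<forall>\<^sub>F m in sequentially. prob (?D m) < e" using e by (intro order_tendstoD)
  then obtain m where "prob (?D m) < e" by (auto simp: eventually_sequentially)
  then show ?thesis using fin by blast
qed

lemma tendsto_zero_powerD:
  fixes x :: "nat \<Rightarrow> real"
  assumes x: "\<forall>\<^sub>F n in sequentially. 0 \<le> x n" and p: "0 < p" and lim: "(\<lambda>n. x n ^ p) \<longlonglongrightarrow> 0"
  shows "x \<longlonglongrightarrow> 0"
proof -
  have "(\<lambda>n. root p (x n ^ p)) \<longlonglongrightarrow> root p 0" by (intro tendsto_real_root lim)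
  moreover have "\<forall>\<^sub>F n in sequentially. root p (x n ^ p) = x n"
    using x by eventually_elim (simp add: real_root_power_cancel p)
  ultimately show ?thesis using Lim_transform_eventually by force
qed

section \<open>Convergence of the Laplace transforms\<close>

lemma laplace_betti_limit:
  fixes f :: "real^'d::finite \<Rightarrow> real" and s :: "nat \<Rightarrow> real" and \<Omega> :: "nat \<Rightarrow> 'w measure"
    and P :: "nat \<Rightarrow> 'w \<Rightarrow> (real^'d) set" and t a :: "'m::finite \<Rightarrow> real" and Y :: "nat \<Rightarrow> 'w \<Rightarrow> real"
  assumes k: "1 \<le> k" and f: "f \<in> borel_measurable borel" "\<And>x. 0 \<le> f x" "\<And>x. f x \<le> b"
    and density: "prob_space (density lborel (\<lambda>x. ennreal (f x)))" and cont: "AE x in lborel. isCont f x"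
    and s: "\<And>n. 1 \<le> n \<Longrightarrow> 0 < s n" and rho: "\<And>n. 1 \<le> n \<Longrightarrow> real n ^ (k + 2) * s n ^ (CARD('d) * (k + 1)) = 1"
    and P: "\<And>n. 1 \<le> n \<Longrightarrow> poisson_process (\<Omega> n) (P n) (density lborel (\<lambda>x. ennreal (real n * f x)))"
    and t: "\<And>i. 0 < t i" and a: "\<And>i. 0 \<le> a i"
    and Y: "\<And>n. 1 \<le> n \<Longrightarrow> Y n \<in> borel_measurable (\<Omega> n)"
      "\<And>n. 1 \<le> n \<Longrightarrow> AE \<omega> in \<Omega> n. Y n \<omega> = exp (- (\<Sum>i\<in>UNIV. a i * real (betti_number k (cech_complex (P n \<omega>) (s n * t i)))))"
  shows "(\<lambda>n. \<integral>\<omega>. Y n \<omega> \<partial>\<Omega> n) \<longlonglongrightarrow>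
    exp (- ((\<integral>x. f x ^ (k + 2) \<partial>lborel) * (\<integral>y. Psi k a t (y :: nat \<Rightarrow> real^'d) \<partial>lborel_power (k + 1)) / fact (k + 2)))"
proof -
  let ?d = "CARD('d)" and ?\<nu> = "density lborel (\<lambda>x. ennreal (f x))"
  define tm where "tm = Max (range t)"
  define IP where "IP = (\<integral>y. Psi k a t (y :: nat \<Rightarrow> real^'d) \<partial>lborel_power (k + 1))"
  define \<Lambda> where "\<Lambda> = (\<integral>x. f x ^ (k + 2) \<partial>lborel) * IP / fact (k + 2)"
  \<comment> \<open>The order of the mass of a cell; the hypothesis \<open>rho\<close> becomes
    \<open>n * u n ^ (k + 1) = 1\<close>.\<close>
  define u where "u n = real n * s n ^ ?d" for n
  define E1 where "E1 n = (\<integral>x. f (fst x) * \<bar>(\<Prod>l<k + 1. f (fst x + s n *\<^sub>R snd x l)) - f (fst x) ^ (k + 1)\<bar> * Psi k a t (snd x) \<partial>(lborel \<Otimes>\<^sub>M lborel_power (k + 1)))" for n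
  define c where "c J = b * (2 * real J * tm) ^ ?d" for J
  define c3 where "c3 = b * (6 * tm) ^ ?d"
  \<comment> \<open>Both summands come from the seam: simplices crossing it in \<open>bad\<close>,
    and first points inside it in the tuple integrals.\<close>
  define c0 where "c0 = real (k + 2) * c3 ^ (k + 1) * (2 * real ?d) + b ^ (k + 1) * IP * (2 * real ?d)"
  \<comment> \<open>All errors that vanish with \<open>n\<close> for fixed \<open>J\<close>.\<close>
  define r where "r J n = 1 / real n + (2 * (c J * u n) * c J ^ (k + 1) + (c J * u n) ^ (k + 2) * c J ^ (k + 1)) + (E1 n + b ^ (k + 1) * IP * (1 / real n))" for J n
  interpret \<nu>: prob_space ?\<nu> by (rule density)
  have \<nu>1: "emeasure ?\<nu> UNIV = 1" using \<nu>.emeasure_space_1 by simp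
  have tm: "t i \<le> tm" for i by (simp add: tm_def)
  then have tm_pos: "0 < tm" using t by (meson less_le_trans)
  have b: "0 \<le> b" using f(2,3)[of 0] by linarith
  have IP: "0 \<le> IP" unfolding IP_def by (intro integral_nonneg_AE AE_I2 Psi_bounds a)
  have \<Lambda>: "0 \<le> \<Lambda>" unfolding \<Lambda>_def using IP f(2) by (intro divide_nonneg_pos mult_nonneg_nonneg integral_nonneg_AE) auto
  have f_int: "integrable lborel f"
  proof (rule integrableI_nonneg)
    have "(\<integral>\<^sup>+ x. ennreal (f x) \<partial>lborel) = emeasure ?\<nu> UNIV"
      using f(1) by (simp add: emeasure_density)
    then show "(\<integral>\<^sup>+ x. ennreal (f x) \<partial>lborel) < \<infinity>" by (simp add: \<nu>1)
  qed (use f in auto)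
  have u_pow: "real n * u n ^ (k + 1) = 1" if n: "1 \<le> n" for n
  proof -
    have "real n * u n ^ (k + 1) = (real n * real n ^ (k + 1)) * (s n ^ ?d) ^ (k + 1)"
      unfolding u_def by (simp only: power_mult_distrib mult_ac)
    also have "real n * real n ^ (k + 1) = real n ^ (k + 2)" by simp
    also have "(s n ^ ?d) ^ (k + 1) = s n ^ (?d * (k + 1))" by (simp only: power_mult)
    finally show ?thesis unfolding rho[OF n] .
  qed
  have u_lim: "u \<longlonglongrightarrow> 0"
  proof (rule tendsto_zero_powerD)
    show "\<forall>\<^sub>F n in sequentially. 0 \<le> u n"
      using eventually_ge_at_top[of 1] by eventually_elim (use s in \<open>auto simp: u_def less_imp_le\<close>)
    have "\<forall>\<^sub>F n in sequentially. inverse (real n) = u n ^ (k + 1)"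
      using eventually_ge_at_top[of 1]
    proof eventually_elim
      case (elim n)
      then show ?case using u_pow[OF elim] by (intro inverse_unique) simp
    qed
    with lim_inverse_n show "(\<lambda>n. u n ^ (k + 1)) \<longlonglongrightarrow> 0" by (rule Lim_transform_eventually)
  qed simp
  have s_lim: "s \<longlonglongrightarrow> 0"
  proof (rule tendsto_zero_powerD)
    show "\<forall>\<^sub>F n in sequentially. 0 \<le> s n"
      using eventually_ge_at_top[of 1] by eventually_elim (use s in \<open>auto simp: less_imp_le\<close>)
    have "(\<lambda>n. inverse (real n) * u n) \<longlonglongrightarrow> 0 * 0" by (intro tendsto_mult lim_inverse_n u_lim)
    moreover have "\<forall>\<^sub>F n in sequentially. inverse (real n) * u n = s n ^ ?d"
      using eventually_ge_at_top[of 1] by eventually_elim (simp add: u_def)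
    ultimately show "(\<lambda>n. s n ^ ?d) \<longlonglongrightarrow> 0" using Lim_transform_eventually by force
  qed simp
  have E1_lim: "E1 \<longlonglongrightarrow> 0"
    unfolding E1_def
    by (rule local_average_error[OF f f_int cont integrable_Psi[OF a k] Psi_bounds(1)[OF a] s_lim])
  have r_lim: "r J \<longlonglongrightarrow> 0" for J
  proof -
    have inv: "(\<lambda>n. 1 / real n) \<longlonglongrightarrow> 0" using lim_inverse_n by (simp add: divide_inverse)
    have "r J \<longlonglongrightarrow> 0 + (2 * (c J * 0) * c J ^ (k + 1) + (c J * 0) ^ (k + 2) * c J ^ (k + 1)) + (0 + b ^ (k + 1) * IP * 0)"
      unfolding r_def[abs_def] by (intro tendsto_intros inv u_lim E1_lim)
    then show ?thesis by simp
  qed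
  have meas_n: "measure (density lborel (\<lambda>x. ennreal (real n * f x))) A = real n * measure ?\<nu> A"
    if "A \<in> sets borel" for A :: "(real^'d) set" and n
  proof -
    have "emeasure (density lborel (\<lambda>x. ennreal (real n * f x))) A = ennreal (real n) * emeasure ?\<nu> A"
      using f(1) that by (simp add: emeasure_density ennreal_mult' mult.assoc nn_integral_cmult)
    then show ?thesis by (simp add: measure_def enn2real_mult)
  qed
  have key: "\<bar>(\<integral>\<omega>. Y n \<omega> \<partial>\<Omega> n) - exp (- \<Lambda>)\<bar> \<le> c0 / real J + r J n" if n: "1 \<le> n" and J: "1 \<le> J" for n J
  proof -
    let ?\<mu> = "density lborel (\<lambda>x. ennreal (real n * f x))" and ?h = "2 * s n * tm"
    obtain z where z: "measure ?\<nu> {x. grid_cell ?h x \<in> layer (int J) z} \<le> 2 * real ?d / real J"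
      using choose_shift[OF density, of "int J" ?h] J by auto
    \<comment> \<open>One factor \<open>1 / n\<close> compensates the intensity
      \<open>n * f\<close>, the other makes the mass outside the blocks vanish.\<close>
    obtain Q where Q: "finite Q" "measure ?\<nu> {x. block (int J) z (grid_cell ?h x) \<notin> Q} < 1 / (real n * real n)"
      using choose_blocks[OF density, of "1 / (real n * real n)" "int J" z ?h] n by auto
    have "prob_space (\<Omega> n)" using P[OF n] by (simp add: poisson_process_def poisson_random_measure_def)
    then interpret \<Omega>: prob_space "\<Omega> n" .
    have "emeasure ?\<mu> (space ?\<mu>) = ennreal (real n) * emeasure ?\<nu> UNIV"
      using f(1) by (simp add: emeasure_density ennreal_mult' nn_integral_cmult)
    then have fin: "emeasure ?\<mu> (space ?\<mu>) \<noteq> \<infinity>" by (simp add: \<nu>1)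
    interpret M: finite_measure ?\<mu> by (rule finite_measureI[OF fin])
    interpret C: cech_process "\<Omega> n" ?\<mu> "P n" k "s n" t tm "\<lambda>x. real n * f x" "real n * b" a "int J" z Q
      by unfold_locales (use P[OF n] k s[OF n] tm_pos tm f a J Q(1) in \<open>auto intro!: mult_left_mono\<close>)
    have h: "C.h = ?h" by (simp add: C.h_def)
    have seam_eq: "C.seam = {x. grid_cell ?h x \<in> layer (int J) z}" by (simp add: C.seam_def h)
    have seam: "measure ?\<mu> C.seam \<le> real n * (2 * real ?d / real J)"
      unfolding meas_n[OF C.sets_sets(3)] using mult_left_mono[OF z, of "real n"] by (simp add: seam_eq)
    have out: "measure ?\<mu> C.outside \<le> 1 / real n"
    proof -
      have "measure ?\<mu> C.outside = real n * measure ?\<nu> C.outside" by (rule meas_n[OF C.sets_sets(2)])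
      also have "\<dots> \<le> real n * (1 / (real n * real n))"
        using Q(2) by (intro mult_left_mono) (auto simp: C.outside_def h)
      finally show ?thesis using n by simp
    qed
    have T: "measure ?\<mu> UNIV = real n" using meas_n[of UNIV n] \<nu>.prob_space by simp
    have \<eta>: "C.\<eta> = c J * u n"
      unfolding C.\<eta>_def h c_def u_def by (simp add: power_mult_distrib mult_ac)
    have \<theta>: "C.\<theta> = c3 * u n"
    proof -
      have "3 * ?h = (6 * tm) * s n" by simp
      then show ?thesis unfolding C.\<theta>_def h c3_def u_def by (simp only: power_mult_distrib mult_ac)
    qed
    have c3: "0 \<le> c3" using b tm_pos by (simp add: c3_def)
    have u_nn: "0 \<le> u n" using s[OF n] by (simp add: u_def)
    have "real (k + 2) * C.\<theta> ^ (k + 1) * measure ?\<mu> C.seam \<le> real (k + 2) * C.\<theta> ^ (k + 1) * (real n * (2 * real ?d / real J))"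
      using seam C.\<theta>_nonneg by (intro mult_left_mono) auto
    also have "\<dots> = real (k + 2) * c3 ^ (k + 1) * (real n * u n ^ (k + 1)) * (2 * real ?d / real J)"
      unfolding \<theta> by (simp only: power_mult_distrib mult_ac)
    finally have 1: "real (k + 2) * C.\<theta> ^ (k + 1) * measure ?\<mu> C.seam \<le> real (k + 2) * c3 ^ (k + 1) * (2 * real ?d / real J)"
      unfolding u_pow[OF n] by simp
    have 2: "(2 * C.\<eta> ^ (k + 2) + C.\<eta> ^ (k + 2) * C.\<eta> ^ (k + 1)) * measure ?\<mu> UNIV
        = 2 * (c J * u n) * c J ^ (k + 1) + (c J * u n) ^ (k + 2) * c J ^ (k + 1)"
    proof -
      \<comment> \<open>The total mass is \<open>n\<close>, and \<open>k + 1\<close> powers of the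
        block mass balance it exactly; each further power tends to 0.\<close>
      have e: "C.\<eta> ^ (k + 1) * real n = c J ^ (k + 1)"
        unfolding \<eta> power_mult_distrib using u_pow[OF n] by (simp add: mult.assoc mult.commute[of "real n"])
      have "C.\<eta> ^ (k + 2) = C.\<eta> * C.\<eta> ^ (k + 1)" by simp
      then have "(2 * C.\<eta> ^ (k + 2) + C.\<eta> ^ (k + 2) * C.\<eta> ^ (k + 1)) * real n = 2 * C.\<eta> * (C.\<eta> ^ (k + 1) * real n) + C.\<eta> ^ (k + 2) * (C.\<eta> ^ (k + 1) * real n)"
        by (simp only: distrib_right mult.assoc)
      then show ?thesis unfolding T e unfolding \<eta> .
    qed
    have "\<bar>(\<Sum>q\<in>Q. C.tuple_integral q) - (\<integral>x. f x ^ (k + 2) \<partial>lborel) * IP\<bar> \<le>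
        E1 n + b ^ (k + 1) * IP * ((measure ?\<mu> C.seam + measure ?\<mu> C.outside) / real n)"
      unfolding E1_def IP_def by (rule C.sum_tuple_integral_error[OF f f_int n refl rho[OF n]])
    also have "\<dots> \<le> E1 n + b ^ (k + 1) * IP * (2 * real ?d / real J + 1 / real n)"
    proof -
      have "(measure ?\<mu> C.seam + measure ?\<mu> C.outside) / real n \<le> (real n * (2 * real ?d / real J) + 1 / real n) / real n"
        using seam out by (intro divide_right_mono add_mono) auto
      also have "\<dots> = 2 * real ?d / real J + 1 / real n / real n" using n by (simp add: add_divide_distrib)
      also have "\<dots> \<le> 2 * real ?d / real J + 1 / real n" using n by (simp add: divide_le_eq_1 field_simps)
      finally show ?thesis using b IP by (intro add_left_mono mult_left_mono) auto
    qed
    finally have I: "\<bar>(\<Sum>q\<in>Q. C.tuple_integral q) - (\<integral>x. f x ^ (k + 2) \<partial>lborel) * IP\<bar> \<le>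
      E1 n + b ^ (k + 1) * IP * (2 * real ?d / real J + 1 / real n)" .
    have "\<bar>(\<Sum>q\<in>Q. C.tuple_integral q) / fact (k + 2) - \<Lambda>\<bar> = \<bar>(\<Sum>q\<in>Q. C.tuple_integral q) - (\<integral>x. f x ^ (k + 2) \<partial>lborel) * IP\<bar> / fact (k + 2)"
      unfolding \<Lambda>_def by (simp only: diff_divide_distrib[symmetric] abs_divide abs_of_pos fact_gt_zero)
    also have "\<dots> \<le> \<bar>(\<Sum>q\<in>Q. C.tuple_integral q) - (\<integral>x. f x ^ (k + 2) \<partial>lborel) * IP\<bar> / 1"
      by (intro divide_left_mono fact_ge_1) auto
    finally have 3: "\<bar>(\<Sum>q\<in>Q. C.tuple_integral q) / fact (k + 2) - \<Lambda>\<bar> \<le> E1 n + b ^ (k + 1) * IP * (2 * real ?d / real J + 1 / real n)"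
      using I by simp
    have 4: "c0 / real J + r J n = 1 / real n + real (k + 2) * c3 ^ (k + 1) * (2 * real ?d / real J)
        + (2 * (c J * u n) * c J ^ (k + 1) + (c J * u n) ^ (k + 2) * c J ^ (k + 1))
        + (E1 n + b ^ (k + 1) * IP * (2 * real ?d / real J + 1 / real n))"
      unfolding c0_def r_def by (simp only: add_divide_distrib distrib_left times_divide_eq_right add_ac)
    from C.laplace_error[OF Y(1)[OF n] Y(2)[OF n] \<Lambda>] show ?thesis
      unfolding 4 using out 1 2 3 by linarith
  qed
  have c0: "0 \<le> c0" unfolding c0_def c3_def using b IP tm_pos by (intro add_nonneg_nonneg mult_nonneg_nonneg) auto
  have "(\<lambda>n. \<integral>\<omega>. Y n \<omega> \<partial>\<Omega> n) \<longlonglongrightarrow> exp (- \<Lambda>)"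
  proof (rule tendstoI)
    fix e :: real assume e: "0 < e"
    \<comment> \<open>The seam error does not depend on \<open>n\<close>, so \<open>J\<close> is
      chosen before \<open>n\<close> grows.\<close>
    obtain J :: nat where J: "2 * c0 / e < real J" using reals_Archimedean2 by blast
    moreover have "0 \<le> 2 * c0 / e" using c0 e by simp
    ultimately have J1: "1 \<le> J" by (cases J) auto
    have cJ: "c0 / real J < e / 2" using J J1 e by (simp add: field_simps)
    have "\<forall>\<^sub>F n in sequentially. r J n < e / 2" using r_lim[of J] e by (intro order_tendstoD(2)) auto
    then show "\<forall>\<^sub>F n in sequentially. dist (\<integral>\<omega>. Y n \<omega> \<partial>\<Omega> n) (exp (- \<Lambda>)) < e"
      using eventually_ge_at_top[of 1]
    proof eventually_elim
      case (elim n)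
      then show ?case using key[OF elim(2) J1] cJ unfolding dist_real_def by linarith
    qed
  qed
  then show ?thesis by (simp add: \<Lambda>_def IP_def)
qed

section \<open>Weak convergence of the Betti numbers\<close>

text \<open>The statistics are controlled only almost surely, for instance when the process has
  finitely many points. Each agrees almost everywhere with a measurable modification, through which
  measurability and integrals for the completion are obtained.\<close>

lemma
  fixes X X' :: "'w \<Rightarrow> 'c::topological_space"
  assumes X': "X' \<in> borel_measurable M" and eq: "AE \<omega> in M. X \<omega> = X' \<omega>"
  shows borel_measurable_completion_AE: "X \<in> borel_measurable (completion M)"
    and integral_completion_AE: "g \<in> borel_measurable borel \<Longrightarrow>
      integral\<^sup>L (completion M) (\<lambda>\<omega>. g (X \<omega>)) = (\<integral>\<omega>. g (X' \<omega>) \<partial>M :: real)"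
proof -
  have m: "X' \<in> borel_measurable (completion M)" by (rule measurable_completion[OF X'])
  show X: "X \<in> borel_measurable (completion M)"
  proof (rule measurableI)
    fix A :: "'c set" assume A: "A \<in> sets borel"
    have "Measurable.pred (completion M) (\<lambda>\<omega>. \<not> X \<omega> = X' \<omega>)"
      "Measurable.pred (completion M) (\<lambda>\<omega>. X \<omega> \<in> A \<and> \<not> X \<omega> = X' \<omega>)"
      using eq by (auto intro!: sets_completion_AE elim: eventually_mono)
    moreover have "Measurable.pred (completion M) (\<lambda>\<omega>. X' \<omega> \<in> A)" using m A by measurable
    moreover have "Measurable.pred (completion M) (\<lambda>\<omega>. (P \<omega> \<and> \<not> Q \<omega>) \<or> R \<omega>)"
      if "Measurable.pred (completion M) P" "Measurable.pred (completion M) Q" "Measurable.pred (completion M) R" for P Q R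
      using that by measurable
    ultimately have "Measurable.pred (completion M) (\<lambda>\<omega>. (X' \<omega> \<in> A \<and> \<not> \<not> X \<omega> = X' \<omega>) \<or> (X \<omega> \<in> A \<and> \<not> X \<omega> = X' \<omega>))"
      by blast
    moreover have "(\<lambda>\<omega>. (X' \<omega> \<in> A \<and> \<not> \<not> X \<omega> = X' \<omega>) \<or> (X \<omega> \<in> A \<and> \<not> X \<omega> = X' \<omega>)) = (\<lambda>\<omega>. X \<omega> \<in> A)" by auto
    ultimately have "Measurable.pred (completion M) (\<lambda>\<omega>. X \<omega> \<in> A)" by (simp only:)
    then have "{\<omega> \<in> space (completion M). X \<omega> \<in> A} \<in> sets (completion M)" by (simp only: pred_def)
    moreover have "{\<omega> \<in> space (completion M). X \<omega> \<in> A} = X -` A \<inter> space (completion M)" by auto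
    ultimately show "X -` A \<inter> space (completion M) \<in> sets (completion M)" by simp
  qed simp
  assume g: "g \<in> borel_measurable borel"
  have "(\<lambda>\<omega>. g (X' \<omega>)) \<in> borel_measurable M" using X' g by (rule measurable_compose)
  then have "(\<integral>\<omega>. g (X' \<omega>) \<partial>completion M) = (\<integral>\<omega>. g (X' \<omega>) \<partial>M)" by (rule integral_completion)
  moreover have "(\<integral>\<omega>. g (X \<omega>) \<partial>completion M) = (\<integral>\<omega>. g (X' \<omega>) \<partial>completion M)"
  proof (rule integral_cong_AE)
    show "(\<lambda>\<omega>. g (X \<omega>)) \<in> borel_measurable (completion M)" using X g by (rule measurable_compose)
    show "(\<lambda>\<omega>. g (X' \<omega>)) \<in> borel_measurable (completion M)" using m g by (rule measurable_compose)
    show "AE \<omega> in completion M. g (X \<omega>) = g (X' \<omega>)"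
      using AE_completion[OF eq] by eventually_elim simp
  qed
  ultimately show "(\<integral>\<omega>. g (X \<omega>) \<partial>completion M) = (\<integral>\<omega>. g (X' \<omega>) \<partial>M)" by simp
qed

lemma borel_measurable_nat_vec:
  fixes v :: "'w \<Rightarrow> 'm::finite \<Rightarrow> nat"
  assumes "\<And>i. (\<lambda>\<omega>. real (v \<omega> i)) \<in> borel_measurable M"
  shows "(\<lambda>\<omega>. nat_vec (v \<omega>)) \<in> borel_measurable M"
  unfolding borel_measurable_euclidean_space[where f = "\<lambda>\<omega>. nat_vec (v \<omega>)"]
  using assms by (auto simp: Basis_vec_def inner_axis nat_vec_def)

lemma integral_scale_measure_nonneg:
  fixes f :: "'b \<Rightarrow> real"
  assumes "f \<in> borel_measurable \<mu>" "\<And>x. 0 \<le> f x" "0 \<le> C"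
  shows "(\<integral>x. f x \<partial>scale_measure (ennreal C) \<mu>) = C * (\<integral>x. f x \<partial>\<mu>)"
proof -
  have "(\<integral>x. f x \<partial>scale_measure (ennreal C) \<mu>) = enn2real (\<integral>\<^sup>+x. ennreal (f x) \<partial>scale_measure (ennreal C) \<mu>)"
    using assms by (intro integral_eq_nn_integral) auto
  also have "\<dots> = C * enn2real (\<integral>\<^sup>+x. ennreal (f x) \<partial>\<mu>)"
    using assms by (simp add: nn_integral_scale_measure enn2real_mult)
  also have "enn2real (\<integral>\<^sup>+x. ennreal (f x) \<partial>\<mu>) = (\<integral>x. f x \<partial>\<mu>)"
    using assms by (intro integral_eq_nn_integral[symmetric]) auto
  finally show ?thesis .
qed

context poisson_rm begin

text \<open>Rounding produces natural values for every \<open>\<omega>\<close>; by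
  \<open>AE_count\<close> it almost surely changes nothing on sets of finite mass.\<close>

definition count :: "'b set \<Rightarrow> 'w \<Rightarrow> nat" where "count A \<omega> = nat \<lfloor>measure (N \<omega>) A\<rfloor>"

lemma AE_count:
  assumes "A \<in> sets \<mu>" "emeasure \<mu> A < \<infinity>"
  shows "AE \<omega> in \<Omega>. measure (N \<omega>) A = real (count A \<omega>)"
  using AE_N_nat[OF assms] by eventually_elim (auto simp: measure_def count_def)

lemma lattice_vector_count:
  fixes A :: "'m::finite \<Rightarrow> 'b set"
  assumes "\<And>i. A i \<in> sets \<mu>"
  shows "lattice_vector \<Omega> (\<lambda>\<omega>. nat_vec (\<lambda>i. count (A i) \<omega>))"
proof
  have [measurable]: "(\<lambda>\<omega>. measure (N \<omega>) (A i)) \<in> borel_measurable \<Omega>" for i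
    unfolding measure_def using measurable_N[OF assms[of i]] by measurable
  show "(\<lambda>\<omega>. nat_vec (\<lambda>i. count (A i) \<omega>)) \<in> borel_measurable \<Omega>"
    by (rule borel_measurable_nat_vec) (unfold count_def, measurable)
qed auto

end

lemma lattice_vector_betti:
  fixes P :: "'w \<Rightarrow> (real^'d::finite) set" and c :: "'m::finite \<Rightarrow> real"
  assumes "poisson_proc \<Omega> \<mu> P"
  shows "lattice_vector \<Omega> (\<lambda>\<omega>. nat_vec (\<lambda>i. betti_number k (cech_complex (if finite (P \<omega>) then P \<omega> else {}) (c i))))"
proof -
  interpret poisson_proc \<Omega> \<mu> P by fact
  show ?thesis
    by unfold_locales (auto intro!: borel_measurable_nat_vec measurable_betti_number[OF assms])
qed

text \<open>\<open>cech_h\<close> is the indicator of a set \<open>A i\<close> whose Lebesgue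
  measure is finite because relative coordinates are bounded by \<open>t i\<close>. The stochastic
  integral is therefore the count of \<open>A i\<close>, and the Laplace functional of these
  overlapping sets applies.\<close>

lemma limit_vector:
  fixes t :: "'m::finite \<Rightarrow> real" and N :: "'w \<Rightarrow> (nat \<Rightarrow> 'a::euclidean_space) measure"
  assumes N: "poisson_rm \<Omega> N (scale_measure (ennreal C) (lborel_power (k + 1)))" and C: "0 \<le> C" and k: "1 \<le> k"
  obtains V where "lattice_vector \<Omega> V" "AE \<omega> in \<Omega>. (\<chi> i. \<integral>y. cech_h k (t i) (case_nat 0 y) \<partial>N \<omega>) = V \<omega>"
    "\<And>a. (\<And>i. 0 \<le> a i) \<Longrightarrow> (\<integral>\<omega>. exp (- (\<Sum>i\<in>UNIV. a i * V \<omega> $ i)) \<partial>\<Omega>) =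
      exp (- (C * (\<integral>y. Psi k a t (y :: nat \<Rightarrow> 'a) \<partial>lborel_power (k + 1))))"
proof
  let ?L = "lborel_power (k + 1) :: (nat \<Rightarrow> 'a) measure"
  let ?\<mu> = "scale_measure (ennreal C) ?L"
  interpret poisson_rm \<Omega> N ?\<mu> by (rule N)
  define A where "A i = {y \<in> space ?L. cech_h k (t i) (case_nat 0 y) = 1}" for i
  have A_L: "A i \<in> sets ?L" for i
    unfolding A_def using measurable_cech_h_origin by measurable
  then have A_sets: "A i \<in> sets ?\<mu>" for i by simp
  have A_fin: "emeasure ?\<mu> (A i) < \<infinity>" for i
  proof -
    let ?S = "\<Pi>\<^sub>E l\<in>{..<k + 1}. cball (0 :: 'a) (t i)"
    have "A i \<subseteq> ?S"
    proof
      fix y assume y: "y \<in> A i"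
      then have "norm (y l) < t i" if "l < k + 1" for l
        using that k by (intro cech_h_origin_support[of k "t i" y]) (auto simp: A_def)
      then show "y \<in> ?S" using y by (auto simp: A_def space_PiM PiE_iff less_imp_le)
    qed
    moreover have "?S \<in> sets ?L" by (intro sets_PiM_I_finite) auto
    ultimately have "emeasure ?L (A i) \<le> emeasure ?L ?S" by (rule emeasure_mono)
    also have "\<dots> < \<infinity>" by (rule emeasure_power_cball)
    finally show ?thesis by (simp add: ennreal_mult_less_top)
  qed
  have h_ind: "cech_h k (t i) (case_nat 0 y) = indicator (A i) y" if "y \<in> space ?L" for i y
    using that by (simp add: A_def indicator_def cech_h_eq)
  let ?V = "\<lambda>\<omega>. nat_vec (\<lambda>i. count (A i) \<omega>)"
  show "lattice_vector \<Omega> ?V" by (rule lattice_vector_count[OF A_sets])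
  have AE_all: "AE \<omega> in \<Omega>. \<forall>i\<in>UNIV. measure (N \<omega>) (A i) = real (count (A i) \<omega>)"
    by (intro AE_finite_allI AE_count A_sets A_fin) simp
  show "AE \<omega> in \<Omega>. (\<chi> i. \<integral>y. cech_h k (t i) (case_nat 0 y) \<partial>N \<omega>) = ?V \<omega>"
    using AE_all AE_space
  proof eventually_elim
    case (elim \<omega>)
    have sets: "sets (N \<omega>) = sets ?L" using sets_N[OF elim(2)] by simp
    then have space: "space (N \<omega>) = space ?L" by (rule sets_eq_imp_space_eq)
    have "(\<integral>y. cech_h k (t i) (case_nat 0 y) \<partial>N \<omega>) = measure (N \<omega>) (A i)" for i
    proof -
      have "(\<integral>y. cech_h k (t i) (case_nat 0 y) \<partial>N \<omega>) = (\<integral>y. indicator (A i) y \<partial>N \<omega>)"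
        using space by (intro Bochner_Integration.integral_cong h_ind) auto
      also have "\<dots> = measure (N \<omega>) (A i \<inter> space (N \<omega>))" by simp
      also have "A i \<inter> space (N \<omega>) = A i" unfolding space by (auto simp: A_def)
      finally show ?thesis .
    qed
    then show ?case using elim(1) by (simp add: nat_vec_def)
  qed
  fix a :: "'m \<Rightarrow> real" assume a: "\<And>i. 0 \<le> a i"
  have "(\<integral>\<omega>. exp (- (\<Sum>i\<in>UNIV. a i * ?V \<omega> $ i)) \<partial>\<Omega>) = expectation (\<lambda>\<omega>. exp (- (\<Sum>i\<in>UNIV. a i * measure (N \<omega>) (A i))))"
  proof (rule integral_cong_AE)
    have [measurable]: "(\<lambda>\<omega>. measure (N \<omega>) (A i)) \<in> borel_measurable \<Omega>" for i
      unfolding measure_def using measurable_N[OF A_sets[of i]] by measurable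
    show "(\<lambda>\<omega>. exp (- (\<Sum>i\<in>UNIV. a i * measure (N \<omega>) (A i)))) \<in> borel_measurable \<Omega>" by measurable
    show "(\<lambda>\<omega>. exp (- (\<Sum>i\<in>UNIV. a i * ?V \<omega> $ i))) \<in> borel_measurable \<Omega>"
      unfolding nat_vec_def vec_lambda_beta count_def by measurable
    show "AE \<omega> in \<Omega>. exp (- (\<Sum>i\<in>UNIV. a i * ?V \<omega> $ i)) = exp (- (\<Sum>i\<in>UNIV. a i * measure (N \<omega>) (A i)))"
      using AE_all by eventually_elim (simp add: nat_vec_def)
  qed
  also have "\<dots> = exp (- (\<integral>y. 1 - exp (- (\<Sum>i\<in>UNIV. a i * indicator (A i) y)) \<partial>?\<mu>))"
    by (rule laplace_functional) (use A_sets A_fin a in auto)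
  also have "(\<integral>y. 1 - exp (- (\<Sum>i\<in>UNIV. a i * indicator (A i) y)) \<partial>?\<mu>) = (\<integral>y. Psi k a t y \<partial>?\<mu>)"
    unfolding Psi_def by (intro Bochner_Integration.integral_cong refl) (simp add: space_scale_measure h_ind)
  also have "\<dots> = C * (\<integral>y. Psi k a t y \<partial>?L)"
    by (intro integral_scale_measure_nonneg measurable_Psi Psi_bounds a C)
  finally show "(\<integral>\<omega>. exp (- (\<Sum>i\<in>UNIV. a i * ?V \<omega> $ i)) \<partial>\<Omega>) = exp (- (C * (\<integral>y. Psi k a t y \<partial>?L)))" .
qed

theorem theorem5p2:
  fixes f :: "real^'d \<Rightarrow> real" and s :: "nat \<Rightarrow> real" and k :: nat
    and \<Omega> :: "nat \<Rightarrow> 'w measure" and P :: "nat \<Rightarrow> 'w \<Rightarrow> (real^'d) set"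
    and \<Omega>' :: "'v measure" and M :: "'v \<Rightarrow> (nat \<Rightarrow> real^'d) measure"
    and C :: real and t :: "'m::{finite,linorder} \<Rightarrow> real"
  assumes d: "CARD('d) \<ge> 2" and k: "1 \<le> k" "k < CARD('d)"
    and f_density: "f \<in> borel_measurable borel" "\<And>x. f x \<ge> 0"
      "prob_space (density lborel (\<lambda>x. ennreal (f x)))"
    and f_bounded: "\<exists>B. AE x in lborel. f x \<le> B"
    and f_cont: "AE x in lborel. isCont f x"
    and s_pos: "\<And>n. n \<ge> 1 \<Longrightarrow> s n > 0"
    and rho: "\<And>n. n \<ge> 1 \<Longrightarrow> real n ^ (k + 2) * s n ^ (CARD('d) * (k + 1)) = 1"
    and P: "\<And>n. n \<ge> 1 \<Longrightarrow>
      poisson_process (\<Omega> n) (P n) (density lborel (\<lambda>x. ennreal (real n * f x)))"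
    and C: "C = 1 / fact (k + 2) * (\<integral>x. f x ^ (k + 2) \<partial>lborel)"
    and M: "poisson_random_measure \<Omega>' M
      (scale_measure (ennreal C) (\<Pi>\<^sub>M j\<in>{..<k+1}. (lborel :: (real^'d) measure)))"
    and t: "strict_mono t" "\<And>i. t i > 0"
  shows "converges_weakly
    \<Omega> (\<lambda>n \<omega>. \<chi> i. real (betti_number k (cech_complex (P n \<omega>) (s n * t i))))
    \<Omega>' (\<lambda>\<omega>. \<chi> i. \<integral>y. cech_h k (t i) (case_nat 0 y) \<partial>M \<omega>)"
proof -
  obtain B where B: "AE x in lborel. f x \<le> B" using f_bounded by blast
  \<comment> \<open>Capping \<open>f\<close> turns its essential bound into a bound everywhere. The
    intensity measures stay the same, \<open>min\<close> preserves points of continuity, and the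
    maximum with 0 keeps \<open>f'\<close> nonnegative.\<close>
  define b where "b = max B 0"
  define f' where "f' x = min (f x) b" for x
  have f'_meas: "f' \<in> borel_measurable borel" unfolding f'_def[abs_def] using f_density(1) by measurable
  have f'_bounds: "0 \<le> f' x" "f' x \<le> b" for x using f_density(2)[of x] by (auto simp: f'_def b_def)
  have f'_eq: "AE x in lborel. f x = f' x" using B by eventually_elim (auto simp: f'_def b_def)
  have density_eq: "density lborel (\<lambda>x. ennreal (real n * f x)) = density lborel (\<lambda>x. ennreal (real n * f' x))" for n
    using f'_eq f_density(1) f'_meas by (intro density_cong) (auto elim!: eventually_mono)
  have density': "prob_space (density lborel (\<lambda>x. ennreal (f' x)))"
    using f_density(3) density_eq[of 1] by simp
  have cont': "AE x in lborel. isCont f' x"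
    using f_cont unfolding f'_def[abs_def] by eventually_elim (unfold continuous_at, intro tendsto_min tendsto_const)
  have P': "poisson_process (\<Omega> n) (P n) (density lborel (\<lambda>x. ennreal (real n * f' x)))" if "1 \<le> n" for n
    using P[OF that] unfolding density_eq .
  have C': "C = (\<integral>x. f' x ^ (k + 2) \<partial>lborel) / fact (k + 2)"
  proof -
    have "(\<integral>x. f x ^ (k + 2) \<partial>lborel) = (\<integral>x. f' x ^ (k + 2) \<partial>lborel)"
      using f_density(1) f'_meas f'_eq by (intro integral_cong_AE) (auto elim!: eventually_mono)
    then show ?thesis by (simp add: C)
  qed
  have C_nonneg: "0 \<le> C"
    unfolding C' using f'_bounds(1) by (intro divide_nonneg_pos integral_nonneg_AE) auto
  interpret M: poisson_rm \<Omega>' M "scale_measure (ennreal C) (lborel_power (k + 1))"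
    using M by (auto simp: poisson_random_measure_def intro!: poisson_rm.intro poisson_rm_axioms.intro)
  obtain V where V: "lattice_vector \<Omega>' V"
      "AE \<omega> in \<Omega>'. (\<chi> i. \<integral>y. cech_h k (t i) (case_nat 0 y) \<partial>M \<omega>) = V \<omega>"
      "\<And>a. (\<And>i. 0 \<le> a i) \<Longrightarrow> M.expectation (\<lambda>\<omega>. exp (- (\<Sum>i\<in>UNIV. a i * V \<omega> $ i))) =
        exp (- (C * (\<integral>y. Psi k a t (y :: nat \<Rightarrow> real^'d) \<partial>lborel_power (k + 1))))"
    using limit_vector[OF M.poisson_rm_axioms C_nonneg k(1), of t] by blast
  \<comment> \<open>On the null event of infinitely many points the empty set is substituted, which
    gives a vector measurable without completion.\<close>
  define X where "X n \<omega> = nat_vec (\<lambda>i. betti_number k (cech_complex (if finite (P n \<omega>) then P n \<omega> else {}) (s n * t i)))" for n \<omega>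
  have proc: "poisson_proc (\<Omega> n) (density lborel (\<lambda>x. ennreal (real n * f x))) (P n)" if n: "1 \<le> n" for n
  proof -
    let ?\<mu> = "density lborel (\<lambda>x. ennreal (real n * f x))"
    interpret \<nu>: prob_space "density lborel (\<lambda>x. ennreal (f x))" by (rule f_density(3))
    have "emeasure ?\<mu> (space ?\<mu>) = ennreal (real n) * emeasure (density lborel (\<lambda>x. ennreal (f x))) UNIV"
      using f_density(1,2) by (simp add: emeasure_density ennreal_mult' nn_integral_cmult)
    then have "finite_measure ?\<mu>"
      using \<nu>.emeasure_space_1 by (intro finite_measureI) (simp add: ennreal_mult_eq_top_iff)
    moreover have "prob_space (\<Omega> n)" using P[OF n] by (simp add: poisson_process_def poisson_random_measure_def)
    ultimately show ?thesis
      using P[OF n] by (intro poisson_proc.intro poisson_proc_axioms.intro) auto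
  qed
  have X: "lattice_vector (\<Omega> n) (X n)" if "1 \<le> n" for n
    unfolding X_def[abs_def] by (rule lattice_vector_betti[OF proc[OF that]])
  have X_eq: "AE \<omega> in \<Omega> n. (\<chi> i. real (betti_number k (cech_complex (P n \<omega>) (s n * t i)))) = X n \<omega>" if "1 \<le> n" for n
    using poisson_proc.AE_finite[OF proc[OF that]] by eventually_elim (simp add: X_def nat_vec_def)
  have laplace: "(\<lambda>n. \<integral>\<omega>. exp (- (\<Sum>i\<in>UNIV. real (a i) * X n \<omega> $ i)) \<partial>\<Omega> n)
      \<longlonglongrightarrow> (\<integral>\<omega>. exp (- (\<Sum>i\<in>UNIV. real (a i) * V \<omega> $ i)) \<partial>\<Omega>')" for a :: "'m \<Rightarrow> nat"
  proof -
    have "(\<lambda>n. \<integral>\<omega>. exp (- (\<Sum>i\<in>UNIV. real (a i) * X n \<omega> $ i)) \<partial>\<Omega> n) \<longlonglongrightarrow>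
      exp (- ((\<integral>x. f' x ^ (k + 2) \<partial>lborel) * (\<integral>y. Psi k (\<lambda>i. real (a i)) t (y :: nat \<Rightarrow> real^'d) \<partial>lborel_power (k + 1)) / fact (k + 2)))"
    proof (rule laplace_betti_limit[OF k(1) f'_meas f'_bounds density' cont' s_pos rho P' t(2)])
      fix n :: nat assume n: "1 \<le> n"
      show "(\<lambda>\<omega>. exp (- (\<Sum>i\<in>UNIV. real (a i) * X n \<omega> $ i))) \<in> borel_measurable (\<Omega> n)"
        by (rule measurable_compose[OF lattice_vector.X[OF X[OF n]]], rule borel_measurable_continuous_onI)
          (intro continuous_intros)
      show "AE \<omega> in \<Omega> n. exp (- (\<Sum>i\<in>UNIV. real (a i) * X n \<omega> $ i)) =
          exp (- (\<Sum>i\<in>UNIV. real (a i) * real (betti_number k (cech_complex (P n \<omega>) (s n * t i)))))"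
        using X_eq[OF n]
      proof eventually_elim
        case (elim \<omega>)
        show ?case unfolding elim[symmetric] by simp
      qed
    qed auto
    also have "exp (- ((\<integral>x. f' x ^ (k + 2) \<partial>lborel) * (\<integral>y. Psi k (\<lambda>i. real (a i)) t (y :: nat \<Rightarrow> real^'d) \<partial>lborel_power (k + 1)) / fact (k + 2)))
        = (\<integral>\<omega>. exp (- (\<Sum>i\<in>UNIV. real (a i) * V \<omega> $ i)) \<partial>\<Omega>')"
      \<comment> \<open>The factor \<open>1 / fact (k + 2)\<close>, which counts unordered
        configurations, is absorbed in \<open>C\<close>.\<close>
      by (subst V(3)) (simp_all add: C')
    finally show ?thesis .
  qed
  interpret V: lattice_vector \<Omega>' V by (rule V(1))
  show ?thesis
    unfolding converges_weakly_def
  proof (intro conjI allI impI)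
    show "\<forall>\<^sub>F n in sequentially. (\<lambda>\<omega>. \<chi> i. real (betti_number k (cech_complex (P n \<omega>) (s n * t i)))) \<in> borel_measurable (completion (\<Omega> n))"
      using eventually_ge_at_top[of 1]
      by eventually_elim (rule borel_measurable_completion_AE[OF lattice_vector.X[OF X] X_eq])
    show "(\<lambda>\<omega>. \<chi> i. \<integral>y. cech_h k (t i) (case_nat 0 y) \<partial>M \<omega>) \<in> borel_measurable (completion \<Omega>')"
      by (rule borel_measurable_completion_AE[OF V.X V(2)])
    fix g :: "(real, 'm) vec \<Rightarrow> real" assume g: "continuous_on UNIV g" "bounded (range g)"
    have gm: "g \<in> borel_measurable borel" using g(1) by (rule borel_measurable_continuous_onI)
    \<comment> \<open>The assumptions hold from index 1 on, whereas
      \<open>lattice_weak_convergence\<close> asks for every index; the shift reconciles the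
      two.\<close>
    have "(\<lambda>n. \<integral>\<omega>. g (X (Suc n) \<omega>) \<partial>\<Omega> (Suc n)) \<longlonglongrightarrow> (\<integral>\<omega>. g (V \<omega>) \<partial>\<Omega>')"
    proof (rule lattice_weak_convergence[OF _ V(1) _ g])
      show "lattice_vector (\<Omega> (Suc n)) (X (Suc n))" for n by (rule X) simp
      show "(\<lambda>n. \<integral>\<omega>. exp (- (\<Sum>i\<in>UNIV. real (a i) * X (Suc n) \<omega> $ i)) \<partial>\<Omega> (Suc n))
          \<longlonglongrightarrow> (\<integral>\<omega>. exp (- (\<Sum>i\<in>UNIV. real (a i) * V \<omega> $ i)) \<partial>\<Omega>')" for a
        by (rule LIMSEQ_Suc[OF laplace])
    qed
    then have "(\<lambda>n. \<integral>\<omega>. g (X n \<omega>) \<partial>\<Omega> n) \<longlonglongrightarrow> (\<integral>\<omega>. g (V \<omega>) \<partial>\<Omega>')" by (rule LIMSEQ_imp_Suc)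
    moreover have "\<forall>\<^sub>F n in sequentially. (\<integral>\<omega>. g (X n \<omega>) \<partial>\<Omega> n) =
        (\<integral>\<omega>. g (\<chi> i. real (betti_number k (cech_complex (P n \<omega>) (s n * t i)))) \<partial>completion (\<Omega> n))"
      using eventually_ge_at_top[of 1]
      by eventually_elim (rule integral_completion_AE[OF lattice_vector.X[OF X] X_eq gm, symmetric])
    ultimately have "(\<lambda>n. \<integral>\<omega>. g (\<chi> i. real (betti_number k (cech_complex (P n \<omega>) (s n * t i)))) \<partial>completion (\<Omega> n))
        \<longlonglongrightarrow> (\<integral>\<omega>. g (V \<omega>) \<partial>\<Omega>')"
      by (rule Lim_transform_eventually)
    then show "(\<lambda>n. \<integral>\<omega>. g (\<chi> i. real (betti_number k (cech_complex (P n \<omega>) (s n * t i)))) \<partial>completion (\<Omega> n))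
        \<longlonglongrightarrow> (\<integral>\<omega>. g (\<chi> i. \<integral>y. cech_h k (t i) (case_nat 0 y) \<partial>M \<omega>) \<partial>completion \<Omega>')"
      by (simp only: integral_completion_AE[OF V.X V(2) gm])
  qed
qed

end
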